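(* Suppose $\Theta$ is a compact metric space, $\omega:\Theta\to\Theta$ is a minimal homeomorphism, $X$ is a Riemannian manifold, $f$ is an $\omega$-forced $C^1$-map on $\Theta\times X$ and $K$ is a (non-empty) compact invariant set of $f$. Further, assume that $\lambda_{\max}(\nu)<0$ for all $f$-invariant ergodic measures $\nu$ supported on $K$. Then there exist $k\in\mathbb{N}$ and a continuous map $\psi=(\psi_1,\ldots,\psi_k):\Theta\to X_k$ such that $K$ is the graph of $\psi$, that is, $$K=\{(\theta,\psi_i(\theta)) : \theta\in\Theta,\ i=1,\ldots,k\}.$$
   Context: Measures are Borel probability measures. $X$ carries the canonical distance function $d$ induced by the Riemannian metric. An $\omega$-forced $C^1$-map is a continuous map $f:\Theta\times X\to\Theta\times X$, $f(\theta,x)=(\omega(\theta),f_\theta(x))$, whose fibre maps $f_\theta:X\to X$ are $C^1$ with derivative $Df_\theta(x)$ depending continuously on $(\theta,x)$. Write $f^n_\theta$ for the fibre maps of $f^n$, i.e. $f^n(\theta,x)=(\omega^n(\theta),f^n_\theta(x))$. A set $K$ is invariant if $f(K)=K$. The upper Lyapunov exponent of $(\theta,x)$ is $\lambda_{\max}(\theta,x)=\limsup_{n\to\infty}\frac1n\log\|Df^n_\theta(x)\|$, and for an $f$-invariant measure $\nu$ one sets $\lambda_{\max}(\nu)=\int\lambda_{\max}(\theta,x)\,d\nu(\theta,x)$. $X_k=\{x=(x_1,\ldots,x_k)\in X^k : x_i\ne x_j\text{ if }i\ne j\}$ is endowed with the Hausdorff topology, i.e. a point of $X_k$ is identified with the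 set $\{x_1,\ldots,x_k\}$ of its $k$ distinct entries, and continuity of $\psi$ means that $\theta\mapsto\{\psi_1(\theta),\ldots,\psi_k(\theta)\}$ is continuous with respect to the Hausdorff distance on compact subsets of $X$. *)

theory Defs
  imports "HOL-Analysis.Analysis"
begin

section \<open>Riemannian manifolds\<close>

text \<open>
  A chart is a pair of its domain and its coordinate map; the values of the coordinate map
  outside the domain are irrelevant.  Manifolds are modelled on a normed space of sort
  \<open>{real_normed_vector, heine_borel}\<close>: these are precisely the finite-dimensional normed spaces,
  and in contrast to \<open>euclidean_space\<close> dimension zero is included.  The Hausdorff and
  second countability axioms are imposed by the sort of the point type.
\<close>

type_synonym ('x, 'e) chart = "'x set \<times> ('x \<Rightarrow> 'e)"

definition is_chart :: "('x::topological_space, 'e::real_normed_vector) chart \<Rightarrow> bool" where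
  "is_chart c \<longleftrightarrow> open (fst c) \<and> open (snd c ` fst c) \<and>
     homeomorphism (fst c) (snd c ` fst c) (snd c) (inv_into (fst c) (snd c))"

text \<open>
  The map \<open>h\<close> read in the charts \<open>c\<close> (source) and \<open>c'\<close> (target).  It is meaningful on the image
  under \<open>c\<close> of the points \<open>x\<close> in the domain of \<open>c\<close> with \<open>h x\<close> in the domain of \<open>c'\<close>; for
  continuous \<open>h\<close> this image is open, so derivatives there are not affected by values elsewhere.
\<close>

definition local_rep ::
    "('x, 'e) chart \<Rightarrow> ('x, 'e) chart \<Rightarrow> ('x \<Rightarrow> 'x) \<Rightarrow> 'e \<Rightarrow> 'e" where
  "local_rep c c' h = snd c' \<circ> h \<circ> inv_into (fst c) (snd c)"

text \<open>
  \<open>C\<^sup>n\<close> maps on an open subset of a finite-dimensional space, by means of iterated directional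
  derivatives.
\<close>

primrec Ck_on ::
    "nat \<Rightarrow> ('e::real_normed_vector \<Rightarrow> 'f::real_normed_vector) \<Rightarrow> 'e set \<Rightarrow> bool" where
  "Ck_on 0 h S \<longleftrightarrow> continuous_on S h"
| "Ck_on (Suc n) h S \<longleftrightarrow> (\<forall>y\<in>S. h differentiable (at y)) \<and>
     (\<forall>v. Ck_on n (\<lambda>y. frechet_derivative h (at y) v) S)"

definition smooth_on ::
    "'e set \<Rightarrow> ('e::real_normed_vector \<Rightarrow> 'f::real_normed_vector) \<Rightarrow> bool" where
  "smooth_on S h \<longleftrightarrow> (\<forall>n. Ck_on n h S)"

definition smooth_atlas ::
    "('x::{t2_space, second_countable_topology}, 'e::{real_normed_vector, heine_borel}) chart set \<Rightarrow> bool" where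
  "smooth_atlas A \<longleftrightarrow> (\<forall>c\<in>A. is_chart c) \<and> (\<Union>c\<in>A. fst c) = UNIV \<and>
     (\<forall>c\<in>A. \<forall>c'\<in>A. smooth_on (snd c ` (fst c \<inter> fst c')) (local_rep c c' (\<lambda>x. x)))"

text \<open>
  A Riemannian metric is given by its coordinate expressions: \<open>g c x\<close> is the inner product of the
  tangent space at \<open>x\<close> when tangent vectors are written in the coordinates of the chart \<open>c\<close>.
\<close>

definition riemannian_manifold ::
    "('x::{t2_space, second_countable_topology}, 'e::{real_normed_vector, heine_borel}) chart set \<Rightarrow>
     (('x, 'e) chart \<Rightarrow> 'x \<Rightarrow> 'e \<Rightarrow>\<^sub>L 'e \<Rightarrow>\<^sub>L real) \<Rightarrow> bool" where
  "riemannian_manifold A g \<longleftrightarrow> smooth_atlas A \<and>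
     (\<forall>c\<in>A. smooth_on (snd c ` fst c) (\<lambda>y. g c (inv_into (fst c) (snd c) y)) \<and>
        (\<forall>x\<in>fst c. (\<forall>v w. g c x v w = g c x w v) \<and> (\<forall>v. v \<noteq> 0 \<longrightarrow> g c x v v > 0))) \<and>
     (\<forall>c\<in>A. \<forall>c'\<in>A. \<forall>x\<in>fst c \<inter> fst c'. \<forall>v w.
        g c x v w =
          (let D = frechet_derivative (local_rep c c' (\<lambda>x. x)) (at (snd c x))
           in g c' x (D v) (D w)))"

text \<open>Quantities computed with \<open>chart_at A x\<close> below do not depend on the choice of the chart.\<close>

definition chart_at :: "('x, 'e) chart set \<Rightarrow> 'x \<Rightarrow> ('x, 'e) chart" where
  "chart_at A x = (SOME c. c \<in> A \<and> x \<in> fst c)"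

definition C1_curve_on ::
    "('x::topological_space, 'e::real_normed_vector) chart set \<Rightarrow> (real \<Rightarrow> 'x) \<Rightarrow> real \<Rightarrow> real \<Rightarrow> bool" where
  "C1_curve_on A \<gamma> a b \<longleftrightarrow> continuous_on {a..b} \<gamma> \<and>
     (\<forall>c\<in>A. let T = {t \<in> {a..b}. \<gamma> t \<in> fst c} in
        (\<forall>t\<in>T. (snd c \<circ> \<gamma>) differentiable (at t within {a..b})) \<and>
        continuous_on T (\<lambda>t. vector_derivative (snd c \<circ> \<gamma>) (at t within {a..b})))"

definition piecewise_C1_curve ::
    "('x::topological_space, 'e::real_normed_vector) chart set \<Rightarrow> (real \<Rightarrow> 'x) \<Rightarrow> bool" where
  "piecewise_C1_curve A \<gamma> \<longleftrightarrow>
     (\<exists>n (s :: nat \<Rightarrow> real). s 0 = 0 \<and> s n = 1 \<and>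
        (\<forall>i<n. s i < s (Suc i) \<and> C1_curve_on A \<gamma> (s i) (s (Suc i))))"

definition speed ::
    "('x, 'e::real_normed_vector) chart set \<Rightarrow> (('x, 'e) chart \<Rightarrow> 'x \<Rightarrow> 'e \<Rightarrow>\<^sub>L 'e \<Rightarrow>\<^sub>L real) \<Rightarrow>
     (real \<Rightarrow> 'x) \<Rightarrow> real \<Rightarrow> real" where
  "speed A g \<gamma> t =
     (let c = chart_at A (\<gamma> t); v = vector_derivative (snd c \<circ> \<gamma>) (at t)
      in sqrt (g c (\<gamma> t) v v))"

text \<open>
  The Riemannian distance is the infimum of the lengths of piecewise \<open>C\<^sup>1\<close> curves (the speed may be
  arbitrary at the finitely many break points).  Points in different components have distance
  infinity.
\<close>

definition riemannian_dist ::
    "('x::topological_space, 'e::real_normed_vector) chart set \<Rightarrow>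
     (('x, 'e) chart \<Rightarrow> 'x \<Rightarrow> 'e \<Rightarrow>\<^sub>L 'e \<Rightarrow>\<^sub>L real) \<Rightarrow> 'x \<Rightarrow> 'x \<Rightarrow> ennreal" where
  "riemannian_dist A g x y =
     (INF \<gamma>\<in>{\<gamma>. piecewise_C1_curve A \<gamma> \<and> \<gamma> 0 = x \<and> \<gamma> 1 = y}. ennreal (integral {0..1} (speed A g \<gamma>)))"

definition hausdorff_dist :: "('x \<Rightarrow> 'x \<Rightarrow> ennreal) \<Rightarrow> 'x set \<Rightarrow> 'x set \<Rightarrow> ennreal" where
  "hausdorff_dist d S T = max (SUP x\<in>S. INF y\<in>T. d x y) (SUP y\<in>T. INF x\<in>S. d x y)"

text \<open>
  The operator norm of \<open>Dh(x)\<close> from the tangent space at \<open>x\<close> to the one at \<open>h x\<close>, both with the norm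
  of the Riemannian metric.
\<close>

definition deriv_norm ::
    "('x, 'e::real_normed_vector) chart set \<Rightarrow> (('x, 'e) chart \<Rightarrow> 'x \<Rightarrow> 'e \<Rightarrow>\<^sub>L 'e \<Rightarrow>\<^sub>L real) \<Rightarrow>
     ('x \<Rightarrow> 'x) \<Rightarrow> 'x \<Rightarrow> real" where
  "deriv_norm A g h x =
     (let c = chart_at A x; c' = chart_at A (h x);
          D = frechet_derivative (local_rep c c' h) (at (snd c x))
      in SUP v\<in>{v. sqrt (g c x v v) \<le> 1}. sqrt (g c' (h x) (D v) (D v)))"


section \<open>Forced maps\<close>

definition minimal_homeomorphism :: "('t::topological_space \<Rightarrow> 't) \<Rightarrow> bool" where
  "minimal_homeomorphism \<omega> \<longleftrightarrow> (\<exists>\<omega>'. homeomorphism UNIV UNIV \<omega> \<omega>') \<and>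
     (\<forall>S. closed S \<and> \<omega> ` S = S \<longrightarrow> S = {} \<or> S = UNIV)"

definition fibre_map :: "('t \<times> 'x \<Rightarrow> 't \<times> 'x) \<Rightarrow> nat \<Rightarrow> 't \<Rightarrow> 'x \<Rightarrow> 'x" where
  "fibre_map f n \<theta> x = snd ((f ^^ n) (\<theta>, x))"

definition forced_C1_map ::
    "('x::topological_space, 'e::real_normed_vector) chart set \<Rightarrow> ('t::topological_space \<Rightarrow> 't) \<Rightarrow>
     ('t \<times> 'x \<Rightarrow> 't \<times> 'x) \<Rightarrow> bool" where
  "forced_C1_map A \<omega> f \<longleftrightarrow> continuous_on UNIV f \<and> (\<forall>\<theta> x. fst (f (\<theta>, x)) = \<omega> \<theta>) \<and>
     (\<forall>c\<in>A. \<forall>c'\<in>A. let W = {(\<theta>, x). x \<in> fst c \<and> fibre_map f 1 \<theta> x \<in> fst c'} in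
        (\<forall>(\<theta>, x)\<in>W. local_rep c c' (fibre_map f 1 \<theta>) differentiable (at (snd c x))) \<and>
        continuous_on W (\<lambda>(\<theta>, x).
          Blinfun (frechet_derivative (local_rep c c' (fibre_map f 1 \<theta>)) (at (snd c x)))))"


section \<open>Invariant measures and Lyapunov exponents\<close>

definition invariant_measure :: "('a::topological_space \<Rightarrow> 'a) \<Rightarrow> 'a measure \<Rightarrow> bool" where
  "invariant_measure f \<nu> \<longleftrightarrow>
     sets \<nu> = sets borel \<and> emeasure \<nu> (space \<nu>) = 1 \<and> distr \<nu> borel f = \<nu>"

definition ergodic_measure :: "('a::topological_space \<Rightarrow> 'a) \<Rightarrow> 'a measure \<Rightarrow> bool" where
  "ergodic_measure f \<nu> \<longleftrightarrow> invariant_measure f \<nu> \<and>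
     (\<forall>B\<in>sets borel. f -` B = B \<longrightarrow> emeasure \<nu> B = 0 \<or> emeasure \<nu> B = 1)"

text \<open>The library function \<open>ln\<close> has \<open>ln 0 = 0\<close>, while here \<open>log 0\<close> is minus infinity.\<close>

definition log_ereal :: "real \<Rightarrow> ereal" where
  "log_ereal r = (if r = 0 then -\<infinity> else ereal (ln r))"

definition lyapunov_max ::
    "('x, 'e::real_normed_vector) chart set \<Rightarrow> (('x, 'e) chart \<Rightarrow> 'x \<Rightarrow> 'e \<Rightarrow>\<^sub>L 'e \<Rightarrow>\<^sub>L real) \<Rightarrow>
     ('t \<times> 'x \<Rightarrow> 't \<times> 'x) \<Rightarrow> 't \<times> 'x \<Rightarrow> ereal" where
  "lyapunov_max A g f =
     (\<lambda>(\<theta>, x). limsup (\<lambda>n. ereal (1 / real n) * log_ereal (deriv_norm A g (fibre_map f n \<theta>) x)))"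

text \<open>
  Integral of an extended real function, as the difference of the integrals of its positive
  part and its negative part; \<open>e2ennreal\<close> truncates negative values to zero.
\<close>

definition ereal_integral :: "'a measure \<Rightarrow> ('a \<Rightarrow> ereal) \<Rightarrow> ereal" where
  "ereal_integral \<nu> u =
     enn2ereal (\<integral>\<^sup>+ p. e2ennreal (u p) \<partial>\<nu>) - enn2ereal (\<integral>\<^sup>+ p. e2ennreal (- u p) \<partial>\<nu>)"

definition lyapunov_max_measure ::
    "('x, 'e::real_normed_vector) chart set \<Rightarrow> (('x, 'e) chart \<Rightarrow> 'x \<Rightarrow> 'e \<Rightarrow>\<^sub>L 'e \<Rightarrow>\<^sub>L real) \<Rightarrow>
     ('t \<times> 'x \<Rightarrow> 't \<times> 'x) \<Rightarrow> ('t \<times> 'x) measure \<Rightarrow> ereal" where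
  "lyapunov_max_measure A g f \<nu> = ereal_integral \<nu> (lyapunov_max A g f)"


section \<open>Multivalued graphs\<close>

definition config_space :: "nat \<Rightarrow> (nat \<Rightarrow> 'x) set" where
  "config_space k = {p \<in> {1..k} \<rightarrow>\<^sub>E UNIV. inj_on p {1..k}}"

text \<open>
  Continuity into the configuration space: the set of entries varies continuously in the
  Hausdorff distance; the individual entries need not.
\<close>

definition continuous_config ::
    "('x \<Rightarrow> 'x \<Rightarrow> ennreal) \<Rightarrow> nat \<Rightarrow> ('t::topological_space \<Rightarrow> nat \<Rightarrow> 'x) \<Rightarrow> bool" where
  "continuous_config d k \<psi> \<longleftrightarrow>
     (\<forall>\<theta>. ((\<lambda>\<theta>'. hausdorff_dist d (\<psi> \<theta>' ` {1..k}) (\<psi> \<theta> ` {1..k})) \<longlongrightarrow> 0) (at \<theta>))"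

end

theory Submission
  imports Defs
begin

text \<open>
  The functions \<open>b n = ln (max \<parallel>Df\<^sup>n\<parallel> (exp (- n)))\<close> form a continuous subadditive cocycle over \<open>K\<close>.  If
  none of them is negative on all of \<open>K\<close>, averaging along a suitable orbit yields an invariant
  state \<open>\<Lambda>\<close> on \<open>C(K)\<close> with \<open>\<Lambda> (b n) \<ge> 0\<close> for all \<open>n \<ge> 1\<close>.  Among the invariant states that maximise
  \<open>inf (\<Lambda> (b n) / n)\<close>, a maximiser of a strictly convex functional is extreme, hence an ergodic
  measure, and a maximal-inequality argument shows that its upper exponent is nonnegative.  So the
  hypothesis provides an iterate with \<open>\<parallel>Df\<^sup>n\<parallel> < 1\<close> on \<open>K\<close>.

  A high power of this iterate halves chart distances between nearby points of \<open>K\<close> in the same fibre,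
  even after the distortion of the charts.  Every fibre is the image of fibres in the distant past,
  which are covered by boundedly many small sets; these shrink to points, so the cardinality of the
  fibres is bounded.  The points of a fibre of maximal cardinality stay apart along the whole
  backward orbit, which is dense by minimality; hence all fibres have the same cardinality and
  uniformly separated points, and the upper semicontinuous fibre map is continuous.
\<close>


section \<open>Invariant measures and subadditive cocycles\<close>

text \<open>The truncation by \<open>exp (- n)\<close> keeps \<open>b n\<close> finite and
  continuous where derivatives vanish. It is itself multiplicative, so subadditivity survives, and
  it never interferes in the end: the ergodic measure is shown to decay more slowly than every
  exponential rate. Extremality and the maximal inequality do the work of the ergodic decomposition
  and of Kingman's theorem. Positive functionals replace measures for as long as possible: Tychonoff
  then gives compactness without a metric on the manifold, and the Riesz theorem recovers the
  measure. The Riemannian distance plays no dynamical part. Contraction is measured in coordinates;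
  passing between metric norm and model norm costs a factor \<open>M\<close> at either end, which
  explains the threshold \<open>1 / (4 * M\<^sup>2)\<close>. It leaves a derivative bound 1/4 at
  points of \<open>K\<close>, and continuity relaxes this to 1/2 nearby. The distance enters only at
  the end, through the upper bound given by coordinate segments.\<close>

lemma Hausdorff_space_euclidean_t2: "Hausdorff_space (euclidean :: 'a::t2_space topology)"
  unfolding Hausdorff_space_def disjnt_def by simp (metis hausdorff)

lemma compact_Urysohn:
  fixes K :: "'a::t2_space set"
  assumes "compact K" "closed S" "closed T" "S \<inter> T \<inter> K = {}"
  obtains h :: "'a \<Rightarrow> real" where "continuous_on K h" "\<And>x. x \<in> K \<Longrightarrow> 0 \<le> h x \<and> h x \<le> 1"
    "\<And>x. x \<in> K \<inter> S \<Longrightarrow> h x = 0" "\<And>x. x \<in> K \<inter> T \<Longrightarrow> h x = 1"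
proof -
  have n: "normal_space (top_of_set K)"
    using assms(1) by (intro compact_Hausdorff_or_regular_imp_normal_space)
      (auto simp: compact_space_subtopology intro!: disjI1 Hausdorff_space_subtopology Hausdorff_space_euclidean_t2)
  obtain h where h: "continuous_map (top_of_set K) (top_of_set {0..1::real}) h"
      "h ` (K \<inter> S) \<subseteq> {0}" "h ` (K \<inter> T) \<subseteq> {1}"
    by (rule Urysohn_lemma[OF n, of "K \<inter> S" "K \<inter> T" 0 1])
       (use assms in \<open>auto simp: closedin_closed disjnt_def\<close>)
  show ?thesis
    by (rule that[of h]) (use h in \<open>auto simp: continuous_map_in_subtopology\<close>)
qed

text \<open>The base is a parameter and not a sort: in the application the type is a product whose
  first factor is merely of sort \<open>metric_space\<close>, where a countable base comes from
  compactness.\<close>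

locale compact_countable_base =
  fixes K :: "'a::t2_space set" and B :: "'a set set"
  assumes compact: "compact K" and countable_base: "countable B" and base: "topological_basis B"
begin

lemma closed_K: "closed K"
  using compact by (rule compact_imp_closed)

text \<open>Perfect normality of \<open>K\<close>. The basic sets whose closure misses
  \<open>Z\<close> within \<open>K\<close> cover \<open>K - Z\<close>; Urysohn functions for them,
  summed with weights \<open>(1/2)^Suc n\<close>, vanish on \<open>Z\<close> and nowhere else in
  \<open>K\<close>.\<close>

lemma closed_zero_function:
  assumes "closed Z"
  obtains h :: "'a \<Rightarrow> real" where "continuous_on K h" "\<And>x. x \<in> K \<Longrightarrow> 0 \<le> h x \<and> h x \<le> 1"
    "\<And>x. x \<in> K \<Longrightarrow> h x = 0 \<longleftrightarrow> x \<in> Z"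
proof -
  define B' where "B' = {U \<in> B. closure U \<inter> Z \<inter> K = {}}"
  have "\<exists>h::'a \<Rightarrow> real. continuous_on K h \<and> (\<forall>x\<in>K. 0 \<le> h x \<and> h x \<le> 1) \<and>
       (\<forall>x\<in>K \<inter> Z. h x = 0) \<and> (\<forall>x\<in>K \<inter> closure U. h x = 1)" if U: "U \<in> B'" for U
  proof -
    have "Z \<inter> closure U \<inter> K = {}" using U by (auto simp: B'_def)
    from compact_Urysohn[OF compact assms closed_closure this] show ?thesis
      by (metis)
  qed
  then have "\<exists>h::'a set \<Rightarrow> 'a \<Rightarrow> real. \<forall>U\<in>B'. continuous_on K (h U) \<and> (\<forall>x\<in>K. 0 \<le> h U x \<and> h U x \<le> 1) \<and>
       (\<forall>x\<in>K \<inter> Z. h U x = 0) \<and> (\<forall>x\<in>K \<inter> closure U. h U x = 1)"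
    by (intro bchoice ballI)
  then obtain h :: "'a set \<Rightarrow> 'a \<Rightarrow> real" where h: "\<And>U. U \<in> B' \<Longrightarrow> continuous_on K (h U)"
      "\<And>U x. U \<in> B' \<Longrightarrow> x \<in> K \<Longrightarrow> 0 \<le> h U x \<and> h U x \<le> 1"
      "\<And>U x. U \<in> B' \<Longrightarrow> x \<in> K \<inter> Z \<Longrightarrow> h U x = 0"
      "\<And>U x. U \<in> B' \<Longrightarrow> x \<in> K \<inter> closure U \<Longrightarrow> h U x = 1"
    by blast
  have "countable B'"
    using countable_base by (auto simp: B'_def)
  have cover: "\<exists>U\<in>B'. x \<in> U" if x: "x \<in> K" "x \<notin> Z" for x
  proof -
    have "compactin euclidean {x}" "compactin euclidean (K \<inter> Z)" "disjnt {x} (K \<inter> Z)"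
      using x compact assms by (auto simp: compact_Int_closed)
    then obtain U V where UV: "open U" "open V" "x \<in> U" "K \<inter> Z \<subseteq> V" "disjnt U V"
      using Hausdorff_space_compact_separation[of "euclidean :: 'a topology" "{x}" "K \<inter> Z"] Hausdorff_space_euclidean_t2 by auto
    obtain U' where U': "U' \<in> B" "x \<in> U'" "U' \<subseteq> U"
      using topological_basisE[OF base UV(1,3)] by blast
    have "U' \<subseteq> - V"
      using UV(5) U' by (auto simp: disjnt_def)
    then have "closure U' \<subseteq> - V"
      using UV(2) by (intro closure_minimal) auto
    then have "U' \<in> B'"
      using U' UV(4) by (auto simp: B'_def)
    with U' show ?thesis by blast
  qed
  show ?thesis
  proof (cases "B' = {}")
    case True
    with cover have "K \<subseteq> Z" by auto
    then show ?thesis by (intro that[of "\<lambda>_. 0"]) auto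
  next
    case False
    define u where "u = from_nat_into B'"
    have u: "u n \<in> B'" for n
      using False by (simp add: u_def from_nat_into)
    define s where "s x = (\<Sum>n. (1/2)^Suc n * h (u n) x)" for x
    have smb: "norm ((1/2)^Suc n * h (u n) x) \<le> (1/2::real)^Suc n" if "x \<in> K" for n x
      using h(2)[OF u that] by (simp add: mult_left_le power_le_one abs_mult)
    have sm: "summable (\<lambda>n. (1/2)^Suc n * h (u n) x)" if "x \<in> K" for x
      by (rule summable_comparison_test'[OF power_half_series[THEN sums_summable]])
        (rule smb[OF that])
    have lim: "uniform_limit K (\<lambda>n x. \<Sum>i<n. (1/2)^Suc i * h (u i) x) s sequentially"
      unfolding s_def
      by (rule Weierstrass_m_test[OF smb power_half_series[THEN sums_summable]])
    have "continuous_on K s"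
      by (rule uniform_limit_theorem[OF always_eventually lim])
        (auto intro!: continuous_intros h(1) u simp del: power_Suc)
    moreover have "0 \<le> s x \<and> s x \<le> 1" if "x \<in> K" for x
    proof
      show "0 \<le> s x"
        unfolding s_def using h(2)[OF u that] by (intro suminf_nonneg sm that) auto
      have "s x \<le> (\<Sum>n. (1/2)^Suc n)"
        unfolding s_def using smb[OF that]
        by (intro suminf_le sm that power_half_series[THEN sums_summable]) (auto simp: abs_le_iff)
      then show "s x \<le> 1"
        using power_half_series by (simp add: sums_iff)
    qed
    moreover have "s x = 0 \<longleftrightarrow> x \<in> Z" if x: "x \<in> K" for x
    proof
      assume "x \<in> Z"
      then show "s x = 0" unfolding s_def using h(3)[OF u] x by simp
    next
      assume s0: "s x = 0"
      show "x \<in> Z"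
      proof (rule ccontr)
        assume "x \<notin> Z"
        then obtain U where U: "U \<in> B'" "x \<in> U" using cover x by blast
        obtain n where n: "u n = U"
          using U(1) \<open>countable B'\<close> unfolding u_def by (metis from_nat_into_surj)
        have "0 < (\<Sum>i. (1/2)^Suc i * h (u i) x)"
          using h(2)[OF u x] h(4)[OF u, of x n] n U x closure_subset[of U]
          by (intro suminf_pos2[OF sm[OF x], of n]) (auto simp: in_mono)
        then show False using s0 by (simp add: s_def)
      qed
    qed
    ultimately show ?thesis by (rule that)
  qed
qed

end

text \<open>Turns a pointwise index into a uniform one; used for a Dini argument in
  \<open>outer_K\<close> and for a uniform time and rate in \<open>nonneg_point\<close>.\<close>

lemma compact_mono_cover:
  assumes "compact K" "\<And>n::nat. openin (top_of_set K) {x \<in> K. P n x}"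
    "\<And>x. x \<in> K \<Longrightarrow> \<exists>n. P n x" "\<And>m n x. x \<in> K \<Longrightarrow> m \<le> n \<Longrightarrow> P m x \<Longrightarrow> P n x"
  obtains n where "\<And>x. x \<in> K \<Longrightarrow> P n x"
proof -
  have "\<exists>U. open U \<and> {x \<in> K. P n x} = K \<inter> U" for n
    using assms(2)[of n] by (auto simp: openin_open)
  then obtain U where U: "\<And>n. open (U n)" "\<And>n. {x \<in> K. P n x} = K \<inter> U n"
    by metis
  have "K \<subseteq> (\<Union>n\<in>UNIV. U n)"
    using assms(3) U(2) by blast
  then obtain F where F: "finite F" "K \<subseteq> (\<Union>n\<in>F. U n)"
    by (rule compactE_image[OF assms(1) U(1)])
  show ?thesis
  proof (rule that)
    fix x assume x: "x \<in> K"
    then obtain n where "n \<in> F" "P n x" using F U(2) by blast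
    then show "P (Max F) x" using assms(4)[OF x Max_ge[OF F(1)]] by blast
  qed
qed

section \<open>Positive functionals on \<open>C(K)\<close> and the Riesz representation
  theorem\<close>

context compact_countable_base
begin

text \<open>The normalised positive linear functionals on \<open>C(K)\<close>. They are carried by
  all functions on the type; by positivity the value at a function continuous on \<open>K\<close>
  depends only on its restriction to \<open>K\<close>, and values at other functions are left
  free.\<close>

definition state :: "(('a \<Rightarrow> real) \<Rightarrow> real) \<Rightarrow> bool" where
  "state \<Lambda> \<longleftrightarrow>
     (\<forall>\<phi> \<psi>. continuous_on K \<phi> \<longrightarrow> continuous_on K \<psi> \<longrightarrow> \<Lambda> (\<lambda>x. \<phi> x + \<psi> x) = \<Lambda> \<phi> + \<Lambda> \<psi>) \<and>
     (\<forall>c \<phi>. continuous_on K \<phi> \<longrightarrow> \<Lambda> (\<lambda>x. c * \<phi> x) = c * \<Lambda> \<phi>) \<and>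
     (\<forall>\<phi>. continuous_on K \<phi> \<longrightarrow> (\<forall>x\<in>K. 0 \<le> \<phi> x) \<longrightarrow> 0 \<le> \<Lambda> \<phi>) \<and>
     \<Lambda> (\<lambda>_. 1) = 1"

lemma state_add: "state \<Lambda> \<Longrightarrow> continuous_on K \<phi> \<Longrightarrow> continuous_on K \<psi> \<Longrightarrow>
    \<Lambda> (\<lambda>x. \<phi> x + \<psi> x) = \<Lambda> \<phi> + \<Lambda> \<psi>"
  and state_scale: "state \<Lambda> \<Longrightarrow> continuous_on K \<phi> \<Longrightarrow> \<Lambda> (\<lambda>x. c * \<phi> x) = c * \<Lambda> \<phi>"
  and state_nonneg: "state \<Lambda> \<Longrightarrow> continuous_on K \<phi> \<Longrightarrow> (\<And>x. x \<in> K \<Longrightarrow> 0 \<le> \<phi> x) \<Longrightarrow> 0 \<le> \<Lambda> \<phi>"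
  and state_one: "state \<Lambda> \<Longrightarrow> \<Lambda> (\<lambda>_. 1) = 1"
  by (auto simp: state_def)

lemma state_const: "state \<Lambda> \<Longrightarrow> \<Lambda> (\<lambda>_. c) = c"
  using state_scale[of \<Lambda> "\<lambda>_. 1" c] state_one[of \<Lambda>] by simp

lemma state_diff:
  assumes "state \<Lambda>" "continuous_on K \<phi>" "continuous_on K \<psi>"
  shows "\<Lambda> (\<lambda>x. \<phi> x - \<psi> x) = \<Lambda> \<phi> - \<Lambda> \<psi>"
proof -
  have "\<Lambda> (\<lambda>x. \<phi> x + (-1) * \<psi> x) = \<Lambda> \<phi> + \<Lambda> (\<lambda>x. (-1) * \<psi> x)"
    by (rule state_add[OF assms(1,2) continuous_on_mult_left[OF assms(3)]])
  also have "\<Lambda> (\<lambda>x. (-1) * \<psi> x) = (-1) * \<Lambda> \<psi>"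
    by (rule state_scale[OF assms(1,3)])
  finally show ?thesis by simp
qed

lemma state_mono:
  assumes "state \<Lambda>" "continuous_on K \<phi>" "continuous_on K \<psi>" "\<And>x. x \<in> K \<Longrightarrow> \<phi> x \<le> \<psi> x"
  shows "\<Lambda> \<phi> \<le> \<Lambda> \<psi>"
proof -
  have "0 \<le> \<Lambda> (\<lambda>x. \<psi> x - \<phi> x)"
    by (rule state_nonneg[OF assms(1) continuous_on_diff[OF assms(3,2)]]) (simp add: assms(4))
  then show ?thesis using state_diff[OF assms(1,3,2)] by simp
qed

lemma state_sum:
  assumes "state \<Lambda>" "\<And>i. i \<in> I \<Longrightarrow> continuous_on K (\<phi> i)"
  shows "\<Lambda> (\<lambda>x. \<Sum>i\<in>I. \<phi> i x) = (\<Sum>i\<in>I. \<Lambda> (\<phi> i))"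
  using assms(2)
proof (induction I rule: infinite_finite_induct)
  case (insert i I)
  then have "\<Lambda> (\<lambda>x. \<phi> i x + (\<Sum>i\<in>I. \<phi> i x)) = \<Lambda> (\<phi> i) + \<Lambda> (\<lambda>x. \<Sum>i\<in>I. \<phi> i x)"
    by (intro state_add assms(1) continuous_intros) auto
  with insert show ?case by simp
qed (use state_const[OF assms(1), of 0] in auto)

definition covers :: "'a set \<Rightarrow> (nat \<Rightarrow> 'a \<Rightarrow> real) set" where
  "covers S = {\<phi>. (\<forall>i. continuous_on K (\<phi> i) \<and> (\<forall>x\<in>K. 0 \<le> \<phi> i x)) \<and>
     (\<forall>x\<in>S \<inter> K. 1 \<le> (\<Sum>i. ennreal (\<phi> i x)))}"

text \<open>A Daniell outer measure. Sets are covered by countable families of functions instead of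
  open sets, so that countable subadditivity follows by merging families.\<close>

definition outer :: "(('a \<Rightarrow> real) \<Rightarrow> real) \<Rightarrow> 'a set \<Rightarrow> ennreal" where
  "outer \<Lambda> S = (INF \<phi>\<in>covers S. \<Sum>i. ennreal (\<Lambda> (\<phi> i)))"

lemma outer_mono: "S \<subseteq> T \<Longrightarrow> outer \<Lambda> S \<le> outer \<Lambda> T"
  unfolding outer_def by (intro INF_superset_mono) (auto simp: covers_def)

lemma outer_le_state:
  assumes "state \<Lambda>" "continuous_on K \<psi>" "\<And>x. x \<in> K \<Longrightarrow> 0 \<le> \<psi> x" "\<And>x. x \<in> S \<inter> K \<Longrightarrow> 1 \<le> \<psi> x"
  shows "outer \<Lambda> S \<le> ennreal (\<Lambda> \<psi>)"
proof -
  define \<phi> where "\<phi> i = (if i = 0 then \<psi> else (\<lambda>_. 0))" for i :: nat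
  have s: "(\<Sum>i. F (\<phi> i)) = F \<psi>" if "F (\<lambda>_. 0) = 0" for F :: "('a \<Rightarrow> real) \<Rightarrow> ennreal"
    using that by (subst suminf_finite[of "{0}"]) (auto simp: \<phi>_def)
  have "\<phi> \<in> covers S"
    using assms s[of "\<lambda>h. ennreal (h _)"] by (auto simp: covers_def \<phi>_def[of "Suc _"] \<phi>_def)
  moreover have "(\<Sum>i. ennreal (\<Lambda> (\<phi> i))) = ennreal (\<Lambda> \<psi>)"
    by (rule s) (simp add: state_const[OF assms(1)])
  ultimately show ?thesis unfolding outer_def by (metis INF_lower)
qed

lemma outer_le_1: "state \<Lambda> \<Longrightarrow> outer \<Lambda> S \<le> 1"
  using outer_le_state[of \<Lambda> "\<lambda>_. 1" S] by (simp add: state_one)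

lemma outer_empty: "state \<Lambda> \<Longrightarrow> outer \<Lambda> {} = 0"
  using outer_le_state[of \<Lambda> "\<lambda>_. 0" "{}"] by (simp add: state_const)

lemma outer_approx:
  assumes "state \<Lambda>" "0 < e"
  obtains \<phi> where "\<phi> \<in> covers S" "(\<Sum>i. ennreal (\<Lambda> (\<phi> i))) \<le> outer \<Lambda> S + ennreal e"
proof -
  have "outer \<Lambda> S < outer \<Lambda> S + ennreal e"
    using outer_le_1[OF assms(1), of S] assms(2) ennreal_add_left_cancel_less[of "outer \<Lambda> S" 0]
    by (auto simp: top_unique)
  then show ?thesis
    using that unfolding outer_def INF_less_iff by (metis order.strict_implies_order)
qed

lemma suminf_ennreal_half: "0 < e \<Longrightarrow> (\<Sum>n. ennreal (e * (1/2)^Suc n)) = ennreal e"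
  using sums_mult[OF power_half_series, of e]
  by (subst suminf_ennreal2) (auto simp: sums_iff)

text \<open>Covers that are optimal up to \<open>e * (1/2)^Suc n\<close> are merged into a single
  sequence by the pairing function; the errors add up to \<open>e\<close>.\<close>

lemma outer_UN_le:
  assumes "state \<Lambda>"
  shows "outer \<Lambda> (\<Union>n::nat. S n) \<le> (\<Sum>n. outer \<Lambda> (S n))"
proof (rule ennreal_le_epsilon)
  fix e :: real assume e: "0 < e"
  have "\<forall>n. \<exists>\<phi>. \<phi> \<in> covers (S n) \<and> (\<Sum>i. ennreal (\<Lambda> (\<phi> i))) \<le> outer \<Lambda> (S n) + ennreal (e * (1/2)^Suc n)"
    using outer_approx[OF assms] e by (metis half_gt_zero_iff mult_pos_pos zero_less_one zero_less_power)
  then obtain \<phi> where \<phi>: "\<And>n. \<phi> n \<in> covers (S n)"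
      "\<And>n. (\<Sum>i. ennreal (\<Lambda> (\<phi> n i))) \<le> outer \<Lambda> (S n) + ennreal (e * (1/2)^Suc n)"
    by metis
  define \<psi> where "\<psi> k = (\<lambda>(n, i). \<phi> n i) (prod_decode k)" for k
  have sum: "(\<Sum>k. F (\<psi> k)) = (\<Sum>n. \<Sum>i. F (\<phi> n i))" for F :: "('a \<Rightarrow> real) \<Rightarrow> ennreal"
    using suminf_ennreal_2dimen[of "\<lambda>n. \<Sum>i. F (\<phi> n i)" "\<lambda>(n, i). F (\<phi> n i)"]
    by (simp add: \<psi>_def case_prod_unfold)
  have "\<psi> \<in> covers (\<Union>n. S n)"
  proof -
    have "1 \<le> (\<Sum>k. ennreal (\<psi> k x))" if x: "x \<in> S n" "x \<in> K" for x n
    proof -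
      have "1 \<le> (\<Sum>i. ennreal (\<phi> n i x))" using \<phi>(1)[of n] x by (auto simp: covers_def)
      also have "\<dots> \<le> (\<Sum>n. \<Sum>i. ennreal (\<phi> n i x))"
        using sum_le_suminf[of "\<lambda>n. \<Sum>i. ennreal (\<phi> n i x)" "{n}"] by auto
      finally show ?thesis using sum[of "\<lambda>h. ennreal (h x)"] by simp
    qed
    then show ?thesis
      using \<phi>(1) by (auto simp: covers_def \<psi>_def split: prod.splits)
  qed
  then have "outer \<Lambda> (\<Union>n. S n) \<le> (\<Sum>k. ennreal (\<Lambda> (\<psi> k)))"
    unfolding outer_def by (rule INF_lower)
  also have "\<dots> = (\<Sum>n. \<Sum>i. ennreal (\<Lambda> (\<phi> n i)))"
    by (rule sum)
  also have "\<dots> \<le> (\<Sum>n. outer \<Lambda> (S n) + ennreal (e * (1/2)^Suc n))"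
    by (intro suminf_le \<phi>(2)) auto
  also have "\<dots> = (\<Sum>n. outer \<Lambda> (S n)) + ennreal e"
    using suminf_ennreal_half[OF e] by (subst suminf_add[symmetric]) auto
  finally show "outer \<Lambda> (\<Union>n. S n) \<le> (\<Sum>n. outer \<Lambda> (S n)) + ennreal e" .
qed

text \<open>
  A cover \<open>\<phi> i\<close> of \<open>S\<close> is split by functions \<open>\<psi> n\<close> that decrease to the indicator of \<open>Z\<close>: the products
  \<open>\<phi> i * \<psi> (n i)\<close> cover \<open>S \<inter> Z\<close>, and the telescoping differences \<open>\<phi> i * (\<psi> m - \<psi> (Suc m))\<close> cover \<open>S - Z\<close>.
\<close>

lemma outer_closed_split:
  assumes "state \<Lambda>" "closed Z"
  shows "outer \<Lambda> (S \<inter> Z) + outer \<Lambda> (S - Z) \<le> outer \<Lambda> S"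
  unfolding outer_def[of \<Lambda> S]
proof (rule INF_greatest, rule ennreal_le_epsilon)
  fix \<phi> and e :: real assume \<phi>: "\<phi> \<in> covers S" and e: "0 < e"
  obtain h :: "'a \<Rightarrow> real" where h: "continuous_on K h" "\<And>x. x \<in> K \<Longrightarrow> 0 \<le> h x \<and> h x \<le> 1"
    "\<And>x. x \<in> K \<Longrightarrow> h x = 0 \<longleftrightarrow> x \<in> Z"
    using closed_zero_function[OF assms(2)] by metis
  define \<psi> where "\<psi> n x = max 0 (1 - real n * h x)" for n x
  have \<psi>c: "continuous_on K (\<psi> n)" for n
    unfolding \<psi>_def by (intro continuous_intros h(1))
  have \<psi>0: "0 \<le> \<psi> n x" for n x by (simp add: \<psi>_def)
  have \<psi>Z: "\<psi> n x = 1" if "x \<in> K" "x \<in> Z" for n x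
    using h(3)[OF that(1)] that by (simp add: \<psi>_def)
  have \<psi>d: "\<psi> (Suc n) x \<le> \<psi> n x" if "x \<in> K" for n x
    using h(2)[OF that] by (auto simp: \<psi>_def algebra_simps)
  have \<psi>l: "(\<lambda>n. \<psi> n x) \<longlonglongrightarrow> 0" if "x \<in> K" "x \<notin> Z" for x
  proof (rule tendsto_eventually)
    have "0 < h x" using h(2,3) that by (metis order_le_less)
    then obtain N :: nat where N: "1 / h x < real N" using reals_Archimedean2 by blast
    show "eventually (\<lambda>n. \<psi> n x = 0) sequentially"
      using eventually_ge_at_top[of N]
    proof eventually_elim
      case (elim n)
      have "1 < real N * h x" using N \<open>0 < h x\<close> by (simp add: field_simps)
      also have "\<dots> \<le> real n * h x" using elim \<open>0 < h x\<close> by simp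
      finally show ?case by (simp add: \<psi>_def)
    qed
  qed
  have \<phi>c: "continuous_on K (\<phi> i)" and \<phi>0: "x \<in> K \<Longrightarrow> 0 \<le> \<phi> i x"
    and \<phi>1: "x \<in> S \<Longrightarrow> x \<in> K \<Longrightarrow> 1 \<le> (\<Sum>i. ennreal (\<phi> i x))" for i x
    using \<phi> by (auto simp: covers_def)
  define q where "q i n = \<Lambda> (\<lambda>x. \<phi> i x * \<psi> n x)" for i n
  have q0: "0 \<le> q i n" for i n
    unfolding q_def by (intro state_nonneg[OF assms(1)] continuous_intros \<phi>c \<psi>c)
      (auto simp: \<phi>0 \<psi>0)
  have qd: "q i n - q i (Suc n) = \<Lambda> (\<lambda>x. \<phi> i x * (\<psi> n x - \<psi> (Suc n) x))" for i n
    unfolding q_def by (subst state_diff[OF assms(1), symmetric])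
      (auto intro!: continuous_intros \<phi>c \<psi>c simp: algebra_simps)
  have qd0: "0 \<le> q i n - q i (Suc n)" for i n
    unfolding qd by (intro state_nonneg[OF assms(1)] continuous_intros \<phi>c \<psi>c)
      (auto simp: \<phi>0 \<psi>d)
  have "decseq (q i)" for i
    using qd0[of i] by (intro decseq_SucI) (simp add: algebra_simps)
  then have "convergent (q i)" for i
    using q0 by (metis decseq_convergent convergentI)
  \<comment> \<open>\<open>L i\<close> is the mass that \<phi> \<open>i\<close> puts on
    \<open>Z\<close>. The cover of \<open>S \<inter> Z\<close> costs \<open>L i\<close> up to a
    summable error, the telescoping cover of \<open>S - Z\<close> costs exactly the rest
    \<Lambda>(\<phi> \<open>i\<close>) - \<open>L i\<close>.\<close>
  then obtain L where L: "\<And>i. q i \<longlonglongrightarrow> L i"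
    unfolding convergent_def by metis
  have L0: "0 \<le> L i" for i
    by (rule LIMSEQ_le_const[OF L]) (auto simp: q0)
  have tel: "(\<lambda>n. q i n - q i (Suc n)) sums (\<Lambda> (\<phi> i) - L i)" for i
  proof -
    have "q i 0 = \<Lambda> (\<phi> i)" by (simp add: q_def \<psi>_def)
    then show ?thesis using telescope_sums'[OF L[of i]] by simp
  qed
  have "\<exists>n. q i n \<le> L i + e * (1/2)^Suc i" for i
  proof -
    have "L i < L i + e * (1/2)^Suc i" using e by simp
    then have "eventually (\<lambda>n. q i n < L i + e * (1/2)^Suc i) sequentially"
      using order_tendstoD(2)[OF L] by blast
    then show ?thesis
      by (metis (mono_tags) eventually_happens order.strict_implies_order sequentially_bot)
  qed
  then obtain n where n: "\<And>i. q i (n i) \<le> L i + e * (1/2)^Suc i" by metis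
  have "(\<lambda>i x. \<phi> i x * \<psi> (n i) x) \<in> covers (S \<inter> Z)"
    using \<phi>0 \<psi>0 \<phi>1 \<psi>Z by (auto simp: covers_def intro!: continuous_intros \<phi>c \<psi>c)
  then have "outer \<Lambda> (S \<inter> Z) \<le> (\<Sum>i. ennreal (q i (n i)))"
    unfolding outer_def q_def by (rule INF_lower)
  also have "\<dots> \<le> (\<Sum>i. ennreal (L i) + ennreal (e * (1/2)^Suc i))"
    using e L0 n by (intro suminf_le) (auto simp flip: ennreal_plus intro!: ennreal_leI)
  also have "\<dots> = (\<Sum>i. ennreal (L i)) + ennreal e"
    using suminf_ennreal_half[OF e] by (subst suminf_add[symmetric]) auto
  finally have 1: "outer \<Lambda> (S \<inter> Z) \<le> (\<Sum>i. ennreal (L i)) + ennreal e" .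
  define \<zeta> where "\<zeta> k = (\<lambda>(i, m) x. \<phi> i x * (\<psi> m x - \<psi> (Suc m) x)) (prod_decode k)" for k
  have sum: "(\<Sum>k. F (\<zeta> k)) = (\<Sum>i. \<Sum>m. F (\<lambda>x. \<phi> i x * (\<psi> m x - \<psi> (Suc m) x)))"
    for F :: "('a \<Rightarrow> real) \<Rightarrow> ennreal"
    using suminf_ennreal_2dimen[of "\<lambda>i. \<Sum>m. F (\<lambda>x. \<phi> i x * (\<psi> m x - \<psi> (Suc m) x))"
        "\<lambda>(i, m). F (\<lambda>x. \<phi> i x * (\<psi> m x - \<psi> (Suc m) x))"]
    by (simp add: \<zeta>_def case_prod_unfold)
  have "\<zeta> \<in> covers (S - Z)"
  proof -
    have "1 \<le> (\<Sum>k. ennreal (\<zeta> k x))" if x: "x \<in> S" "x \<in> K" "x \<notin> Z" for x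
    proof -
      have "(\<lambda>m. \<phi> i x * (\<psi> m x - \<psi> (Suc m) x)) sums (\<phi> i x * (\<psi> 0 x - 0))" for i
        by (intro sums_mult telescope_sums' \<psi>l x)
      then have "(\<lambda>m. \<phi> i x * (\<psi> m x - \<psi> (Suc m) x)) sums \<phi> i x" for i
        by (simp add: \<psi>_def)
      then have "(\<Sum>m. ennreal (\<phi> i x * (\<psi> m x - \<psi> (Suc m) x))) = ennreal (\<phi> i x)" for i
        using x \<phi>0 \<psi>d by (subst suminf_ennreal2) (auto simp: sums_iff)
      then show ?thesis
        using \<phi>1[OF x(1,2)] sum[of "\<lambda>h. ennreal (h x)"] by simp
    qed
    then show ?thesis
      by (auto simp: covers_def \<zeta>_def \<phi>0 \<psi>d intro!: continuous_intros \<phi>c \<psi>c split: prod.splits)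
  qed
  then have "outer \<Lambda> (S - Z) \<le> (\<Sum>k. ennreal (\<Lambda> (\<zeta> k)))"
    unfolding outer_def by (rule INF_lower)
  also have "\<dots> = (\<Sum>i. \<Sum>m. ennreal (q i m - q i (Suc m)))"
    unfolding qd by (rule sum[of "\<lambda>h. ennreal (\<Lambda> h)"])
  also have "\<dots> = (\<Sum>i. ennreal (\<Lambda> (\<phi> i) - L i))"
    using tel qd0 by (subst suminf_ennreal2) (auto simp: sums_iff)
  finally have "outer \<Lambda> (S \<inter> Z) + outer \<Lambda> (S - Z) \<le>
      ((\<Sum>i. ennreal (L i)) + ennreal e) + (\<Sum>i. ennreal (\<Lambda> (\<phi> i) - L i))"
    using 1 by (intro add_mono)
  also have "\<dots> = (\<Sum>i. ennreal (L i) + ennreal (\<Lambda> (\<phi> i) - L i)) + ennreal e"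
    by (subst suminf_add[symmetric]) (auto simp: algebra_simps)
  also have "(\<lambda>i. ennreal (L i) + ennreal (\<Lambda> (\<phi> i) - L i)) = (\<lambda>i. ennreal (\<Lambda> (\<phi> i)))"
  proof
    fix i
    have "0 \<le> \<Lambda> (\<phi> i) - L i"
      using sums_le[OF _ sums_zero tel[of i]] qd0 by auto
    then show "ennreal (L i) + ennreal (\<Lambda> (\<phi> i) - L i) = ennreal (\<Lambda> (\<phi> i))"
      using L0[of i] by (simp flip: ennreal_plus)
  qed
  finally show "outer \<Lambda> (S \<inter> Z) + outer \<Lambda> (S - Z) \<le> (\<Sum>i. ennreal (\<Lambda> (\<phi> i))) + ennreal e" .
qed

text \<open>A Dini argument: by compactness finitely many functions of any cover already sum to more
  than \<open>1 - e\<close> on all of \<open>K\<close>, so the cover costs at least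
  \<open>1 - e\<close>.\<close>

lemma outer_K:
  assumes "state \<Lambda>"
  shows "outer \<Lambda> K = 1"
proof (rule antisym)
  show "1 \<le> outer \<Lambda> K"
    unfolding outer_def
  proof (rule INF_greatest, rule ennreal_le_epsilon)
    fix \<phi> and e :: real assume \<phi>: "\<phi> \<in> covers K" and e: "0 < e"
    have \<phi>c: "continuous_on K (\<phi> i)" and \<phi>0: "x \<in> K \<Longrightarrow> 0 \<le> \<phi> i x"
      and \<phi>1: "x \<in> K \<Longrightarrow> 1 \<le> (\<Sum>i. ennreal (\<phi> i x))" for i x
      using \<phi> by (auto simp: covers_def)
    obtain n where n: "\<And>x. x \<in> K \<Longrightarrow> 1 - e < (\<Sum>i<n. \<phi> i x)"
    proof (rule compact_mono_cover[OF compact, of "\<lambda>n x. 1 - e < (\<Sum>i<n. \<phi> i x)"])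
      fix n
      have "continuous_on K (\<lambda>x. \<Sum>i<n. \<phi> i x)" by (intro continuous_intros \<phi>c)
      from continuous_openin_preimage_gen[OF this, of "{1 - e<..}"]
      show "openin (top_of_set K) {x \<in> K. 1 - e < (\<Sum>i<n. \<phi> i x)}"
        by (simp add: vimage_def Int_def)
    next
      fix x assume x: "x \<in> K"
      have "ennreal (1 - e) < 1"
        using e by (metis diff_less_eq ennreal_1 ennreal_lessI less_add_same_cancel1 zero_less_one)
      also have "\<dots> \<le> (SUP n. \<Sum>i<n. ennreal (\<phi> i x))"
        using \<phi>1[OF x] by (simp add: suminf_eq_SUP)
      finally obtain n where "ennreal (1 - e) < (\<Sum>i<n. ennreal (\<phi> i x))"
        by (auto simp: less_SUP_iff)
      also have "\<dots> = ennreal (\<Sum>i<n. \<phi> i x)"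
        using \<phi>0[OF x] by (intro sum_ennreal) auto
      finally show "\<exists>n. 1 - e < (\<Sum>i<n. \<phi> i x)"
        by (metis ennreal_leI linorder_not_less)
    next
      fix m n :: nat and x assume "x \<in> K" "m \<le> n" "1 - e < (\<Sum>i<m. \<phi> i x)"
      moreover from this have "(\<Sum>i<m. \<phi> i x) \<le> (\<Sum>i<n. \<phi> i x)"
        by (intro sum_mono2) (auto simp: \<phi>0)
      ultimately show "1 - e < (\<Sum>i<n. \<phi> i x)" by simp
    qed blast
    have "1 - e = \<Lambda> (\<lambda>_. 1 - e)" using assms by (simp add: state_const)
    also have "\<dots> \<le> \<Lambda> (\<lambda>x. \<Sum>i<n. \<phi> i x)"
      using n by (intro state_mono[OF assms] continuous_intros \<phi>c) (auto intro: less_imp_le)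
    also have "\<dots> = (\<Sum>i<n. \<Lambda> (\<phi> i))"
      by (intro state_sum assms \<phi>c)
    finally have "1 \<le> (\<Sum>i<n. \<Lambda> (\<phi> i)) + e" by simp
    then have "ennreal 1 \<le> ennreal ((\<Sum>i<n. \<Lambda> (\<phi> i)) + e)" by (rule ennreal_leI)
    also have "\<dots> = (\<Sum>i<n. ennreal (\<Lambda> (\<phi> i))) + ennreal e"
      using e state_nonneg[OF assms \<phi>c \<phi>0] by (simp add: sum_nonneg)
    also have "\<dots> \<le> (\<Sum>i. ennreal (\<Lambda> (\<phi> i))) + ennreal e"
      by (intro add_right_mono sum_le_suminf) auto
    finally show "1 \<le> (\<Sum>i. ennreal (\<Lambda> (\<phi> i))) + ennreal e" by simp
  qed
qed (rule outer_le_1[OF assms])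


text \<open>Measures live on the whole type, as \<open>ergodic_measure\<close> demands; being
  supported on the compact set is expressed by giving \<open>K\<close> full mass.\<close>

definition prob_on :: "'a measure \<Rightarrow> bool" where
  "prob_on \<nu> \<longleftrightarrow> sets \<nu> = sets borel \<and> emeasure \<nu> UNIV = 1 \<and> emeasure \<nu> K = 1"

lemma prob_onD:
  assumes "prob_on \<nu>"
  shows prob_on_sets: "sets \<nu> = sets borel" and prob_on_space: "space \<nu> = UNIV"
    and prob_on_finite: "finite_measure \<nu>"
    and prob_on_UNIV: "measure \<nu> UNIV = 1" and prob_on_K: "measure \<nu> K = 1"
    and prob_on_AE: "AE x in \<nu>. x \<in> K"
proof -
  show s: "sets \<nu> = sets borel" using assms by (simp add: prob_on_def)
  then show sp: "space \<nu> = UNIV" using sets_eq_imp_space_eq by fastforce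
  show fin: "finite_measure \<nu>"
    using assms sp by (intro finite_measureI) (simp add: prob_on_def)
  show "measure \<nu> UNIV = 1" "measure \<nu> K = 1"
    using assms by (simp_all add: prob_on_def measure_def)
  have K: "K \<in> sets \<nu>" using s closed_K by simp
  interpret finite_measure \<nu> by (rule fin)
  have "emeasure \<nu> (space \<nu> - K) = 0"
    using assms K emeasure_compl[OF K] by (simp add: prob_on_def sp)
  then show "AE x in \<nu>. x \<in> K"
    using K by (intro AE_I[of _ _ "space \<nu> - K"]) auto
qed

lemma borel_measurable_K:
  assumes "continuous_on K (\<phi> :: 'a \<Rightarrow> real)"
  shows "(\<lambda>x. indicator K x * \<phi> x) \<in> borel_measurable borel"
  using borel_measurable_continuous_on_indicator[OF _ assms] closed_K by simp

lemma set_integrable_K: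
  assumes "prob_on \<nu>" "continuous_on K (\<phi> :: 'a \<Rightarrow> real)"
  shows "set_integrable \<nu> K \<phi>"
proof -
  interpret finite_measure \<nu> by (rule prob_on_finite[OF assms(1)])
  have "compact (\<phi> ` K)" using assms(2) compact by (rule compact_continuous_image)
  then obtain M where M: "\<And>x. x \<in> K \<Longrightarrow> \<bar>\<phi> x\<bar> \<le> M"
    using compact_imp_bounded[of "\<phi> ` K"] by (auto simp: bounded_iff)
  have m: "(\<lambda>x. indicator K x * \<phi> x) \<in> borel_measurable \<nu>"
    using borel_measurable_K[OF assms(2)] measurable_cong_sets[OF prob_on_sets[OF assms(1)] refl]
    by blast
  have "\<bar>indicator K x * \<phi> x\<bar> \<le> \<bar>M\<bar>" for x
    using M[of x] by (auto simp: indicator_def)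
  then show ?thesis
    unfolding set_integrable_def using m
    by (intro integrable_const_bound[where B = "\<bar>M\<bar>"]) auto
qed

lemma integral_state:
  assumes "prob_on \<nu>"
  shows "state (\<lambda>\<phi>. LINT x:K|\<nu>. \<phi> x)"
  unfolding state_def
proof (intro conjI allI impI)
  fix \<phi> \<psi> :: "'a \<Rightarrow> real" assume "continuous_on K \<phi>" "continuous_on K \<psi>"
  then show "(LINT x:K|\<nu>. \<phi> x + \<psi> x) = (LINT x:K|\<nu>. \<phi> x) + (LINT x:K|\<nu>. \<psi> x)"
    using set_integrable_K[OF assms] by (intro set_integral_add)
next
  show "(LINT x:K|\<nu>. 1 :: real) = 1"
    using prob_on_K[OF assms] prob_on_sets[OF assms] closed_K prob_on_space[OF assms]
    by (simp add: set_lebesgue_integral_def)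
next
  fix \<phi> :: "'a \<Rightarrow> real" assume "\<forall>x\<in>K. 0 \<le> \<phi> x"
  then show "0 \<le> (LINT x:K|\<nu>. \<phi> x)"
    unfolding set_lebesgue_integral_def by (intro integral_nonneg_AE AE_I2) (auto simp: indicator_def)
qed (simp add: set_lebesgue_integral_def)

text \<open>The inequality for \<psi> and for 1 - \<psi> gives equality when \<psi> takes values
  between 0 and 1 on \<open>K\<close>, and every continuous function is an affine image of such a
  \<psi>. Hence the Riesz theorem needs only one inequality.\<close>

lemma state_le_imp_eq:
  assumes \<Lambda>: "state \<Lambda>" and M: "state M"
    and le: "\<And>\<phi>. continuous_on K \<phi> \<Longrightarrow> (\<And>x. x \<in> K \<Longrightarrow> 0 \<le> \<phi> x \<and> \<phi> x \<le> 1) \<Longrightarrow> M \<phi> \<le> \<Lambda> \<phi>"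
    and c: "continuous_on K \<phi>"
  shows "M \<phi> = \<Lambda> \<phi>"
proof -
  have eq: "M \<psi> = \<Lambda> \<psi>" if "continuous_on K \<psi>" "\<And>x. x \<in> K \<Longrightarrow> 0 \<le> \<psi> x \<and> \<psi> x \<le> 1" for \<psi>
  proof (rule antisym)
    have "M (\<lambda>x. 1 - \<psi> x) \<le> \<Lambda> (\<lambda>x. 1 - \<psi> x)"
      using that by (intro le continuous_intros) (auto simp: add_increasing)
    moreover have "M (\<lambda>x. 1 - \<psi> x) = 1 - M \<psi>" "\<Lambda> (\<lambda>x. 1 - \<psi> x) = 1 - \<Lambda> \<psi>"
      using state_diff[OF M continuous_on_const that(1), of 1]
        state_diff[OF \<Lambda> continuous_on_const that(1), of 1] state_one[OF M] state_one[OF \<Lambda>] by simp_all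
    ultimately show "\<Lambda> \<psi> \<le> M \<psi>" by simp
  qed (rule le[OF that])
  have "compact (\<phi> ` K)" using c compact by (rule compact_continuous_image)
  then obtain b where b: "\<And>x. x \<in> K \<Longrightarrow> \<bar>\<phi> x\<bar> \<le> b" "0 < b"
    using compact_imp_bounded[of "\<phi> ` K"] unfolding bounded_pos by auto
  define \<psi> where "\<psi> x = (\<phi> x + b) / (2 * b)" for x
  have \<psi>c: "continuous_on K \<psi>"
    unfolding \<psi>_def using b(2) by (intro continuous_intros c) auto
  have "\<phi> = (\<lambda>x. (2 * b) * \<psi> x - b)"
    using b(2) by (auto simp: \<psi>_def)
  moreover have "S (\<lambda>x. (2 * b) * \<psi> x - b) = (2 * b) * S \<psi> - b" if "state S" for S
    using state_diff[OF that continuous_on_mult_left[OF \<psi>c] continuous_on_const, of "2 * b" b]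
      state_scale[OF that \<psi>c, of "2 * b"] state_const[OF that, of b] by simp
  moreover have "0 \<le> \<psi> x \<and> \<psi> x \<le> 1" if "x \<in> K" for x
    using b(1)[OF that] b(2) by (auto simp: \<psi>_def field_simps abs_le_iff)
  ultimately show ?thesis
    using eq[OF \<psi>c] \<Lambda> M by metis
qed

text \<open>Caratheodory's construction from \<open>outer\<close>: closed sets are measurable by
  \<open>outer_closed_split\<close>, hence all Borel sets are. The integral is bounded by \<Lambda>
  through slicing, and \<open>state_le_imp_eq\<close> upgrades this to equality.\<close>

theorem Riesz_representation:
  assumes "state \<Lambda>"
  obtains \<nu> where "prob_on \<nu>" "\<And>\<phi>. continuous_on K \<phi> \<Longrightarrow> (LINT x:K|\<nu>. \<phi> x) = \<Lambda> \<phi>"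
proof -
  interpret Pow: sigma_algebra "UNIV :: 'a set" "Pow UNIV" by (rule sigma_algebra_Pow)
  define L where "L = lambda_system UNIV (Pow UNIV) (outer \<Lambda>)"
  have oms: "outer_measure_space (Pow UNIV) (outer \<Lambda>)"
    unfolding outer_measure_space_def
    by (auto simp: positive_def outer_empty[OF assms] increasing_def outer_mono
        countably_subadditive_def outer_UN_le[OF assms])
  have msL: "measure_space UNIV L (outer \<Lambda>)"
    using Pow.caratheodory_lemma[OF oms] by (simp add: L_def)
  have closedL: "Z \<in> L" if "closed Z" for Z
  proof -
    have "outer \<Lambda> (S \<inter> Z) + outer \<Lambda> (S - Z) = outer \<Lambda> S" for S
    proof (rule antisym)
      define T where "T n = (if n = 0 then S \<inter> Z else if n = 1 then S - Z else {})" for n :: nat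
      have "(\<Union>n. T n) = S"
        using UN_I[of 0 UNIV _ T] UN_I[of 1 UNIV _ T] by (auto simp: T_def split: if_splits)
      then have "outer \<Lambda> S \<le> (\<Sum>n. outer \<Lambda> (T n))"
        using outer_UN_le[OF assms, of T] by simp
      also have "\<dots> = (\<Sum>n\<in>{0, 1}. outer \<Lambda> (T n))"
        by (rule suminf_finite) (auto simp: T_def outer_empty[OF assms])
      also have "\<dots> = outer \<Lambda> (S \<inter> Z) + outer \<Lambda> (S - Z)"
        by (simp add: T_def)
      finally show "outer \<Lambda> S \<le> outer \<Lambda> (S \<inter> Z) + outer \<Lambda> (S - Z)" .
    qed (rule outer_closed_split[OF assms that])
    then show ?thesis
      unfolding L_def Pow.lambda_system_eq by auto
  qed
  have sigL: "sigma_algebra UNIV L" using msL by (simp add: measure_space_def)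
  have "sets borel = sigma_sets UNIV {S::'a set. closed S}"
    unfolding borel_eq_closed by simp
  also have "\<dots> \<subseteq> L"
    using closedL by (intro sigma_algebra.sigma_sets_subset[OF sigL]) auto
  finally have borelL: "sets borel \<subseteq> L" .
  define \<nu> where "\<nu> = measure_of UNIV (sets borel) (outer \<Lambda>)"
  have sets_\<nu>: "sets \<nu> = sets borel"
    unfolding \<nu>_def using sets.sigma_sets_eq[of borel] by simp
  have "measure_space UNIV (sets borel) (outer \<Lambda>)"
    using sets.sigma_algebra_axioms[of "borel :: 'a measure"]
    by (intro measure_down[OF msL _ borelL]) simp
  then have em: "emeasure \<nu> S = outer \<Lambda> S" if "S \<in> sets borel" for S
    using that unfolding \<nu>_def measure_space_def
    by (blast intro: emeasure_measure_of_sigma)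
  have prob: "prob_on \<nu>"
    unfolding prob_on_def
  proof (intro conjI)
    show "emeasure \<nu> K = 1" using em[of K] closed_K outer_K[OF assms] by simp
    have "outer \<Lambda> UNIV \<ge> 1" using outer_mono[of K UNIV \<Lambda>] outer_K[OF assms] by simp
    then show "emeasure \<nu> UNIV = 1"
      using outer_le_1[OF assms] em[of UNIV] by (simp add: antisym)
  qed (rule sets_\<nu>)
  interpret finite_measure \<nu> by (rule prob_on_finite[OF prob])
  have le: "(LINT x:K|\<nu>. \<phi> x) \<le> \<Lambda> \<phi>"
    if \<phi>: "continuous_on K \<phi>" "\<And>x. x \<in> K \<Longrightarrow> 0 \<le> \<phi> x \<and> \<phi> x \<le> 1" for \<phi>
  proof (rule field_le_epsilon)
    fix e :: real assume "0 < e"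
    then obtain n where n: "0 < n" "1 / real n < e"
      by (metis nat_approx_posE of_nat_0_less_iff zero_less_Suc)
    define C where "C k = {x \<in> K. real k / n \<le> \<phi> x}" for k
    have C: "C k \<in> sets \<nu>" for k
    proof -
      have "closed (C k)"
        unfolding C_def using continuous_closed_preimage[OF \<phi>(1) closed_K, of "{real k / n..}"]
        by (simp add: vimage_def Int_def)
      then show ?thesis by (simp add: sets_\<nu>)
    qed
    \<comment> \<open>\<psi> \<open>k\<close> is the slice of \<open>n * \<phi>\<close> between the
      heights \<open>k\<close> and \<open>k + 1\<close>. It equals 1 on \<open>C (Suc k)\<close>, so
      \<Lambda>(\<psi> \<open>k\<close>) bounds the measure of that set, and the slices add up to
      \<open>n * \<phi>\<close>.\<close>
    define \<psi> where "\<psi> k x = max 0 (min 1 (n * \<phi> x - real k))" for k x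
    have \<psi>c: "continuous_on K (\<psi> k)" for k
      unfolding \<psi>_def by (intro continuous_intros \<phi>(1))
    have mC: "measure \<nu> (C (Suc k)) \<le> \<Lambda> (\<psi> k)" for k
    proof -
      have "outer \<Lambda> (C (Suc k)) \<le> ennreal (\<Lambda> (\<psi> k))"
        using n(1) by (intro outer_le_state[OF assms \<psi>c]) (auto simp: \<psi>_def C_def field_simps)
      moreover have "0 \<le> \<Lambda> (\<psi> k)"
        by (intro state_nonneg[OF assms \<psi>c]) (auto simp: \<psi>_def)
      ultimately show ?thesis
        using em[of "C (Suc k)"] C[of "Suc k"] unfolding sets_\<nu>
        by (metis emeasure_eq_measure ennreal_le_iff)
    qed
    have sum\<psi>: "(\<Sum>k<m. max 0 (min 1 (t - real k))) = t" if "0 \<le> t" "t \<le> real m" for m and t :: real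
      using that
    proof (induction m arbitrary: t)
      case (Suc m)
      show ?case
      proof (cases "t \<le> real m")
        case True
        then show ?thesis using Suc.IH[OF Suc.prems(1)] by simp
      next
        case False
        have "(\<Sum>k<m. max 0 (min 1 (t - real k))) = (\<Sum>k<m. 1)"
        proof (rule sum.cong)
          fix k assume "k \<in> {..<m}"
          then have "real k + 1 \<le> real m" by (simp add: Suc_leI flip: of_nat_Suc)
          then show "max 0 (min 1 (t - real k)) = 1" using False by simp
        qed simp
        then show ?thesis using False Suc.prems by simp
      qed
    qed simp
    \<comment> \<open>The slices are bounded by the indicators of \<open>C k\<close>; shifting the
      index to \<open>Suc k\<close> loses only the term for \<open>k = 0\<close>, which accounts for
      the error \<open>1 / n\<close>.\<close>
    have bound: "indicator K x * \<phi> x \<le> 1 / n + (\<Sum>k<n. indicator (C (Suc k)) x / n)" for x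
    proof (cases "x \<in> K")
      case True
      have "n * \<phi> x = (\<Sum>k<n. \<psi> k x)"
        unfolding \<psi>_def using \<phi>(2)[OF True] by (intro sum\<psi>[symmetric]) (auto simp: mult_left_le)
      also have "\<dots> \<le> (\<Sum>k<n. indicator (C k) x)"
        using True n(1) by (intro sum_mono) (auto simp: \<psi>_def C_def indicator_def field_simps)
      also have "\<dots> \<le> (\<Sum>k<Suc n. indicator (C k) x)" by simp
      also have "\<dots> \<le> 1 + (\<Sum>k<n. indicator (C (Suc k)) x)"
        by (subst sum.lessThan_Suc_shift) (simp add: indicator_def)
      finally show ?thesis
        using n(1) True by (simp add: field_simps sum_divide_distrib[symmetric])
    qed (use n in \<open>simp add: sum_nonneg\<close>)
    have "(LINT x:K|\<nu>. \<phi> x) \<le> (\<integral>x. 1 / n + (\<Sum>k<n. indicator (C (Suc k)) x / n) \<partial>\<nu>)"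
      unfolding set_lebesgue_integral_def
    proof (rule integral_mono)
      show "integrable \<nu> (\<lambda>x. indicat_real K x *\<^sub>R \<phi> x)"
        using set_integrable_K[OF prob \<phi>(1)] by (simp add: set_integrable_def)
    qed (use bound C in \<open>auto intro!: integrable_real_indicator simp: less_top[symmetric]\<close>)
    also have "\<dots> = 1 / n + (\<Sum>k<n. measure \<nu> (C (Suc k)) / n)"
    proof -
      have "(\<integral>x. 1 / n + (\<Sum>k<n. indicator (C (Suc k)) x / n) \<partial>\<nu>) =
          (\<integral>x. 1 / n \<partial>\<nu>) + (\<Sum>k<n. \<integral>x. indicator (C (Suc k)) x / n \<partial>\<nu>)"
        using C by (subst Bochner_Integration.integral_add)
          (auto intro!: Bochner_Integration.integral_sum integrable_real_indicator simp: less_top[symmetric])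
      then show ?thesis using C prob_on_UNIV[OF prob] prob_on_space[OF prob] by simp
    qed
    also have "\<dots> \<le> 1 / n + (\<Sum>k<n. \<Lambda> (\<psi> k) / n)"
      by (intro add_left_mono sum_mono divide_right_mono mC) simp
    also have "(\<Sum>k<n. \<Lambda> (\<psi> k) / n) = \<Lambda> (\<lambda>x. \<Sum>k<n. \<psi> k x) / n"
      by (simp add: state_sum[OF assms \<psi>c] sum_divide_distrib)
    also have "\<dots> \<le> \<Lambda> (\<lambda>x. real n * \<phi> x) / n"
    proof (intro divide_right_mono state_mono[OF assms])
      show "(\<Sum>k<n. \<psi> k x) \<le> n * \<phi> x" if "x \<in> K" for x
        unfolding \<psi>_def using \<phi>(2)[OF that] by (subst sum\<psi>) (auto simp: mult_left_le)
    qed (auto intro!: continuous_intros \<psi>c \<phi>)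
    also have "\<dots> = \<Lambda> \<phi>"
      using n(1) by (simp add: state_scale[OF assms \<phi>(1)])
    finally show "(LINT x:K|\<nu>. \<phi> x) \<le> \<Lambda> \<phi> + e" using n(2) by simp
  qed
  show ?thesis
    using that[OF prob] state_le_imp_eq[OF assms integral_state[OF prob] le] by blast
qed

text \<open>For \<open>U\<close> in a countable base stable under finite intersections, the
  functions \<open>min 1 (j * h U)\<close> increase on \<open>K\<close> to the indicator of
  \<open>U\<close>, so their integrals determine the measure on a generating pi-system. The family
  makes equality of measures testable by countably many numbers.\<close>

lemma determining_family:
  obtains \<Phi> :: "nat \<Rightarrow> 'a \<Rightarrow> real" where "\<And>n. continuous_on K (\<Phi> n)"
    "\<And>n x. x \<in> K \<Longrightarrow> 0 \<le> \<Phi> n x \<and> \<Phi> n x \<le> 1"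
    "\<And>\<mu> \<nu>. prob_on \<mu> \<Longrightarrow> prob_on \<nu> \<Longrightarrow>
       (\<And>n. (LINT x:K|\<mu>. \<Phi> n x) = (LINT x:K|\<nu>. \<Phi> n x)) \<Longrightarrow> \<mu> = \<nu>"
proof -
  \<comment> \<open>Finite intersections make the base stable under intersection; the empty family
    contributes \<open>UNIV\<close>.\<close>
  define D where "D = (\<lambda>F. \<Inter>F) ` {F. finite F \<and> F \<subseteq> B}"
  have "countable D"
    unfolding D_def using countable_Collect_finite_subset[OF countable_base] by simp
  have openD: "open U" if "U \<in> D" for U
    using that base by (auto simp: D_def topological_basis_open intro!: open_Inter)
  have UNIV_D: "UNIV \<in> D" unfolding D_def by (rule image_eqI[of _ _ "{}"]) auto
  have "B \<subseteq> D" unfolding D_def by (auto intro!: image_eqI[of _ _ "{_}"])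
  have basisD: "topological_basis D"
    using base openD \<open>B \<subseteq> D\<close> unfolding topological_basis_def by (meson subset_trans)
  have "Int_stable D"
  proof (rule Int_stableI)
    fix U V assume "U \<in> D" "V \<in> D"
    then obtain F G where "finite F" "F \<subseteq> B" "U = \<Inter>F" "finite G" "G \<subseteq> B" "V = \<Inter>G"
      by (auto simp: D_def)
    then show "U \<inter> V \<in> D" unfolding D_def by (intro image_eqI[of _ _ "F \<union> G"]) auto
  qed
  have sets_D: "sets borel = sigma_sets UNIV D"
    unfolding borel_eq_countable_basis[OF \<open>countable D\<close> basisD] by (rule sets_measure_of) simp
  have "\<exists>h :: 'a \<Rightarrow> real. continuous_on K h \<and> (\<forall>x\<in>K. 0 \<le> h x \<and> h x \<le> 1) \<and>
      (\<forall>x\<in>K. h x = 0 \<longleftrightarrow> x \<in> - U)" if "U \<in> D" for U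
    using closed_zero_function[of "- U"] openD[OF that] by (metis closed_Compl)
  then have "\<exists>h :: 'a set \<Rightarrow> 'a \<Rightarrow> real. \<forall>U\<in>D. continuous_on K (h U) \<and> (\<forall>x\<in>K. 0 \<le> h U x \<and> h U x \<le> 1) \<and>
      (\<forall>x\<in>K. h U x = 0 \<longleftrightarrow> x \<in> - U)"
    by (intro bchoice ballI)
  then obtain h :: "'a set \<Rightarrow> 'a \<Rightarrow> real" where h: "\<And>U. U \<in> D \<Longrightarrow> continuous_on K (h U)"
      "\<And>U x. U \<in> D \<Longrightarrow> x \<in> K \<Longrightarrow> 0 \<le> h U x \<and> h U x \<le> 1"
      "\<And>U x. U \<in> D \<Longrightarrow> x \<in> K \<Longrightarrow> h U x = 0 \<longleftrightarrow> x \<in> - U"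
    by blast
  define \<phi> where "\<phi> U j x = min 1 (real j * h U x)" for U j x
  define \<Phi> where "\<Phi> n = \<phi> (from_nat_into D (fst (prod_decode n))) (snd (prod_decode n))" for n
  have D': "from_nat_into D k \<in> D" for k
    using UNIV_D by (metis empty_iff from_nat_into)
  have \<phi>c: "continuous_on K (\<phi> U j)" if "U \<in> D" for U j
    unfolding \<phi>_def by (intro continuous_intros h that)
  have \<phi>01: "0 \<le> \<phi> U j x \<and> \<phi> U j x \<le> 1" if "U \<in> D" "x \<in> K" for U j x
    using h(2)[OF that] by (auto simp: \<phi>_def)
  have lim: "(\<lambda>j. LINT x:K|\<nu>. \<phi> U j x) \<longlonglongrightarrow> measure \<nu> U" if U: "U \<in> D" and \<nu>: "prob_on \<nu>" for U \<nu>
  proof -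
    interpret finite_measure \<nu> by (rule prob_on_finite[OF \<nu>])
    have U\<nu>: "U \<in> sets \<nu>" using openD[OF U] prob_on_sets[OF \<nu>] by simp
    have K\<nu>: "K \<in> sets \<nu>" using closed_K prob_on_sets[OF \<nu>] by simp
    have pt: "(\<lambda>j. indicat_real K x *\<^sub>R \<phi> U j x) \<longlonglongrightarrow> indicator (U \<inter> K) x" for x
    proof (cases "x \<in> K")
      case True
      show ?thesis
      proof (cases "x \<in> U")
        case xU: True
        then have "0 < h U x" using h(2,3)[OF U True] by (auto simp: order_le_less)
        then obtain N :: nat where N: "1 / h U x < real N" using reals_Archimedean2 by blast
        have "eventually (\<lambda>j. indicat_real K x *\<^sub>R \<phi> U j x = indicator (U \<inter> K) x) sequentially"
          using eventually_ge_at_top[of N]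
        proof eventually_elim
          case (elim j)
          have "1 < real N * h U x" using N \<open>0 < h U x\<close> by (simp add: field_simps)
          also have "\<dots> \<le> real j * h U x" using elim \<open>0 < h U x\<close> by simp
          finally show ?case using True xU by (simp add: \<phi>_def)
        qed
        then show ?thesis by (rule tendsto_eventually)
      next
        case False
        then show ?thesis using True h(3)[OF U True] by (simp add: \<phi>_def)
      qed
    qed simp
    have "(\<lambda>j. LINT x:K|\<nu>. \<phi> U j x) \<longlonglongrightarrow> (\<integral>x. indicator (U \<inter> K) x \<partial>\<nu>)"
      unfolding set_lebesgue_integral_def
    proof (rule integral_dominated_convergence[where w = "\<lambda>_. 1"])
      show "(\<lambda>x. indicat_real K x *\<^sub>R \<phi> U j x) \<in> borel_measurable \<nu>" for j
        using set_integrable_K[OF \<nu> \<phi>c[OF U]] unfolding set_integrable_def by blast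
    qed (use U\<nu> K\<nu> pt \<phi>01[OF U] in \<open>auto simp: indicator_def\<close>)
    also have "(\<integral>x. indicator (U \<inter> K) x \<partial>\<nu>) = measure \<nu> (U \<inter> K)"
      using U\<nu> K\<nu> by simp
    also have "\<dots> = measure \<nu> U"
      using prob_on_AE[OF \<nu>] U\<nu> K\<nu> by (intro finite_measure_eq_AE) auto
    finally show ?thesis .
  qed
  show ?thesis
  proof (rule that[of \<Phi>])
    fix \<mu> \<nu> assume \<mu>: "prob_on \<mu>" and \<nu>: "prob_on \<nu>"
      and eq: "\<And>n. (LINT x:K|\<mu>. \<Phi> n x) = (LINT x:K|\<nu>. \<Phi> n x)"
    have "measure \<mu> U = measure \<nu> U" if U: "U \<in> D" for U
    proof -
      obtain k where k: "from_nat_into D k = U"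
        using U \<open>countable D\<close> by (metis from_nat_into_surj)
      have "\<phi> U j = \<Phi> (prod_encode (k, j))" for j
        by (simp add: \<Phi>_def k)
      then show ?thesis
        using lim[OF U \<mu>] lim[OF U \<nu>] eq LIMSEQ_unique by auto
    qed
    then have em: "emeasure \<mu> U = emeasure \<nu> U" if "U \<in> D" for U
      using that prob_on_finite[OF \<mu>] prob_on_finite[OF \<nu>]
      by (simp add: finite_measure.emeasure_eq_measure)
    show "\<mu> = \<nu>"
      by (rule measure_eqI_generator_eq[OF \<open>Int_stable D\<close>, of UNIV _ _ "\<lambda>_. UNIV"])
        (use em UNIV_D \<mu> sets_D prob_on_sets[OF \<mu>] prob_on_sets[OF \<nu>] in \<open>auto simp: prob_on_def\<close>)
  qed (auto simp: \<Phi>_def \<phi>c D' \<phi>01)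
qed

end

text \<open>The space of functionals is an uncountable product, so convergent subsequences are not
  at hand. A cluster point suffices: it inherits every closed condition that holds eventually along
  the sequence.\<close>

lemma compact_sequence_cluster:
  assumes "compact U" "\<And>n::nat. X n \<in> U"
  obtains x where "x \<in> U" "\<And>S. closed S \<Longrightarrow> eventually (\<lambda>n. X n \<in> S) sequentially \<Longrightarrow> x \<in> S"
proof -
  define F where "F = filtermap X sequentially"
  have "eventually (\<lambda>y. y \<in> U) F" "F \<noteq> bot"
    using assms(2) by (auto simp: F_def eventually_filtermap filtermap_bot_iff)
  then obtain x where x: "x \<in> U" "inf (nhds x) F \<noteq> bot"
    using assms(1) unfolding compact_filter le_principal by blast
  show ?thesis
  proof (rule that[OF x(1)], rule ccontr)
    fix S assume S: "closed S" "eventually (\<lambda>n. X n \<in> S) sequentially" "x \<notin> S"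
    then have "eventually (\<lambda>y. y \<in> - S) (nhds x)"
      by (intro eventually_nhds_in_open) auto
    moreover have "eventually (\<lambda>y. y \<in> S) F"
      using S(2) by (simp add: F_def eventually_filtermap)
    ultimately have "eventually (\<lambda>y. False) (inf (nhds x) F)"
      unfolding eventually_inf by (intro exI[of _ "\<lambda>y. y \<in> - S"] exI[of _ "\<lambda>y. y \<in> S"]) auto
    then show False using x(2) by (simp add: eventually_False)
  qed
qed

section \<open>Subadditive cocycles: orbit bounds, invariant states and their growth\<close>

locale subadditive_cocycle = compact_countable_base K B
  for K :: "'a::t2_space set" and B +
  fixes f :: "'a \<Rightarrow> 'a" and b :: "nat \<Rightarrow> 'a \<Rightarrow> real"
  assumes continuous_f: "continuous_on UNIV f" and f_K: "f ` K \<subseteq> K" and K_nonempty: "K \<noteq> {}"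
    and continuous_b: "\<And>n. continuous_on K (b n)"
    and subadditive: "\<And>m n p. 1 \<le> m \<Longrightarrow> 1 \<le> n \<Longrightarrow> p \<in> K \<Longrightarrow> b (m + n) p \<le> b m p + b n ((f ^^ m) p)"
begin

lemma f_in_K: "p \<in> K \<Longrightarrow> f p \<in> K"
  using f_K by blast

lemma funpow_in_K: "p \<in> K \<Longrightarrow> (f ^^ n) p \<in> K"
  by (induction n) (auto simp: f_in_K)

lemma continuous_on_K_comp: "continuous_on K \<phi> \<Longrightarrow> continuous_on K (\<lambda>x. \<phi> (f x))"
  using continuous_on_compose2[of K \<phi> K f] continuous_on_subset[OF continuous_f] f_K by auto

lemma continuous_on_bound:
  assumes "continuous_on K (\<phi> :: 'a \<Rightarrow> real)"
  obtains M where "0 < M" "\<And>x. x \<in> K \<Longrightarrow> \<bar>\<phi> x\<bar> \<le> M"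
  using compact_imp_bounded[OF compact_continuous_image[OF assms compact]]
  unfolding bounded_pos by auto

lemma b_linear_bound:
  assumes "\<And>p. p \<in> K \<Longrightarrow> b 1 p \<le> C" "p \<in> K" "1 \<le> n"
  shows "b n p \<le> C * n"
  using assms(3,2)
proof (induction n arbitrary: p rule: dec_induct)
  case base
  then show ?case using assms(1) by simp
next
  case (step n)
  have "b (Suc n) p \<le> b 1 p + b n (f p)"
    using subadditive[of 1 n p] step by simp
  also have "\<dots> \<le> C + C * n"
    using step assms(1) f_in_K by (intro add_mono) auto
  finally show ?case by (simp add: algebra_simps)
qed

text \<open>
  Along an orbit, jump by \<open>n\<close> whenever \<open>b n \<le> - \<epsilon> * n\<close> for some \<open>n \<le> N\<close>, and by one otherwise.
\<close>

lemma b_orbit_bound: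
  fixes N :: nat and \<epsilon> C :: real
  defines "bad p \<equiv> (if \<exists>n\<in>{1..N}. b n p \<le> - \<epsilon> * n then 0 else 1)"
  assumes "\<And>p. p \<in> K \<Longrightarrow> b 1 p \<le> C" "0 \<le> C" "0 \<le> \<epsilon>" "p \<in> K" "1 \<le> T"
  shows "b T p \<le> - \<epsilon> * T + (C + \<epsilon>) * (\<Sum>i<T. bad ((f ^^ i) p)) + N * (C + \<epsilon>)"
  using assms(5,6)
proof (induction T arbitrary: p rule: less_induct)
  case (less T)
  have bad0: "0 \<le> bad q" for q by (simp add: bad_def)
  have b_le: "b T p \<le> - \<epsilon> * T + (C + \<epsilon>) * T"
    using b_linear_bound[OF assms(2) less.prems] by (simp add: algebra_simps)
  show ?case
  proof (cases "\<exists>n\<in>{1..N}. b n p \<le> - \<epsilon> * n")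
    case False
    then have badp: "bad p = 1" by (simp add: bad_def)
    show ?thesis
    proof (cases "T = 1")
      case True
      moreover have "0 \<le> N * (C + \<epsilon>)" using assms(3,4) by simp
      ultimately show ?thesis using b_le badp by simp
    next
      case False
      then obtain S where S: "T = Suc S" "1 \<le> S" using less.prems(2) by (cases T) auto
      have "b T p \<le> b 1 p + b S (f p)"
        using subadditive[of 1 S p] S less.prems by simp
      also have "\<dots> \<le> C + (- \<epsilon> * S + (C + \<epsilon>) * (\<Sum>i<S. bad ((f ^^ i) (f p))) + N * (C + \<epsilon>))"
        using S less.prems f_in_K by (intro add_mono assms(2) less.IH) auto
      also have "(\<Sum>i<T. bad ((f ^^ i) p)) = 1 + (\<Sum>i<S. bad ((f ^^ i) (f p)))"
        unfolding S(1) sum.lessThan_Suc_shift by (simp add: badp funpow_swap1)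
      ultimately show ?thesis
        using S(1) by (simp add: algebra_simps)
    qed
  next
    case True
    then obtain n where n: "1 \<le> n" "n \<le> N" "b n p \<le> - \<epsilon> * n" by auto
    show ?thesis
    \<comment> \<open>A jump that overshoots the end leaves at most \<open>N\<close> steps, which
      the additive term \<open>N * (C + \<epsilon>)\<close> pays for.\<close>
    proof (cases "T \<le> n")
      case True
      have "(C + \<epsilon>) * T \<le> N * (C + \<epsilon>)"
        using True n(2) assms(3,4) by (subst mult.commute, intro mult_right_mono) auto
      moreover have "0 \<le> (C + \<epsilon>) * (\<Sum>i<T. bad ((f ^^ i) p))"
        using assms(3,4) bad0 by (simp add: sum_nonneg)
      ultimately show ?thesis using b_le by simp
    next
      case False
      then obtain S where S: "T = n + S" "1 \<le> S" "S < T"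
        using n(1) less_imp_add_positive[of n T] by fastforce
      have "b T p \<le> b n p + b S ((f ^^ n) p)"
        using subadditive[of n S p] S n less.prems by simp
      also have "\<dots> \<le> - \<epsilon> * n + (- \<epsilon> * S + (C + \<epsilon>) * (\<Sum>i<S. bad ((f ^^ i) ((f ^^ n) p))) + N * (C + \<epsilon>))"
        using S less.prems funpow_in_K by (intro add_mono n(3) less.IH) auto
      finally have 1: "b T p \<le> - \<epsilon> * T + (C + \<epsilon>) * (\<Sum>i<S. bad ((f ^^ (i + n)) p)) + N * (C + \<epsilon>)"
        unfolding S(1) by (simp add: algebra_simps funpow_add)
      have "(\<Sum>i<S. bad ((f ^^ (i + n)) p)) = (\<Sum>i\<in>{n..<T}. bad ((f ^^ i) p))"
        unfolding S(1) using sum.shift_bounds_nat_ivl[of "\<lambda>i. bad ((f ^^ i) p)" 0 n S]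
        by (simp add: atLeast0LessThan add.commute)
      also have "\<dots> \<le> (\<Sum>i<T. bad ((f ^^ i) p))"
        by (intro sum_mono2) (auto simp: bad0)
      finally have "(C + \<epsilon>) * (\<Sum>i<S. bad ((f ^^ (i + n)) p)) \<le> (C + \<epsilon>) * (\<Sum>i<T. bad ((f ^^ i) p))"
        using assms(3,4) by (intro mult_left_mono) auto
      with 1 show ?thesis by linarith
    qed
  qed
qed

text \<open>If every point had a negative value at some time, compactness would bound time and rate
  uniformly. Then no time along any orbit is bad, and \<open>b_orbit_bound\<close> makes
  \<open>b T\<close> negative on all of \<open>K\<close> for large \<open>T\<close>, against the
  assumption.\<close>

lemma nonneg_point:
  assumes "\<And>n. 1 \<le> n \<Longrightarrow> \<exists>p\<in>K. 0 \<le> b n p"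
  obtains p where "p \<in> K" "\<And>n. 1 \<le> n \<Longrightarrow> 0 \<le> b n p"
proof (rule ccontr)
  note point = that
  assume "\<not> thesis"
  then have neg: "\<exists>n\<ge>1. b n p < 0" if "p \<in> K" for p
    using that point by (metis not_le)
  obtain C where C: "0 < C" "\<And>x. x \<in> K \<Longrightarrow> \<bar>b 1 x\<bar> \<le> C"
    using continuous_on_bound[OF continuous_b] by metis
  \<comment> \<open>One index bounds the time from above and the rate from below, which makes the
    condition monotone in \<open>N\<close> and, being a strict inequality, open in
    \<open>p\<close>.\<close>
  define P where "P N p \<longleftrightarrow> 1 \<le> N \<and> (\<exists>n\<in>{1..N}. b n p < - real n / real N)" for N p
  obtain N where N: "\<And>p. p \<in> K \<Longrightarrow> P N p"
  proof (rule compact_mono_cover[OF compact, of P])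
    fix N :: nat
    have "openin (top_of_set K) {p \<in> K. b n p < - n / N}" for n :: nat
      using continuous_openin_preimage_gen[OF continuous_b, of "{..<- n / N}" n]
      by (simp add: vimage_def Int_def)
    then have "openin (top_of_set K) (\<Union>n\<in>{1..N}. {p \<in> K. b n p < - n / N})"
      by (intro openin_Union) blast
    moreover have "{p \<in> K. 1 \<le> N \<and> (\<exists>n\<in>{1..N}. b n p < - n / N)} =
        (\<Union>n\<in>{1..N}. {p \<in> K. b n p < - n / N})"
      by auto
    ultimately show "openin (top_of_set K) {p \<in> K. P N p}"
      by (simp add: P_def)
  next
    fix p assume "p \<in> K"
    then obtain n where n: "1 \<le> n" "b n p < 0" using neg by blast
    define u where "u = - b n p"
    have u: "0 < u" using n(2) by (simp add: u_def)
    obtain k where k: "n / u < real k" using reals_Archimedean2 by blast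
    define l where "l = max n k"
    have "n / u < real l" using k by (simp add: l_def)
    then have "n < real l * u" using u by (simp add: pos_divide_less_eq)
    then have "n / real l < u"
      using n(1) by (simp add: l_def pos_divide_less_eq mult.commute)
    then have "b n p < - n / max n k"
      by (simp add: u_def l_def)
    then show "\<exists>N. P N p"
      unfolding P_def using n(1) by (intro exI[of _ "max n k"]) auto
  next
    fix m n :: nat and p
    assume mn: "m \<le> n" and "P m p"
    then obtain i where i: "i \<in> {1..m}" "b i p < - i / m" and m: "1 \<le> m" by (auto simp: P_def)
    have "real i / n \<le> i / m" using m mn by (intro divide_left_mono) auto
    then have "b i p < - i / n" using i(2) by simp
    then show "P n p"
      unfolding P_def using i(1) m mn by (intro conjI bexI[of _ i]) auto
  qed blast
  have N1: "1 \<le> N" using N K_nonempty unfolding P_def by blast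
  obtain T :: nat where T: "N * (N * (C + 1 / N)) + 1 < T" using reals_Archimedean2 by blast
  have "0 \<le> N * (N * (C + 1 / N))" using C by simp
  then have "1 < real T" using T by linarith
  then have "1 \<le> T" by simp
  then obtain p where p: "p \<in> K" "0 \<le> b T p" using assms by blast
  have bad0: "\<exists>n\<in>{1..N}. b n q \<le> - (1 / N) * n" if "q \<in> K" for q
    using N[OF that] by (auto simp: P_def intro!: less_imp_le)
  have "b T p \<le> - (1 / N) * T + (C + 1 / N) * (\<Sum>i<T. if \<exists>n\<in>{1..N}. b n ((f ^^ i) p) \<le> - (1 / N) * n then 0 else 1)
       + N * (C + 1 / N)"
    using C p \<open>1 \<le> T\<close> by (intro b_orbit_bound) (auto simp: abs_le_iff)
  also have "(\<Sum>i<T. if \<exists>n\<in>{1..N}. b n ((f ^^ i) p) \<le> - (1 / N) * n then 0 else 1 :: real) = 0"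
    using bad0[OF funpow_in_K[OF p(1)]] by (intro sum.neutral) auto
  finally have "0 \<le> - (1 / N) * T + N * (C + 1 / N)" using p(2) by simp
  then have "T \<le> N * (N * (C + 1 / N))" using N1 by (simp add: field_simps)
  with T show False by linarith
qed

text \<open>The value 0 at discontinuous functions is a normalisation: it confines every coordinate
  to a compact set and makes functionals equal as soon as they agree on \<open>C(K)\<close>.\<close>

definition invariant_states :: "(('a \<Rightarrow> real) \<Rightarrow> real) set" where
  "invariant_states = {\<Lambda>. state \<Lambda> \<and> (\<forall>\<phi>. continuous_on K \<phi> \<longrightarrow> \<Lambda> (\<lambda>x. \<phi> (f x)) = \<Lambda> \<phi>) \<and>
     (\<forall>\<phi>. \<not> continuous_on K \<phi> \<longrightarrow> \<Lambda> \<phi> = 0)}"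

text \<open>A common shape for additivity, homogeneity, normalisation and invariance, each of which
  is thereby a closed condition in the product topology.\<close>

lemma closed_coordinate_eq:
  "closed {\<Lambda> :: ('a \<Rightarrow> real) \<Rightarrow> real. \<Lambda> \<phi> = c * \<Lambda> \<psi> + d * \<Lambda> \<zeta> + e}"
  by (intro closed_Collect_eq continuous_intros continuous_on_product_coordinates)

lemma closed_coordinate_ge: "closed {\<Lambda> :: ('a \<Rightarrow> real) \<Rightarrow> real. c \<le> \<Lambda> \<phi>}"
  by (intro closed_Collect_le continuous_intros continuous_on_product_coordinates)

lemma closed_state: "closed {\<Lambda>. state \<Lambda>}"
proof -
  have "{\<Lambda>. state \<Lambda>} =
    (\<Inter>\<phi>\<in>{\<phi>. continuous_on K \<phi>}. \<Inter>\<psi>\<in>{\<psi>. continuous_on K \<psi>}.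
        {\<Lambda>. \<Lambda> (\<lambda>x. \<phi> x + \<psi> x) = 1 * \<Lambda> \<phi> + 1 * \<Lambda> \<psi> + 0}) \<inter>
    (\<Inter>c. \<Inter>\<phi>\<in>{\<phi>. continuous_on K \<phi>}. {\<Lambda>. \<Lambda> (\<lambda>x. c * \<phi> x) = c * \<Lambda> \<phi> + 0 * \<Lambda> \<phi> + 0}) \<inter>
    (\<Inter>\<phi>\<in>{\<phi>. continuous_on K \<phi> \<and> (\<forall>x\<in>K. 0 \<le> \<phi> x)}. {\<Lambda>. 0 \<le> \<Lambda> \<phi>}) \<inter>
    {\<Lambda>. \<Lambda> (\<lambda>_. 1) = 0 * \<Lambda> (\<lambda>_. 1) + 0 * \<Lambda> (\<lambda>_. 1) + 1}"
    unfolding state_def by auto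
  also have "closed \<dots>"
    by (intro closed_Int closed_INT ballI closed_coordinate_eq closed_coordinate_ge)
  finally show ?thesis .
qed

lemma closed_invariant_states: "closed invariant_states"
proof -
  have "invariant_states = {\<Lambda>. state \<Lambda>} \<inter>
    (\<Inter>\<phi>\<in>{\<phi>. continuous_on K \<phi>}. {\<Lambda>. \<Lambda> (\<lambda>x. \<phi> (f x)) = 1 * \<Lambda> \<phi> + 0 * \<Lambda> \<phi> + 0}) \<inter>
    (\<Inter>\<phi>\<in>{\<phi>. \<not> continuous_on K \<phi>}. {\<Lambda>. \<Lambda> \<phi> = 0 * \<Lambda> \<phi> + 0 * \<Lambda> \<phi> + 0})"
    unfolding invariant_states_def by auto
  also have "closed \<dots>"
    by (intro closed_Int closed_INT ballI closed_coordinate_eq closed_state)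
  finally show ?thesis .
qed

text \<open>The sup norm bound for every coordinate. Compactness of the product of these intervals
  is the Banach-Alaoglu argument.\<close>

definition state_box :: "('a \<Rightarrow> real) \<Rightarrow> real set" where
  "state_box \<phi> = (if continuous_on K \<phi> then {- (SUP x\<in>K. \<bar>\<phi> x\<bar>)..(SUP x\<in>K. \<bar>\<phi> x\<bar>)} else {0})"

lemma compact_state_box: "compact (PiE UNIV state_box)"
proof -
  have "compactin (product_topology (\<lambda>_. euclidean) UNIV) (PiE UNIV state_box)"
    unfolding compactin_PiE by (simp add: state_box_def)
  then show ?thesis
    by (simp add: euclidean_product_topology)
qed

lemma state_in_box:
  assumes "state \<Lambda>" "\<And>\<phi>. \<not> continuous_on K \<phi> \<Longrightarrow> \<Lambda> \<phi> = 0"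
  shows "\<Lambda> \<in> PiE UNIV state_box"
proof -
  have "\<bar>\<Lambda> \<phi>\<bar> \<le> (SUP x\<in>K. \<bar>\<phi> x\<bar>)" if \<phi>: "continuous_on K \<phi>" for \<phi>
  proof -
    obtain M where "\<And>x. x \<in> K \<Longrightarrow> \<bar>\<phi> x\<bar> \<le> M"
      using continuous_on_bound[OF \<phi>] by metis
    then have s: "\<bar>\<phi> x\<bar> \<le> (SUP x\<in>K. \<bar>\<phi> x\<bar>)" if "x \<in> K" for x
      using that by (intro cSUP_upper) (auto intro!: bdd_aboveI2)
    have "\<Lambda> \<phi> \<le> \<Lambda> (\<lambda>_. SUP x\<in>K. \<bar>\<phi> x\<bar>)"
      using s by (intro state_mono[OF assms(1) \<phi> continuous_on_const]) (auto simp: abs_le_iff)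
    moreover have "\<Lambda> (\<lambda>_. - (SUP x\<in>K. \<bar>\<phi> x\<bar>)) \<le> \<Lambda> \<phi>"
      using s by (intro state_mono[OF assms(1) continuous_on_const \<phi>]) (force simp: abs_le_iff)
    ultimately show ?thesis by (simp add: state_const[OF assms(1)])
  qed
  then show ?thesis
    using assms(2) by (auto simp: state_box_def abs_le_iff minus_le_iff)
qed

lemma compact_invariant_states: "compact invariant_states"
proof -
  have "invariant_states \<subseteq> PiE UNIV state_box"
    using state_in_box by (auto simp: invariant_states_def)
  then show ?thesis
    using compact_Int_closed[OF compact_state_box closed_invariant_states]
    by (simp add: inf.absorb2)
qed

text \<open>The condition says that the infimum of \<Lambda>(\<open>b m\<close>) / \<open>m\<close>
  is at least \<beta>. As a family of closed conditions it keeps the set compact, although the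
  infimum itself need not be continuous.\<close>

definition growth_states :: "real \<Rightarrow> (('a \<Rightarrow> real) \<Rightarrow> real) set" where
  "growth_states \<beta> = {\<Lambda> \<in> invariant_states. \<forall>m\<ge>1. \<beta> * m \<le> \<Lambda> (b m)}"

lemma compact_growth_states: "compact (growth_states \<beta>)"
proof -
  have "growth_states \<beta> = invariant_states \<inter> (\<Inter>m\<in>{1..}. {\<Lambda>. \<beta> * m \<le> \<Lambda> (b m)})"
    by (auto simp: growth_states_def)
  moreover have "compact \<dots>"
    by (intro compact_Int_closed compact_invariant_states closed_INT ballI closed_coordinate_ge)
  ultimately show ?thesis by simp
qed

text \<open>Krylov-Bogolyubov: a cluster point of the averages along the orbit of \<open>p\<close>.
  The invariance defect is a boundary term of order 1/n. Subadditivity bounds the sum of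
  \<open>b m\<close> along the orbit below by a telescoping sum of values \<open>b i p\<close>, all
  of them nonnegative except for boundedly many subtracted ones.\<close>

lemma growth_states_0:
  assumes p: "p \<in> K" "\<And>n. 1 \<le> n \<Longrightarrow> 0 \<le> b n p"
  shows "growth_states 0 \<noteq> {}"
proof -
  define \<Lambda> where "\<Lambda> n \<phi> = (if continuous_on K \<phi> then (\<Sum>i<Suc n. \<phi> ((f ^^ i) p)) / Suc n else 0)"
    for n \<phi>
  have pK: "(f ^^ i) p \<in> K" for i by (rule funpow_in_K[OF p(1)])
  have st: "state (\<Lambda> n)" for n
    unfolding state_def
    by (auto simp: \<Lambda>_def sum.distrib add_divide_distrib sum_distrib_left[symmetric] pK
        intro!: continuous_intros divide_nonneg_pos sum_nonneg add_nonneg_nonneg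
        simp del: sum.lessThan_Suc)
  have "\<Lambda> n \<in> PiE UNIV state_box" for n
    by (rule state_in_box[OF st]) (simp add: \<Lambda>_def)
  then obtain M where M: "M \<in> PiE UNIV state_box"
      "\<And>S. closed S \<Longrightarrow> eventually (\<lambda>n. \<Lambda> n \<in> S) sequentially \<Longrightarrow> M \<in> S"
    using compact_sequence_cluster[OF compact_state_box, of \<Lambda>] by metis
  have "state M"
    using M(2)[OF closed_state] st by simp
  \<comment> \<open>Passes to the cluster point any lower bound that holds for the averages up to an
    error \<open>D / Suc n\<close>.\<close>
  have ge: "c \<le> M \<psi> - M \<phi>" if "\<And>n. c - D / Suc n \<le> \<Lambda> n \<psi> - \<Lambda> n \<phi>" for c D \<phi> \<psi>
  proof (rule field_le_epsilon)
    fix e :: real assume e: "0 < e"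
    have "closed {\<Lambda> :: ('a \<Rightarrow> real) \<Rightarrow> real. c - e \<le> \<Lambda> \<psi> - \<Lambda> \<phi>}"
      by (intro closed_Collect_le continuous_intros continuous_on_product_coordinates)
    moreover have "eventually (\<lambda>n. c - e \<le> \<Lambda> n \<psi> - \<Lambda> n \<phi>) sequentially"
    proof -
      have "(\<lambda>n. D * inverse (real (Suc n))) \<longlonglongrightarrow> D * 0"
        by (intro tendsto_intros LIMSEQ_inverse_real_of_nat)
      then have "eventually (\<lambda>n. D * inverse (real (Suc n)) < e) sequentially"
        using e by (intro order_tendstoD(2)) auto
      then show ?thesis
      proof eventually_elim
        case (elim n)
        then show ?case using that[of n] by (simp add: divide_inverse)
      qed
    qed
    ultimately have "c - e \<le> M \<psi> - M \<phi>" using M(2)[of "{\<Lambda>. c - e \<le> \<Lambda> \<psi> - \<Lambda> \<phi>}"] by simp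
    then show "c \<le> M \<psi> - M \<phi> + e" by simp
  qed
  have "M \<in> growth_states 0"
    unfolding growth_states_def invariant_states_def
  proof (intro CollectI conjI allI impI)
    fix \<phi> :: "'a \<Rightarrow> real" assume \<phi>: "continuous_on K \<phi>"
    obtain D where D: "0 < D" "\<And>x. x \<in> K \<Longrightarrow> \<bar>\<phi> x\<bar> \<le> D"
      using continuous_on_bound[OF \<phi>] by metis
    have diff: "\<Lambda> n (\<lambda>x. \<phi> (f x)) - \<Lambda> n \<phi> = (\<phi> ((f ^^ Suc n) p) - \<phi> p) / Suc n" for n
    proof -
      have "(\<Sum>i<Suc n. \<phi> ((f ^^ Suc i) p)) - (\<Sum>i<Suc n. \<phi> ((f ^^ i) p)) = \<phi> ((f ^^ Suc n) p) - \<phi> p"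
        using sum_lessThan_telescope[of "\<lambda>i. \<phi> ((f ^^ i) p)" "Suc n"]
        by (simp only: sum_subtractf) simp
      then show ?thesis
        using \<phi> continuous_on_K_comp[OF \<phi>]
        by (simp add: \<Lambda>_def diff_divide_distrib[symmetric] del: sum.lessThan_Suc)
    qed
    have bd: "\<bar>\<phi> ((f ^^ Suc n) p) - \<phi> p\<bar> \<le> 2 * D" for n
      using D(2)[OF pK[of "Suc n"]] D(2)[OF p(1)] by linarith
    have "0 \<le> M (\<lambda>x. \<phi> (f x)) - M \<phi>"
    proof (rule ge)
      fix n
      have "- (2 * D) / Suc n \<le> (\<phi> ((f ^^ Suc n) p) - \<phi> p) / Suc n"
        using bd[of n] by (intro divide_right_mono) (auto simp: abs_le_iff)
      then show "0 - 2 * D / Suc n \<le> \<Lambda> n (\<lambda>x. \<phi> (f x)) - \<Lambda> n \<phi>"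
        unfolding diff by simp
    qed
    moreover have "0 \<le> M \<phi> - M (\<lambda>x. \<phi> (f x))"
    proof (rule ge)
      fix n
      have "(\<phi> ((f ^^ Suc n) p) - \<phi> p) / Suc n \<le> (2 * D) / Suc n"
        using bd[of n] by (intro divide_right_mono) (auto simp: abs_le_iff)
      then show "0 - 2 * D / Suc n \<le> \<Lambda> n \<phi> - \<Lambda> n (\<lambda>x. \<phi> (f x))"
        using diff[of n] by simp
    qed
    ultimately show "M (\<lambda>x. \<phi> (f x)) = M \<phi>" by simp
  next
    fix \<phi> :: "'a \<Rightarrow> real" assume "\<not> continuous_on K \<phi>"
    then show "M \<phi> = 0" using M(1) by (auto simp: state_box_def PiE_iff split: if_splits)
  next
    fix m :: nat assume m: "1 \<le> m"
    define D where "D = (\<Sum>i<m. \<bar>b i p\<bar>)"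
    have "0 \<le> M (b m) - M (\<lambda>_. 0)"
    proof (rule ge)
      fix n
      \<comment> \<open>Subadditivity is assumed for positive times only; with the value 0 at time 0
        the inequality \<open>step\<close> also holds for \<open>i = 0\<close>.\<close>
      define b' where "b' i = (if i = 0 then 0 else b i p)" for i
      have b'0: "0 \<le> b' i" for i using p(2) by (simp add: b'_def)
      have step: "b' (i + m) - b' i \<le> b m ((f ^^ i) p)" for i
        using subadditive[of i m p] m p(1) by (auto simp: b'_def)
      have "- D \<le> (\<Sum>i<Suc n. b' (i + m)) - (\<Sum>i<Suc n. b' i)"
      proof -
        have "(\<Sum>i<Suc n. b' (i + m)) + (\<Sum>i<m. b' i) = (\<Sum>i<Suc n + m. b' i)"
          using sum.atLeastLessThan_concat[of 0 m "Suc n + m" b']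
            sum.shift_bounds_nat_ivl[of b' 0 m "Suc n"] by (simp add: atLeast0LessThan)
        moreover have "(\<Sum>i<Suc n. b' i) \<le> (\<Sum>i<Suc n + m. b' i)"
          by (intro sum_mono2) (auto simp: b'0)
        moreover have "(\<Sum>i<m. b' i) \<le> D"
          unfolding D_def by (intro sum_mono) (auto simp: b'_def)
        ultimately show ?thesis by linarith
      qed
      also have "\<dots> \<le> (\<Sum>i<Suc n. b m ((f ^^ i) p))"
        unfolding sum_subtractf[symmetric] by (intro sum_mono step)
      finally have "- D / Suc n \<le> (\<Sum>i<Suc n. b m ((f ^^ i) p)) / Suc n"
        by (intro divide_right_mono) auto
      then show "0 - D / Suc n \<le> \<Lambda> n (b m) - \<Lambda> n (\<lambda>_. 0)"
        by (simp add: \<Lambda>_def continuous_b del: sum.lessThan_Suc)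
    qed
    then show "0 * real m \<le> M (b m)"
      using state_const[OF \<open>state M\<close>, of 0] by simp
  qed (rule \<open>state M\<close>)
  then show ?thesis by blast
qed


text \<open>The growth rates of invariant states are bounded by the maximum of \<open>b 1\<close>,
  and a cluster point of almost optimal states attains their supremum. The last conclusion says that
  no invariant state exceeds \<beta>, in the form in which the face argument consumes it.\<close>

lemma maximal_growth:
  assumes "growth_states 0 \<noteq> {}"
  obtains \<beta> where "0 \<le> \<beta>" "growth_states \<beta> \<noteq> {}"
    "\<And>\<eta> \<Lambda>. 0 < \<eta> \<Longrightarrow> \<Lambda> \<in> invariant_states \<Longrightarrow> \<exists>m\<ge>1. \<Lambda> (b m) < (\<beta> + \<eta>) * m"
proof -
  define R where "R = {\<beta>. growth_states \<beta> \<noteq> {}}"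
  obtain C where C: "0 < C" "\<And>x. x \<in> K \<Longrightarrow> \<bar>b 1 x\<bar> \<le> C"
    using continuous_on_bound[OF continuous_b] by metis
  have le: "\<beta> \<le> C" if \<beta>: "\<beta> \<in> R" for \<beta>
  proof -
    obtain \<Lambda> where "\<Lambda> \<in> growth_states \<beta>"
      using \<beta> by (auto simp: R_def)
    then have "state \<Lambda>" "\<forall>m\<ge>1. \<beta> * real m \<le> \<Lambda> (b m)"
      by (auto simp: growth_states_def invariant_states_def)
    from this(1) this(2)[rule_format, of 1] have \<Lambda>: "state \<Lambda>" "\<beta> \<le> \<Lambda> (b 1)" by auto
    have "\<Lambda> (b 1) \<le> \<Lambda> (\<lambda>_. C)"
      using C by (intro state_mono[OF \<Lambda>(1) continuous_b continuous_on_const]) (auto simp: abs_le_iff)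
    then show ?thesis using \<Lambda> by (simp add: state_const)
  qed
  then have bdd: "bdd_above R" by (auto intro!: bdd_aboveI)
  have "0 \<in> R" using assms by (simp add: R_def)
  define \<beta> where "\<beta> = Sup R"
  have "\<exists>\<Lambda>. \<Lambda> \<in> growth_states (\<beta> - 1 / Suc n)" for n
  proof -
    have "\<beta> - 1 / Suc n < \<beta>" by simp
    then obtain \<gamma> where \<gamma>: "\<gamma> \<in> R" "\<beta> - 1 / Suc n < \<gamma>"
      using less_cSup_iff[OF _ bdd, of "\<beta> - 1 / Suc n"] \<open>0 \<in> R\<close> unfolding \<beta>_def by blast
    then obtain \<Lambda> where \<Lambda>: "\<Lambda> \<in> growth_states \<gamma>" by (auto simp: R_def)
    have "(\<beta> - 1 / Suc n) * m \<le> \<gamma> * m" for m :: nat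
      using \<gamma>(2) by (intro mult_right_mono) auto
    then have "\<Lambda> \<in> growth_states (\<beta> - 1 / Suc n)"
      using \<Lambda> unfolding growth_states_def by (blast intro: order_trans)
    then show ?thesis by blast
  qed
  then obtain \<Lambda> where \<Lambda>: "\<And>n. \<Lambda> n \<in> growth_states (\<beta> - 1 / Suc n)" by metis
  then have "\<Lambda> n \<in> invariant_states" for n by (simp add: growth_states_def)
  then obtain M where M: "M \<in> invariant_states"
      "\<And>S. closed S \<Longrightarrow> eventually (\<lambda>n. \<Lambda> n \<in> S) sequentially \<Longrightarrow> M \<in> S"
    using compact_sequence_cluster[OF compact_invariant_states, of \<Lambda>] by metis
  have "\<beta> * m \<le> M (b m)" if "1 \<le> m" for m :: nat
  proof (rule field_le_epsilon)
    fix e :: real assume e: "0 < e"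
    have "(\<lambda>n. real m * inverse (real (Suc n))) \<longlonglongrightarrow> real m * 0"
      by (intro tendsto_intros LIMSEQ_inverse_real_of_nat)
    then have "eventually (\<lambda>n. m * inverse (real (Suc n)) < e) sequentially"
      using e by (intro order_tendstoD(2)) auto
    then have "eventually (\<lambda>n. \<Lambda> n \<in> {\<Lambda>. \<beta> * m - e \<le> \<Lambda> (b m)}) sequentially"
    proof eventually_elim
      case (elim n)
      have "(\<beta> - 1 / Suc n) * m \<le> \<Lambda> n (b m)"
        using \<Lambda>[of n] that unfolding growth_states_def by blast
      with elim show ?case by (simp add: algebra_simps divide_inverse)
    qed
    from M(2)[OF closed_coordinate_ge this] show "\<beta> * m \<le> M (b m) + e" by simp
  qed
  then have "growth_states \<beta> \<noteq> {}"
    using M(1) by (auto simp: growth_states_def)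
  moreover have "0 \<le> \<beta>"
    unfolding \<beta>_def using \<open>0 \<in> R\<close> bdd by (rule cSup_upper)
  moreover have "\<exists>m\<ge>1. \<Lambda> (b m) < (\<beta> + \<eta>) * m" if "0 < \<eta>" "\<Lambda> \<in> invariant_states" for \<eta> \<Lambda>
  proof (rule ccontr)
    assume "\<not> ?thesis"
    then have "\<Lambda> \<in> growth_states (\<beta> + \<eta>)"
      using that(2) by (auto simp: growth_states_def not_less)
    then have "\<beta> + \<eta> \<le> \<beta>"
      unfolding \<beta>_def by (intro cSup_upper bdd) (auto simp: R_def)
    then show False using that(1) by simp
  qed
  ultimately show ?thesis using that by blast
qed

text \<open>Brings rates observed at two different times \<open>m\<close> and \<open>n\<close> to
  the common time \<open>n * m\<close>: subadditivity cuts the time into blocks, and invariance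
  gives all blocks the same value.\<close>

lemma invariant_state_b_mult:
  assumes "\<Lambda> \<in> invariant_states" "1 \<le> m" "1 \<le> n"
  shows "\<Lambda> (b (n * m)) \<le> n * \<Lambda> (b m)"
  using assms(3)
proof (induction n rule: dec_induct)
  case (step n)
  have st: "state \<Lambda>" using assms(1) by (simp add: invariant_states_def)
  have cont: "continuous_on K (\<lambda>x. b m ((f ^^ k) x))" and inv: "\<Lambda> (\<lambda>x. b m ((f ^^ k) x)) = \<Lambda> (b m)" for k
  proof (induction k)
    case (Suc k)
    {
      case 1
      show ?case using continuous_on_K_comp[OF Suc.IH(1)] by (simp add: funpow_swap1)
    next
      case 2
      have "\<Lambda> (\<lambda>x. b m ((f ^^ k) (f x))) = \<Lambda> (\<lambda>x. b m ((f ^^ k) x))"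
        using assms(1) Suc.IH(1) unfolding invariant_states_def by blast
      then show ?case using Suc.IH(2) by (simp add: funpow_swap1)
    }
  qed (auto simp: continuous_b)
  have "\<Lambda> (b (n * m + m)) \<le> \<Lambda> (\<lambda>x. b (n * m) x + b m ((f ^^ (n * m)) x))"
    using assms(2) step(1) by (intro state_mono[OF st continuous_b] continuous_on_add continuous_b cont subadditive) auto
  also have "\<dots> = \<Lambda> (b (n * m)) + \<Lambda> (b m)"
    using state_add[OF st continuous_b cont] inv by simp
  finally show ?case using step by (simp add: algebra_simps)
qed simp

text \<open>\<open>\<Lambda> \<mapsto> inf (\<Lambda> (b m) / m)\<close> is affine on the invariant states, so its maximisers form a face.\<close>

lemma maximal_growth_face:
  fixes \<beta> :: real
  assumes max: "\<And>\<eta> \<Lambda>. 0 < \<eta> \<Longrightarrow> \<Lambda> \<in> invariant_states \<Longrightarrow> \<exists>m\<ge>1. \<Lambda> (b m) < (\<beta> + \<eta>) * m"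
    and \<Lambda>: "\<Lambda> \<in> growth_states \<beta>" and M: "M \<in> invariant_states" and N: "N \<in> invariant_states"
    and t: "0 < t" "t \<le> 1"
    and conv: "\<And>\<phi>. \<Lambda> \<phi> = t * M \<phi> + (1 - t) * N \<phi>"
  shows "M \<in> growth_states \<beta>"
proof (rule ccontr)
  assume "M \<notin> growth_states \<beta>"
  then obtain m where m: "1 \<le> m" "M (b m) < \<beta> * m"
    using M by (auto simp: growth_states_def not_le)
  define d where "d = \<beta> - M (b m) / m"
  have d: "0 < d" "M (b m) = (\<beta> - d) * m"
    using m by (auto simp: d_def field_simps)
  \<comment> \<open>At the common time \<open>n * m\<close> the component \<open>M\<close> loses
    \<open>t * d\<close>, which is twice \<eta>, while \<open>N\<close> gains at most
    \<open>(1 - t) * \<eta>\<close>; the mixture would then stay below \<beta>.\<close>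
  define \<eta> where "\<eta> = t * d / 2"
  have \<eta>: "0 < \<eta>" using d t by (simp add: \<eta>_def)
  obtain n where n: "1 \<le> n" "N (b n) < (\<beta> + \<eta>) * n"
    using max[OF \<eta> N] by blast
  have nm: "1 \<le> n * m" "0 < real (n * m)" using n m by auto
  have "M (b (n * m)) \<le> n * ((\<beta> - d) * m)"
    using invariant_state_b_mult[OF M m(1) n(1)] d(2) by simp
  then have 1: "M (b (n * m)) \<le> (\<beta> - d) * real (n * m)" by (simp add: algebra_simps)
  have "N (b (m * n)) \<le> m * N (b n)"
    by (rule invariant_state_b_mult[OF N n(1) m(1)])
  also have "\<dots> \<le> m * ((\<beta> + \<eta>) * n)"
    using n(2) by (intro mult_left_mono) auto
  finally have 2: "N (b (n * m)) \<le> (\<beta> + \<eta>) * real (n * m)" by (simp add: algebra_simps)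
  have "\<beta> * real (n * m) \<le> t * M (b (n * m)) + (1 - t) * N (b (n * m))"
    using \<Lambda> nm(1) unfolding growth_states_def conv[symmetric] by blast
  also have "\<dots> \<le> t * ((\<beta> - d) * real (n * m)) + (1 - t) * ((\<beta> + \<eta>) * real (n * m))"
    using t 1 2 by (intro add_mono mult_left_mono) auto
  also have "\<dots> = (\<beta> - \<eta> - t * \<eta>) * real (n * m)"
    by (simp add: \<eta>_def algebra_simps) (simp add: field_simps)
  also have "\<dots> < \<beta> * real (n * m)"
    using \<eta> t nm(2) by (intro mult_strict_right_mono) (auto simp: add_pos_pos algebra_simps)
  finally show False by simp
qed

section \<open>From invariant states to ergodic measures\<close>

definition expectation_on :: "'a measure \<Rightarrow> ('a \<Rightarrow> real) \<Rightarrow> real" where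
  "expectation_on \<nu> \<phi> = (if continuous_on K \<phi> then (LINT x:K|\<nu>. \<phi> x) else 0)"

lemma measurable_f: "prob_on \<nu> \<Longrightarrow> f \<in> measurable \<nu> borel"
  using borel_measurable_continuous_onI[OF continuous_f] measurable_cong_sets[OF prob_on_sets refl] by blast

lemma LINT_distr_f:
  fixes \<phi> :: "'a \<Rightarrow> real"
  assumes "prob_on \<nu>" "continuous_on K \<phi>"
  shows "(LINT x:K|distr \<nu> borel f. \<phi> x) = (LINT x:K|\<nu>. \<phi> (f x))"
proof -
  have "(LINT x:K|distr \<nu> borel f. \<phi> x) = (\<integral>x. indicat_real K (f x) *\<^sub>R \<phi> (f x) \<partial>\<nu>)"
    unfolding set_lebesgue_integral_def
    by (intro integral_distr measurable_f assms) (use borel_measurable_K[OF assms(2)] in simp)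
  also have "\<dots> = (LINT x:K|\<nu>. \<phi> (f x))"
    unfolding set_lebesgue_integral_def
  proof (rule integral_cong_AE)
    have "(\<lambda>x. indicator K x * \<phi> x) \<in> borel_measurable borel"
      by (rule borel_measurable_K[OF assms(2)])
    then show "(\<lambda>x. indicat_real K (f x) *\<^sub>R \<phi> (f x)) \<in> borel_measurable \<nu>"
      using measurable_compose[OF measurable_f[OF assms(1)]] by simp
    show "(\<lambda>x. indicat_real K x *\<^sub>R \<phi> (f x)) \<in> borel_measurable \<nu>"
      using set_integrable_K[OF assms(1) continuous_on_K_comp[OF assms(2)]]
      unfolding set_integrable_def by blast
    show "AE x in \<nu>. indicat_real K (f x) *\<^sub>R \<phi> (f x) = indicat_real K x *\<^sub>R \<phi> (f x)"
      using prob_on_AE[OF assms(1)] by eventually_elim (simp add: f_in_K)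
  qed
  finally show ?thesis .
qed

lemma expectation_invariant:
  assumes "prob_on \<nu>" "distr \<nu> borel f = \<nu>"
  shows "expectation_on \<nu> \<in> invariant_states"
proof -
  have "state (expectation_on \<nu>)"
    using integral_state[OF assms(1)] unfolding state_def expectation_on_def
    by (auto intro!: continuous_intros)
  moreover have "expectation_on \<nu> (\<lambda>x. \<phi> (f x)) = expectation_on \<nu> \<phi>" if "continuous_on K \<phi>" for \<phi>
    using LINT_distr_f[OF assms(1) that] continuous_on_K_comp[OF that] that assms(2)
    by (simp add: expectation_on_def)
  ultimately show ?thesis by (simp add: invariant_states_def expectation_on_def)
qed

lemma prob_on_distr:
  assumes "prob_on \<nu>"
  shows "prob_on (distr \<nu> borel f)"
proof -
  interpret finite_measure \<nu> by (rule prob_on_finite[OF assms])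
  have "emeasure \<nu> (f -` K) = 1"
  proof -
    have "AE x in \<nu>. x \<in> f -` K"
      using prob_on_AE[OF assms] by eventually_elim (simp add: f_in_K)
    moreover have "f -` K \<inter> space \<nu> \<in> sets \<nu>"
      using closed_K by (intro measurable_sets[OF measurable_f[OF assms]]) simp
    ultimately have "emeasure \<nu> (f -` K) = emeasure \<nu> UNIV"
      by (intro emeasure_eq_AE) (auto simp: prob_on_space[OF assms] prob_on_sets[OF assms])
    then show ?thesis using assms by (simp add: prob_on_def)
  qed
  then show ?thesis
    using assms closed_K measurable_f[OF assms]
    by (simp add: prob_on_def emeasure_distr prob_on_space[OF assms])
qed

text \<open>The Riesz measure and its image under \<open>f\<close> have the same integrals over the
  determining family, so invariance of the functional becomes invariance of the measure.\<close>

lemma invariant_state_measure: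
  assumes "\<Lambda> \<in> invariant_states"
  obtains \<nu> where "prob_on \<nu>" "distr \<nu> borel f = \<nu>" "expectation_on \<nu> = \<Lambda>"
proof -
  obtain \<nu> where \<nu>: "prob_on \<nu>" "\<And>\<phi>. continuous_on K \<phi> \<Longrightarrow> (LINT x:K|\<nu>. \<phi> x) = \<Lambda> \<phi>"
    using Riesz_representation assms unfolding invariant_states_def by blast
  obtain \<Phi> :: "nat \<Rightarrow> 'a \<Rightarrow> real" where \<Phi>: "\<And>n. continuous_on K (\<Phi> n)"
    "\<And>\<mu> \<nu>. prob_on \<mu> \<Longrightarrow> prob_on \<nu> \<Longrightarrow>
       (\<And>n. (LINT x:K|\<mu>. \<Phi> n x) = (LINT x:K|\<nu>. \<Phi> n x)) \<Longrightarrow> \<mu> = \<nu>"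
    by (rule determining_family) blast
  have "distr \<nu> borel f = \<nu>"
  proof (rule \<Phi>(2)[OF prob_on_distr[OF \<nu>(1)] \<nu>(1)])
    fix n
    show "(LINT x:K|distr \<nu> borel f. \<Phi> n x) = (LINT x:K|\<nu>. \<Phi> n x)"
      using LINT_distr_f[OF \<nu>(1) \<Phi>(1)] \<nu>(2) \<Phi>(1) continuous_on_K_comp[OF \<Phi>(1)] assms
      by (simp add: invariant_states_def)
  qed
  moreover have "expectation_on \<nu> = \<Lambda>"
    using \<nu>(2) assms by (auto simp: expectation_on_def invariant_states_def)
  ultimately show ?thesis using that \<nu>(1) by blast
qed

text \<open>Conditioning on a strictly invariant set; applied to a set and to its complement it
  splits a measure that is not ergodic.\<close>

lemma uniform_measure_invariant:
  assumes \<nu>: "prob_on \<nu>" "distr \<nu> borel f = \<nu>" and S: "S \<in> sets borel" "f -` S = S" "0 < measure \<nu> S"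
  shows "prob_on (uniform_measure \<nu> S)" "distr (uniform_measure \<nu> S) borel f = uniform_measure \<nu> S"
proof -
  interpret finite_measure \<nu> by (rule prob_on_finite[OF \<nu>(1)])
  note sets_\<nu> = prob_on_sets[OF \<nu>(1)]
  have S0: "emeasure \<nu> S \<noteq> 0" "emeasure \<nu> S \<noteq> \<infinity>" using S(3) by (auto simp: emeasure_eq_measure)
  have em: "emeasure (uniform_measure \<nu> S) X = emeasure \<nu> (S \<inter> X) / emeasure \<nu> S" if "X \<in> sets borel" for X
    using that S(1) by (simp add: emeasure_uniform_measure sets_\<nu>)
  have "emeasure \<nu> (S \<inter> K) = emeasure \<nu> S"
    using prob_on_AE[OF \<nu>(1)] S(1) closed_K by (intro emeasure_eq_AE) (auto simp: sets_\<nu>)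
  then show p: "prob_on (uniform_measure \<nu> S)"
    using em[of UNIV] em[of K] closed_K S0 sets_\<nu>
    by (auto simp: prob_on_def ennreal_divide_self less_top[symmetric])
  show "distr (uniform_measure \<nu> S) borel f = uniform_measure \<nu> S"
  proof (rule measure_eqI)
    fix X assume "X \<in> sets (distr (uniform_measure \<nu> S) borel f)"
    then have X: "X \<in> sets borel" by simp
    have "f -` X \<in> sets borel" "f -` (S \<inter> X) \<in> sets borel"
      using measurable_sets[OF borel_measurable_continuous_onI[OF continuous_f]] X S(1) by (auto simp flip: vimage_Int)
    have "emeasure (distr (uniform_measure \<nu> S) borel f) X = emeasure (uniform_measure \<nu> S) (f -` X)"
      using X measurable_f[OF p] by (simp add: emeasure_distr prob_on_space[OF \<nu>(1)])
    also have "\<dots> = emeasure \<nu> (f -` (S \<inter> X)) / emeasure \<nu> S"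
      using em[OF \<open>f -` X \<in> sets borel\<close>] S(2) by simp
    also have "emeasure \<nu> (f -` (S \<inter> X)) = emeasure (distr \<nu> borel f) (S \<inter> X)"
      using X S(1) measurable_f[OF \<nu>(1)] by (simp add: emeasure_distr prob_on_space[OF \<nu>(1)])
    also have "\<dots> / emeasure \<nu> S = emeasure (uniform_measure \<nu> S) X"
      using em[OF X] \<nu>(2) by simp
    finally show "emeasure (distr (uniform_measure \<nu> S) borel f) X = emeasure (uniform_measure \<nu> S) X" .
  qed (simp add: sets_\<nu>)
qed

lemma LINT_uniform_measure:
  fixes \<phi> :: "'a \<Rightarrow> real"
  assumes \<nu>: "prob_on \<nu>" and S: "S \<in> sets borel" "0 < measure \<nu> S" and \<phi>: "continuous_on K \<phi>"
  shows "measure \<nu> S * (LINT x:K|uniform_measure \<nu> S. \<phi> x) = (\<integral>x. indicator S x * (indicator K x * \<phi> x) \<partial>\<nu>)"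
proof -
  interpret finite_measure \<nu> by (rule prob_on_finite[OF \<nu>(1)])
  have m: "(\<lambda>x. indicator K x * \<phi> x) \<in> borel_measurable \<nu>"
    using borel_measurable_K[OF \<phi>] measurable_cong_sets[OF prob_on_sets[OF \<nu>] refl] by blast
  have u: "uniform_measure \<nu> S = density \<nu> (\<lambda>x. ennreal (indicator S x / measure \<nu> S))"
    unfolding uniform_measure_def using S(2)
    by (intro arg_cong2[where f = density] ext refl) (auto simp: emeasure_eq_measure divide_ennreal[symmetric] indicator_def)
  have "(LINT x:K|uniform_measure \<nu> S. \<phi> x) =
      (\<integral>x. (indicator S x / measure \<nu> S) *\<^sub>R (indicator K x * \<phi> x) \<partial>\<nu>)"
    unfolding set_lebesgue_integral_def u real_scaleR_def
    using S prob_on_sets[OF \<nu>] by (subst integral_density[OF m]) auto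
  also have "\<dots> = (\<integral>x. indicator S x * (indicator K x * \<phi> x) \<partial>\<nu>) / measure \<nu> S"
    by simp
  finally show ?thesis using S(2) by simp
qed

text \<open>If an invariant set \<open>S\<close> had measure \<open>t\<close> strictly between 0 and
  1, the two conditional measures would both have maximal growth by the face property. Since
  \<open>G\<close> is maximal at their mixture, strict convexity makes them agree on the determining
  family, hence coincide, although they give \<open>S\<close> mass 1 and 0.\<close>

lemma exists_ergodic:
  assumes "growth_states 0 \<noteq> {}"
  obtains \<nu> where "prob_on \<nu>" "distr \<nu> borel f = \<nu>"
    "\<And>S. S \<in> sets borel \<Longrightarrow> f -` S = S \<Longrightarrow> measure \<nu> S = 0 \<or> measure \<nu> S = 1"
    "\<And>m. 1 \<le> m \<Longrightarrow> 0 \<le> (LINT x:K|\<nu>. b m x)"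
proof -
  obtain \<beta> where \<beta>: "0 \<le> \<beta>" "growth_states \<beta> \<noteq> {}"
    "\<And>\<eta> \<Lambda>. 0 < \<eta> \<Longrightarrow> \<Lambda> \<in> invariant_states \<Longrightarrow> \<exists>m\<ge>1. \<Lambda> (b m) < (\<beta> + \<eta>) * m"
    using maximal_growth[OF assms] by metis
  obtain \<Phi> :: "nat \<Rightarrow> 'a \<Rightarrow> real" where \<Phi>: "\<And>n. continuous_on K (\<Phi> n)"
    "\<And>n x. x \<in> K \<Longrightarrow> 0 \<le> \<Phi> n x \<and> \<Phi> n x \<le> 1"
    "\<And>\<mu> \<nu>. prob_on \<mu> \<Longrightarrow> prob_on \<nu> \<Longrightarrow>
       (\<And>n. (LINT x:K|\<mu>. \<Phi> n x) = (LINT x:K|\<nu>. \<Phi> n x)) \<Longrightarrow> \<mu> = \<nu>"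
    using determining_family by blast
  \<comment> \<open>a continuous strictly convex functional: its maximisers are extreme points\<close>
  define G where "G \<Lambda> = (\<Sum>n. (1/2)^Suc n * (\<Lambda> (\<Phi> n))\<^sup>2)" for \<Lambda> :: "('a \<Rightarrow> real) \<Rightarrow> real"
  have \<Phi>01: "0 \<le> \<Lambda> (\<Phi> n) \<and> \<Lambda> (\<Phi> n) \<le> 1" if "state \<Lambda>" for \<Lambda> n
  proof
    show "0 \<le> \<Lambda> (\<Phi> n)" using \<Phi> by (intro state_nonneg[OF that]) auto
    have "\<Lambda> (\<Phi> n) \<le> \<Lambda> (\<lambda>_. 1)" using \<Phi> by (intro state_mono[OF that]) auto
    then show "\<Lambda> (\<Phi> n) \<le> 1" by (simp add: state_one[OF that])
  qed
  have nb: "norm ((1/2)^Suc n * (\<Lambda> (\<Phi> n))\<^sup>2) \<le> (1/2::real)^Suc n" if "state \<Lambda>" for \<Lambda> n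
    using \<Phi>01[OF that, of n] by (simp add: abs_mult power_le_one mult_left_le)
  have sm: "summable (\<lambda>n. (1/2)^Suc n * (\<Lambda> (\<Phi> n))\<^sup>2)" if "state \<Lambda>" for \<Lambda>
    by (rule summable_comparison_test'[OF power_half_series[THEN sums_summable]]) (rule nb[OF that])
  have stg: "state \<Lambda>" if "\<Lambda> \<in> growth_states \<beta>" for \<Lambda>
    using that by (simp add: growth_states_def invariant_states_def)
  have ul: "uniform_limit (growth_states \<beta>) (\<lambda>n \<Lambda>. \<Sum>i<n. (1/2)^Suc i * (\<Lambda> (\<Phi> i))\<^sup>2) G sequentially"
    unfolding G_def by (rule Weierstrass_m_test[OF nb[OF stg] power_half_series[THEN sums_summable]])
  have "continuous_on (growth_states \<beta>) (\<lambda>\<Lambda>. \<Sum>i<n. (1/2)^Suc i * (\<Lambda> (\<Phi> i))\<^sup>2)" for n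
    by (intro continuous_intros continuous_on_subset[OF continuous_on_product_coordinates] subset_UNIV)
  then have "continuous_on (growth_states \<beta>) G"
    by (intro uniform_limit_theorem[OF always_eventually[OF allI] ul]) auto
  then obtain \<Lambda> where \<Lambda>: "\<Lambda> \<in> growth_states \<beta>" "\<And>M. M \<in> growth_states \<beta> \<Longrightarrow> G M \<le> G \<Lambda>"
    using continuous_attains_sup[OF compact_growth_states \<beta>(2)] by blast
  then have \<Lambda>i: "\<Lambda> \<in> invariant_states" by (simp add: growth_states_def)
  obtain \<nu> where \<nu>: "prob_on \<nu>" "distr \<nu> borel f = \<nu>" "expectation_on \<nu> = \<Lambda>"
    using invariant_state_measure[OF \<Lambda>i] by blast
  interpret finite_measure \<nu> by (rule prob_on_finite[OF \<nu>(1)])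
  show ?thesis
  proof (rule that[OF \<nu>(1,2)])
    fix m :: nat assume m: "1 \<le> m"
    then have "\<beta> * m \<le> \<Lambda> (b m)" using \<Lambda>(1) by (simp add: growth_states_def)
    moreover have "0 \<le> \<beta> * m" using \<beta>(1) by simp
    ultimately show "0 \<le> (LINT x:K|\<nu>. b m x)"
      using \<nu>(3) continuous_b by (auto simp: expectation_on_def)
  next
    fix S :: "'a set" assume S: "S \<in> sets borel" "f -` S = S"
    have mc: "measure \<nu> (- S) = 1 - measure \<nu> S"
      using finite_measure_compl[of S] S(1) prob_on_sets[OF \<nu>(1)] prob_on_UNIV[OF \<nu>(1)] prob_on_space[OF \<nu>(1)]
      by (simp add: Compl_eq_Diff_UNIV)
    show "measure \<nu> S = 0 \<or> measure \<nu> S = 1"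
    proof (rule ccontr)
      assume neg: "\<not> ?thesis"
      define t where "t = measure \<nu> S"
      have t: "0 < t" "t < 1" "measure \<nu> (- S) = 1 - t"
        using neg mc measure_nonneg[of \<nu> S] measure_nonneg[of \<nu> "- S"] by (auto simp: t_def simp del: measure_nonneg)
      have S': "- S \<in> sets borel" "f -` (- S) = - S" using S by auto
      define \<mu> where "\<mu> = uniform_measure \<nu> S"
      define \<kappa> where "\<kappa> = uniform_measure \<nu> (- S)"
      have \<mu>: "prob_on \<mu>" "distr \<mu> borel f = \<mu>" and \<kappa>: "prob_on \<kappa>" "distr \<kappa> borel f = \<kappa>"
        using uniform_measure_invariant[OF \<nu>(1,2) S] uniform_measure_invariant[OF \<nu>(1,2) S'] t
        by (auto simp: \<mu>_def \<kappa>_def t_def)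
      have conv: "\<Lambda> \<phi> = t * expectation_on \<mu> \<phi> + (1 - t) * expectation_on \<kappa> \<phi>" for \<phi>
      proof (cases "continuous_on K \<phi>")
        case True
        define h where "h x = indicator K x * \<phi> x" for x
        have int: "integrable \<nu> h"
          using set_integrable_K[OF \<nu>(1) True] by (simp add: set_integrable_def h_def[abs_def])
        have "S \<in> sets \<nu>" "- S \<in> sets \<nu>" using S(1) S'(1) prob_on_sets[OF \<nu>(1)] by auto
        then have "(\<integral>x. indicator S x * h x \<partial>\<nu>) + (\<integral>x. indicator (- S) x * h x \<partial>\<nu>) =
            (\<integral>x. indicator S x * h x + indicator (- S) x * h x \<partial>\<nu>)"
          using integrable_mult_indicator[OF _ int, of S] integrable_mult_indicator[OF _ int, of "- S"]
          by (intro Bochner_Integration.integral_add[symmetric]) auto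
        also have "(\<lambda>x. indicator S x * h x + indicator (- S) x * h x) = h"
          by (auto simp: indicator_def)
        also have "(\<integral>x. h x \<partial>\<nu>) = (LINT x:K|\<nu>. \<phi> x)"
          by (simp add: set_lebesgue_integral_def h_def)
        finally show ?thesis
          using LINT_uniform_measure[OF \<nu>(1) S(1) _ True] LINT_uniform_measure[OF \<nu>(1) S'(1) _ True] t True
          unfolding \<nu>(3)[symmetric] expectation_on_def \<mu>_def \<kappa>_def h_def by (simp add: t_def)
      qed (use \<Lambda>i in \<open>auto simp: expectation_on_def invariant_states_def\<close>)
      have \<mu>i: "expectation_on \<mu> \<in> invariant_states" and \<kappa>i: "expectation_on \<kappa> \<in> invariant_states"
        using expectation_invariant \<mu> \<kappa> by auto
      have \<mu>g: "expectation_on \<mu> \<in> growth_states \<beta>"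
        using t by (intro maximal_growth_face[OF \<beta>(3) \<Lambda>(1) \<mu>i \<kappa>i _ _ conv]) auto
      have \<kappa>g: "expectation_on \<kappa> \<in> growth_states \<beta>"
        using t conv by (intro maximal_growth_face[OF \<beta>(3) \<Lambda>(1) \<kappa>i \<mu>i, of "1 - t"]) auto
      define D where "D n = (1/2)^Suc n * (expectation_on \<mu> (\<Phi> n) - expectation_on \<kappa> (\<Phi> n))\<^sup>2" for n
      \<comment> \<open>The convexity gap of the square: \<open>t * x\<^sup>2 + (1 - t) * y\<^sup>2
        - (t * x + (1 - t) * y)\<^sup>2 = t * (1 - t) * (x - y)\<^sup>2\<close>.\<close>
      have id: "(\<lambda>n. t * ((1/2)^Suc n * (expectation_on \<mu> (\<Phi> n))\<^sup>2) +
          (1 - t) * ((1/2)^Suc n * (expectation_on \<kappa> (\<Phi> n))\<^sup>2) - (1/2)^Suc n * (\<Lambda> (\<Phi> n))\<^sup>2) =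
          (\<lambda>n. t * (1 - t) * D n)"
      proof -
        have "t * (w * x\<^sup>2) + (1 - t) * (w * y\<^sup>2) - w * (t * x + (1 - t) * y)\<^sup>2 = t * (1 - t) * (w * (x - y)\<^sup>2)"
          for w x y :: real
          by (simp add: power2_eq_square algebra_simps)
        then show ?thesis unfolding conv D_def by (intro ext)
      qed
      have tt: "0 < t * (1 - t)" using t by simp
      have "(\<lambda>n. t * ((1/2)^Suc n * (expectation_on \<mu> (\<Phi> n))\<^sup>2) +
          (1 - t) * ((1/2)^Suc n * (expectation_on \<kappa> (\<Phi> n))\<^sup>2) - (1/2)^Suc n * (\<Lambda> (\<Phi> n))\<^sup>2)
          sums (t * G (expectation_on \<mu>) + (1 - t) * G (expectation_on \<kappa>) - G \<Lambda>)"
        unfolding G_def by (intro sums_diff sums_add sums_mult summable_sums sm stg \<mu>g \<kappa>g \<Lambda>(1))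
      then have "(\<lambda>n. t * (1 - t) * D n) sums (t * G (expectation_on \<mu>) + (1 - t) * G (expectation_on \<kappa>) - G \<Lambda>)"
        unfolding id .
      moreover have "t * G (expectation_on \<mu>) + (1 - t) * G (expectation_on \<kappa>) \<le> t * G \<Lambda> + (1 - t) * G \<Lambda>"
        using t \<Lambda>(2) \<mu>g \<kappa>g by (intro add_mono mult_left_mono) auto
      moreover have "t * G \<Lambda> + (1 - t) * G \<Lambda> = G \<Lambda>" by (simp add: algebra_simps)
      ultimately obtain s where s: "(\<lambda>n. t * (1 - t) * D n) sums s" "s \<le> 0"
        by (metis diff_le_0_iff_le)
      have D0: "0 \<le> t * (1 - t) * D n" for n using tt by (simp add: D_def)
      have "D n = 0" for n
      proof (rule ccontr)
        assume "D n \<noteq> 0"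
        moreover have "0 \<le> D n" by (simp add: D_def)
        ultimately have "0 < t * (1 - t) * D n" using t(1,2) by (intro mult_pos_pos) auto
        then have "0 < (\<Sum>n. t * (1 - t) * D n)"
          by (intro suminf_pos2[OF sums_summable[OF s(1)] D0])
        then show False using s by (simp add: sums_iff)
      qed
      then have eq: "expectation_on \<mu> (\<Phi> n) = expectation_on \<kappa> (\<Phi> n)" for n
        by (simp add: D_def)
      have "\<mu> = \<kappa>"
        using eq \<Phi>(1) by (intro \<Phi>(3)[OF \<mu>(1) \<kappa>(1)]) (simp add: expectation_on_def)
      moreover have "emeasure \<mu> S = 1" "emeasure \<kappa> S = 0"
      proof -
        have "emeasure \<nu> S \<noteq> 0" "emeasure \<nu> S \<noteq> top" using t by (auto simp: emeasure_eq_measure t_def)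
        then show "emeasure \<mu> S = 1"
          using S(1) prob_on_sets[OF \<nu>(1)] by (simp add: \<mu>_def emeasure_uniform_measure ennreal_divide_self less_top[symmetric])
        show "emeasure \<kappa> S = 0"
          using S(1) S'(1) prob_on_sets[OF \<nu>(1)] by (simp add: \<kappa>_def emeasure_uniform_measure)
      qed
      ultimately show False by simp
    qed
  qed
qed


section \<open>Maximal inequality and slow decay almost everywhere\<close>

lemma measure_funpow_vimage:
  assumes "prob_on \<nu>" "distr \<nu> borel f = \<nu>" "S \<in> sets borel"
  shows "(f ^^ n) -` S \<in> sets borel" "measure \<nu> ((f ^^ n) -` S) = measure \<nu> S"
proof (induction n)
  case (Suc n)
  have eq: "(f ^^ Suc n) -` S = f -` ((f ^^ n) -` S)"
    by (simp add: vimage_comp funpow_Suc_right del: funpow.simps)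
  {
    case 1
    show ?case
      unfolding eq
      using measurable_sets[OF borel_measurable_continuous_onI[OF continuous_f] Suc.IH(1)] by simp
  next
    case 2
    have "measure (distr \<nu> borel f) ((f ^^ n) -` S) = measure \<nu> (f -` ((f ^^ n) -` S))"
      using Suc.IH(1) measurable_f[OF assms(1)] by (simp add: measure_distr prob_on_space[OF assms(1)])
    then show ?case
      unfolding eq using assms(2) Suc.IH(2) by simp
  }
qed (use assms in auto)

text \<open>A maximal inequality. Were the set null, the points without a drop up to time
  \<open>N\<close> would have measure tending to 0. They are the bad points of
  \<open>b_orbit_bound\<close>, whose integral would then give a negative integral of
  \<open>b T\<close> for large \<open>T\<close>.\<close>

lemma positive_measure_slow_decay:
  assumes \<nu>: "prob_on \<nu>" "distr \<nu> borel f = \<nu>" and b: "\<And>m. 1 \<le> m \<Longrightarrow> 0 \<le> (LINT x:K|\<nu>. b m x)"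
    and \<epsilon>: "0 < \<epsilon>"
  shows "{p \<in> K. \<forall>n\<ge>1. - \<epsilon> * n < b n p} \<in> sets borel"
    "0 < measure \<nu> {p \<in> K. \<forall>n\<ge>1. - \<epsilon> * n < b n p}"
proof -
  interpret finite_measure \<nu> by (rule prob_on_finite[OF \<nu>(1)])
  note sets_\<nu> = prob_on_sets[OF \<nu>(1)]
  define E where "E N = {p \<in> K. \<forall>n\<in>{1..N}. - \<epsilon> * n < b n p}" for N :: nat
  have one: "{p \<in> K. - \<epsilon> * n < b n p} \<in> sets borel" for n :: nat
  proof -
    have "closed {p \<in> K. b n p \<le> - \<epsilon> * n}"
      using continuous_closed_preimage[OF continuous_b closed_K, of "{..- \<epsilon> * n}"]
      by (simp add: vimage_def Int_def)
    then have "K - {p \<in> K. b n p \<le> - \<epsilon> * n} \<in> sets borel"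
      using closed_K by (intro sets.Diff) auto
    moreover have "K - {p \<in> K. b n p \<le> - \<epsilon> * n} = {p \<in> K. - \<epsilon> * n < b n p}" by auto
    ultimately show ?thesis by simp
  qed
  have E: "E N \<in> sets borel" for N
  proof -
    \<comment> \<open>The harmless index 0 keeps the finite intersection nonempty also for
      \<open>N = 0\<close>.\<close>
    have "E N = K \<inter> (\<Inter>n\<in>{..N}. if n = 0 then K else {p \<in> K. - \<epsilon> * n < b n p})"
      by (auto simp: E_def split: if_splits)
    also have "\<dots> \<in> sets borel"
      using one closed_K by (intro sets.Int sets.finite_INT) auto
    finally show ?thesis .
  qed
  have E_Inter: "(\<Inter>N. E N) = {p \<in> K. \<forall>n\<ge>1. - \<epsilon> * n < b n p}"
    by (auto simp: E_def) (metis One_nat_def atLeastAtMost_iff order_refl)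
  have "(\<Inter>N. E N) \<in> sets borel" using E by (intro sets.countable_INT') auto
  then show "{p \<in> K. \<forall>n\<ge>1. - \<epsilon> * n < b n p} \<in> sets borel" unfolding E_Inter .
  show "0 < measure \<nu> {p \<in> K. \<forall>n\<ge>1. - \<epsilon> * n < b n p}"
  proof (rule ccontr)
    assume "\<not> ?thesis"
    then have "measure \<nu> (\<Inter>N. E N) = 0"
      unfolding E_Inter by (simp add: zero_less_measure_iff)
    moreover have "(\<lambda>N. measure \<nu> (E N)) \<longlonglongrightarrow> measure \<nu> (\<Inter>N. E N)"
    proof (rule finite_Lim_measure_decseq)
      show "range E \<subseteq> sets \<nu>" using E sets_\<nu> by auto
      show "decseq E" by (intro decseq_SucI) (auto simp: E_def)
    qed
    ultimately have lim: "(\<lambda>N. measure \<nu> (E N)) \<longlonglongrightarrow> 0" by simp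
    obtain C where C: "0 < C" "\<And>x. x \<in> K \<Longrightarrow> \<bar>b 1 x\<bar> \<le> C"
      using continuous_on_bound[OF continuous_b] by metis
    \<comment> \<open>A bad time costs \<open>C + \<epsilon>\<close>; below this frequency of bad
      times an average decay of \<epsilon>/2 per step remains.\<close>
    have "0 < \<epsilon> / (2 * (C + \<epsilon>))" using C \<epsilon> by simp
    from order_tendstoD(2)[OF lim this]
    obtain N where "measure \<nu> (E N) < \<epsilon> / (2 * (C + \<epsilon>))"
      by (auto simp: eventually_sequentially)
    then have N: "(C + \<epsilon>) * measure \<nu> (E N) \<le> \<epsilon> / 2"
      using C \<epsilon> by (simp add: field_simps)
    obtain T :: nat where T: "2 * (N * (C + \<epsilon>)) / \<epsilon> + 1 < T" using reals_Archimedean2 by blast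
    have "0 \<le> 2 * (N * (C + \<epsilon>)) / \<epsilon>" using C \<epsilon> by simp
    with T have T1: "1 \<le> T" by linarith
    define bad where "bad p = (if \<exists>n\<in>{1..N}. b n p \<le> - \<epsilon> * n then 0 else 1 :: real)" for p
    have bad: "bad p = indicator (E N) p" if "p \<in> K" for p
    proof -
      have "p \<in> E N \<longleftrightarrow> \<not> (\<exists>n\<in>{1..N}. b n p \<le> - \<epsilon> * n)"
        using that unfolding E_def by (simp add: not_le)
      then show ?thesis by (simp add: bad_def indicator_def)
    qed
    define h where "h x = - \<epsilon> * T + (C + \<epsilon>) * (\<Sum>i<T. indicator ((f ^^ i) -` E N) x) + N * (C + \<epsilon>)" for x
    have pre: "(f ^^ i) -` E N \<in> sets \<nu>" "measure \<nu> ((f ^^ i) -` E N) = measure \<nu> (E N)" for i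
      using measure_funpow_vimage[OF \<nu> E[of N], of i] by (auto simp: sets_\<nu>)
    have ind: "integrable \<nu> (indicat_real ((f ^^ i) -` E N))" for i
      using pre by (intro integrable_real_indicator) (auto simp: less_top[symmetric])
    have "(LINT x:K|\<nu>. b T x) \<le> (\<integral>x. h x \<partial>\<nu>)"
      unfolding set_lebesgue_integral_def
    proof (rule integral_mono_AE)
      show "integrable \<nu> (\<lambda>x. indicat_real K x *\<^sub>R b T x)"
        using set_integrable_K[OF \<nu>(1) continuous_b] by (simp add: set_integrable_def)
      show "integrable \<nu> h"
        unfolding h_def using ind by auto
      show "AE x in \<nu>. indicat_real K x *\<^sub>R b T x \<le> h x"
        using prob_on_AE[OF \<nu>(1)]
      proof eventually_elim
        case (elim p)
        have "b T p \<le> - \<epsilon> * T + (C + \<epsilon>) * (\<Sum>i<T. bad ((f ^^ i) p)) + N * (C + \<epsilon>)"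
          unfolding bad_def using C \<epsilon> elim T1 by (intro b_orbit_bound) (auto simp: abs_le_iff)
        also have "(\<Sum>i<T. bad ((f ^^ i) p)) = (\<Sum>i<T. indicator ((f ^^ i) -` E N) p)"
          using funpow_in_K[OF elim] bad by (intro sum.cong) (auto simp: indicator_def)
        finally show ?case using elim by (simp add: h_def)
      qed
    qed
    also have "(\<integral>x. h x \<partial>\<nu>) = - \<epsilon> * T + (C + \<epsilon>) * (\<Sum>i<T. measure \<nu> (E N)) + N * (C + \<epsilon>)"
    proof -
      have "(\<integral>x. h x \<partial>\<nu>) = - \<epsilon> * T + (C + \<epsilon>) * (\<integral>x. (\<Sum>i<T. indicator ((f ^^ i) -` E N) x) \<partial>\<nu>) + N * (C + \<epsilon>)"
        unfolding h_def using ind prob_on_UNIV[OF \<nu>(1)] prob_on_space[OF \<nu>(1)] by simp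
      also have "(\<integral>x. (\<Sum>i<T. indicat_real ((f ^^ i) -` E N) x) \<partial>\<nu>) = (\<Sum>i<T. measure \<nu> (E N))"
        using ind pre prob_on_space[OF \<nu>(1)] by (subst Bochner_Integration.integral_sum) auto
      finally show ?thesis .
    qed
    also have "\<dots> = - \<epsilon> * T + T * ((C + \<epsilon>) * measure \<nu> (E N)) + N * (C + \<epsilon>)"
      by simp
    also have "\<dots> \<le> - \<epsilon> * T + T * (\<epsilon> / 2) + N * (C + \<epsilon>)"
      using mult_left_mono[OF N, of "real T"] by linarith
    finally have "T * (\<epsilon> / 2) \<le> N * (C + \<epsilon>)"
      using b[OF T1] by (simp add: mult.commute)
    then have "T \<le> 2 * (N * (C + \<epsilon>)) / \<epsilon>"
      using \<epsilon> by (simp add: field_simps)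
    with T show False by linarith
  qed
qed

text \<open>For each rate \<open>c\<close> the points with slow decay along infinitely many times
  form a forward invariant set of positive measure. Ergodicity concerns strictly invariant sets, so
  the set is first enlarged to the union of its preimages, which has the same measure.\<close>

theorem ergodic_measure_nonneg_growth:
  assumes "\<And>n. 1 \<le> n \<Longrightarrow> \<exists>p\<in>K. 0 \<le> b n p"
  shows "\<exists>\<nu>. sets \<nu> = sets borel \<and> emeasure \<nu> UNIV = 1 \<and> emeasure \<nu> K = 1 \<and> distr \<nu> borel f = \<nu> \<and>
    (\<forall>S\<in>sets borel. f -` S = S \<longrightarrow> emeasure \<nu> S = 0 \<or> emeasure \<nu> S = 1) \<and>
    (\<forall>c>0. AE p in \<nu>. p \<in> K \<and> (\<exists>D. \<exists>\<^sub>\<infinity>n. - c * n - D \<le> b n p))"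
proof -
  obtain p where p: "p \<in> K" "\<And>n. 1 \<le> n \<Longrightarrow> 0 \<le> b n p"
    using nonneg_point[OF assms] by blast
  obtain \<nu> where \<nu>: "prob_on \<nu>" "distr \<nu> borel f = \<nu>"
    "\<And>S. S \<in> sets borel \<Longrightarrow> f -` S = S \<Longrightarrow> measure \<nu> S = 0 \<or> measure \<nu> S = 1"
    "\<And>m. 1 \<le> m \<Longrightarrow> 0 \<le> (LINT x:K|\<nu>. b m x)"
    using exists_ergodic[OF growth_states_0[OF p]] by blast
  interpret finite_measure \<nu> by (rule prob_on_finite[OF \<nu>(1)])
  note sets_\<nu> = prob_on_sets[OF \<nu>(1)]
  have slow: "AE p in \<nu>. p \<in> K \<and> (\<exists>D. \<exists>\<^sub>\<infinity>n. - c * n - D \<le> b n p)" if c: "0 < c" for c :: real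
  proof -
    \<comment> \<open>The constant \<open>D\<close> gives forward invariance, as one step of the
      orbit costs at most \<open>C + c\<close>; natural numbers \<open>D\<close> keep the union
      countable and \<open>L\<close> measurable.\<close>
    define L where "L = {p \<in> K. \<exists>D::nat. \<exists>\<^sub>\<infinity>n. - c * n - D \<le> b n p}"
    have one: "{p \<in> K. - c * n - D \<le> b n p} \<in> sets borel" for n D :: nat
    proof -
      have "closed {p \<in> K. - c * n - D \<le> b n p}"
        using continuous_closed_preimage[OF continuous_b closed_K, of "{- c * n - D..}"]
        by (simp add: vimage_def Int_def)
      then show ?thesis by simp
    qed
    have "L = (\<Union>D::nat. \<Inter>m. \<Union>n\<in>{m..}. {p \<in> K. - c * n - D \<le> b n p})"
      unfolding L_def by (auto simp: INFM_nat_le Bex_def) blast+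
    also have "\<dots> \<in> sets borel"
      using one by (intro sets.countable_UN' sets.countable_INT') auto
    finally have L: "L \<in> sets borel" .
    obtain C where C: "0 < C" "\<And>x. x \<in> K \<Longrightarrow> \<bar>b 1 x\<bar> \<le> C"
      using continuous_on_bound[OF continuous_b] by metis
    have forward: "f p \<in> L" if pL: "p \<in> L" for p
    proof -
      obtain D :: nat where D: "p \<in> K" "\<exists>\<^sub>\<infinity>n. - c * n - D \<le> b n p"
        using pL by (auto simp: L_def)
      obtain D' :: nat where D': "C + c + D \<le> D'" using real_arch_simple by blast
      have "\<exists>\<^sub>\<infinity>n. - c * n - D' \<le> b n (f p)"
        unfolding INFM_nat_le
      proof
        fix m
        obtain n where n: "Suc (Suc m) \<le> n" "- c * n - D \<le> b n p"
          using D(2) unfolding INFM_nat_le by blast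
        then obtain k where k: "n = Suc k" "1 \<le> k" "m \<le> k" by (cases n) auto
        have "b n p \<le> b 1 p + b k (f p)"
          using subadditive[of 1 k p] k D(1) by simp
        moreover have "b 1 p \<le> C" using C(2)[OF D(1)] by (simp add: abs_le_iff)
        ultimately have "- c * k - D' \<le> b k (f p)"
          using n(2) D' unfolding k(1) by (simp add: algebra_simps)
        then show "\<exists>n\<ge>m. - c * n - D' \<le> b n (f p)" using k(3) by blast
      qed
      then show ?thesis using D(1) f_in_K by (auto simp: L_def)
    qed
    define E where "E = {p \<in> K. \<forall>n\<ge>1. - c * n < b n p}"
    have E: "E \<in> sets borel" "0 < measure \<nu> E"
      unfolding E_def by (rule positive_measure_slow_decay[OF \<nu>(1,2,4) c], assumption)+
    have "E \<subseteq> L"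
    proof
      fix p assume p: "p \<in> E"
      have "\<exists>\<^sub>\<infinity>n. - c * n - 0 \<le> b n p"
        unfolding INFM_nat_le
      proof
        fix m
        have "- c * Suc m < b (Suc m) p"
          using p unfolding E_def by (metis (mono_tags, lifting) le_add1 mem_Collect_eq plus_1_eq_Suc)
        then show "\<exists>n\<ge>m. - c * n - 0 \<le> b n p"
          by (intro exI[of _ "Suc m"]) simp
      qed
      then have "\<exists>D::nat. \<exists>\<^sub>\<infinity>n. - c * n - D \<le> b n p" by (intro exI[of _ 0]) simp
      then show "p \<in> L" using p by (simp add: L_def E_def)
    qed
    then have "measure \<nu> E \<le> measure \<nu> L"
      using L sets_\<nu> by (intro finite_measure_mono) auto
    then have L0: "0 < measure \<nu> L" using E by simp
    have pre: "(f ^^ n) -` L \<in> sets \<nu>" "measure \<nu> ((f ^^ n) -` L) = measure \<nu> L" for n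
      using measure_funpow_vimage[OF \<nu>(1,2) L, of n] by (auto simp: sets_\<nu>)
    have inc: "incseq (\<lambda>n. (f ^^ n) -` L)"
      by (intro incseq_SucI) (auto intro: forward)
    \<comment> \<open>The preimages increase and all have the measure of \<open>L\<close>, so their
      union has it too.\<close>
    define U where "U = (\<Union>n. (f ^^ n) -` L)"
    have U: "U \<in> sets borel" unfolding U_def using pre(1) sets_\<nu> by (intro sets.countable_UN') auto
    have "(\<lambda>n. measure \<nu> ((f ^^ n) -` L)) \<longlonglongrightarrow> measure \<nu> U"
      unfolding U_def using pre(1) inc by (intro finite_Lim_measure_incseq) auto
    then have "measure \<nu> U = measure \<nu> L"
      using pre(2) by (simp add: LIMSEQ_const_iff)
    moreover have "f -` U = U"
    proof
      show "f -` U \<subseteq> U"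
      proof
        fix x assume "x \<in> f -` U"
        then obtain n where "(f ^^ n) (f x) \<in> L" by (auto simp: U_def)
        then have "(f ^^ Suc n) x \<in> L" by (simp add: funpow_swap1)
        then show "x \<in> U" unfolding U_def by blast
      qed
      show "U \<subseteq> f -` U"
      proof
        fix x assume "x \<in> U"
        then obtain n where "(f ^^ n) x \<in> L" by (auto simp: U_def)
        then have "(f ^^ n) (f x) \<in> L" using forward by (metis comp_apply funpow.simps(2) funpow_swap1)
        then show "x \<in> f -` U" by (auto simp: U_def)
      qed
    qed
    ultimately have "measure \<nu> L = 1" using \<nu>(3)[OF U] L0 by auto
    then have "measure \<nu> (space \<nu> - L) = 0"
      using finite_measure_compl[of L] L prob_on_UNIV[OF \<nu>(1)] prob_on_space[OF \<nu>(1)] sets_\<nu> by simp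
    then have "AE p in \<nu>. p \<in> L"
      using L sets_\<nu> by (intro AE_I[of _ _ "space \<nu> - L"]) (auto simp: emeasure_eq_measure)
    then show ?thesis by eventually_elim (auto simp: L_def)
  qed
  show ?thesis
  proof (intro exI[of _ \<nu>] conjI ballI impI allI)
    fix S :: "'a set" assume "S \<in> sets borel" "f -` S = S"
    then show "emeasure \<nu> S = 0 \<or> emeasure \<nu> S = 1"
      using \<nu>(3)[of S] by (auto simp: emeasure_eq_measure)
  qed (use \<nu> slow in \<open>auto simp: prob_on_def\<close>)
qed

end

section \<open>Fibred attractors over a minimal base\<close>

text \<open>\<open>V\<close> is a neighbourhood of the fibrewise diagonal over \<open>K\<close>, and
  \<open>attracting\<close> is uniform contraction of nearby pairs in the language of
  neighbourhoods, which needs no metric on the fibres.\<close>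

locale fibred_attractor =
  fixes \<omega> \<omega>' :: "'t::t2_space \<Rightarrow> 't" and f :: "'t \<times> 'x \<Rightarrow> 't \<times> 'x::t2_space"
    and K :: "('t \<times> 'x) set" and V :: "('t \<times> 'x \<times> 'x) set"
  assumes compact_base: "compact (UNIV :: 't set)"
    and homeo: "homeomorphism UNIV UNIV \<omega> \<omega>'"
    and minimal: "\<And>S. closed S \<Longrightarrow> \<omega> ` S = S \<Longrightarrow> S = {} \<or> S = UNIV"
    and K: "K \<noteq> {}" "compact K" "f ` K = K"
    and fst_f: "\<And>p. fst (f p) = \<omega> (fst p)"
    and V_open: "open V" and V_diag: "\<And>\<theta> x. (\<theta>, x) \<in> K \<Longrightarrow> (\<theta>, x, x) \<in> V"
    and attracting: "\<And>W. open W \<Longrightarrow> (\<And>\<theta> x. (\<theta>, x) \<in> K \<Longrightarrow> (\<theta>, x, x) \<in> W) \<Longrightarrow>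
      \<exists>I. \<forall>i\<ge>I. \<forall>\<theta> x y. (\<theta>, x) \<in> K \<longrightarrow> (\<theta>, y) \<in> K \<longrightarrow> (\<theta>, x, y) \<in> V \<longrightarrow>
        ((\<omega> ^^ i) \<theta>, snd ((f ^^ i) (\<theta>, x)), snd ((f ^^ i) (\<theta>, y))) \<in> W"
begin

definition fibre :: "'t \<Rightarrow> 'x set" where
  "fibre \<theta> = {x. (\<theta>, x) \<in> K}"

text \<open>Both orders of a pair are tested, as \<open>V\<close> is not assumed to be
  symmetric.\<close>

definition separated :: "'t \<Rightarrow> 'x set \<Rightarrow> bool" where
  "separated \<theta> S \<longleftrightarrow> (\<forall>x\<in>S. \<forall>y\<in>S. x \<noteq> y \<longrightarrow> (\<theta>, x, y) \<notin> V)"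

lemma \<omega>_inverse: "\<omega>' (\<omega> \<theta>) = \<theta>" "\<omega> (\<omega>' \<theta>) = \<theta>"
  and continuous_\<omega>: "continuous_on UNIV \<omega>" "continuous_on UNIV \<omega>'"
  using homeo by (auto simp: homeomorphism_def)

lemma fst_funpow: "fst ((f ^^ n) p) = (\<omega> ^^ n) (fst p)"
  by (induction n) (auto simp: fst_f)

lemma funpow_inverse: "(\<omega> ^^ n) ((\<omega>' ^^ n) \<theta>) = \<theta>" "(\<omega>' ^^ n) ((\<omega> ^^ n) \<theta>) = \<theta>"
proof -
  show "(\<omega> ^^ n) ((\<omega>' ^^ n) \<theta>) = \<theta>"
    by (induction n arbitrary: \<theta>) (auto simp: funpow_swap1[of \<omega>] \<omega>_inverse)
  show "(\<omega>' ^^ n) ((\<omega> ^^ n) \<theta>) = \<theta>"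
    by (induction n arbitrary: \<theta>) (auto simp: funpow_swap1[of \<omega>'] \<omega>_inverse)
qed

lemma funpow_K: "(f ^^ n) ` K = K"
proof (induction n)
  case (Suc n)
  have "(f ^^ Suc n) ` K = f ` ((f ^^ n) ` K)" by (simp add: image_image)
  then show ?case using Suc K(3) by simp
qed simp

lemma fibre_preimage:
  assumes "y \<in> fibre ((\<omega> ^^ n) \<theta>)"
  obtains x where "x \<in> fibre \<theta>" "snd ((f ^^ n) (\<theta>, x)) = y"
proof -
  obtain p where p: "p \<in> K" "(f ^^ n) p = ((\<omega> ^^ n) \<theta>, y)"
    using assms funpow_K[of n] unfolding fibre_def by (metis imageE mem_Collect_eq)
  then have "(\<omega> ^^ n) (fst p) = (\<omega> ^^ n) \<theta>" using fst_funpow[of n p] by simp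
  then have "fst p = \<theta>" by (metis funpow_inverse(2))
  then show ?thesis using that[of "snd p"] p by (cases p) (auto simp: fibre_def)
qed

text \<open>The base points whose fibre leaves \<open>U\<close> form the projection of a compact
  set, hence a closed set.\<close>

lemma fibre_upper_semicontinuous:
  assumes "open U" "fibre \<theta> \<subseteq> U"
  shows "\<exists>N. open N \<and> \<theta> \<in> N \<and> (\<forall>\<theta>'\<in>N. fibre \<theta>' \<subseteq> U)"
proof -
  have "compact (K \<inter> (UNIV \<times> (- U)))"
    using K(2) assms(1) by (intro compact_Int_closed closed_Times) auto
  then have "compact (fst ` (K \<inter> (UNIV \<times> (- U))))"
    by (intro compact_continuous_image continuous_intros)
  then have "open (- fst ` (K \<inter> (UNIV \<times> (- U))))"
    using compact_imp_closed by blast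
  moreover have "\<theta> \<in> - fst ` (K \<inter> (UNIV \<times> (- U)))"
    using assms(2) by (auto simp: fibre_def)
  moreover have "fibre \<theta>' \<subseteq> U" if "\<theta>' \<in> - fst ` (K \<inter> (UNIV \<times> (- U)))" for \<theta>'
    using that by (force simp: fibre_def)
  ultimately show ?thesis by blast
qed

text \<open>Two preimages of distinct points of \<open>S\<close> under a late iterate cannot form a
  pair in \<open>V\<close>: attraction would push their images off the finitely many off-diagonal
  pairs of \<open>S\<close>.\<close>

lemma separated_preimage:
  assumes "finite S" "S \<subseteq> fibre \<theta>"
  shows "\<exists>I. \<forall>i\<ge>I. \<forall>\<theta>'. (\<omega> ^^ i) \<theta>' = \<theta> \<longrightarrow>
    (\<exists>S'\<subseteq>fibre \<theta>'. finite S' \<and> card S' = card S \<and> separated \<theta>' S')"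
proof -
  \<comment> \<open>Removing finitely many points leaves an open set, and no diagonal point is
    removed; thus \<open>attracting\<close> applies.\<close>
  define W where "W = - ((\<lambda>(x, y). (\<theta>, x, y)) ` {(x, y) \<in> S \<times> S. x \<noteq> y})"
  have "finite ((\<lambda>(x, y). (\<theta>, x, y)) ` {(x, y) \<in> S \<times> S. x \<noteq> y})"
    using assms(1) by (intro finite_imageI finite_subset[OF _ finite_cartesian_product[OF assms(1) assms(1)]]) auto
  then have "open W"
    unfolding W_def using finite_imp_closed by blast
  moreover have "(\<theta>, x, x) \<in> W" for \<theta> x by (auto simp: W_def)
  ultimately obtain I where I: "\<And>i \<theta>' x y. I \<le> i \<Longrightarrow> (\<theta>', x) \<in> K \<Longrightarrow> (\<theta>', y) \<in> K \<Longrightarrow> (\<theta>', x, y) \<in> V \<Longrightarrow>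
        ((\<omega> ^^ i) \<theta>', snd ((f ^^ i) (\<theta>', x)), snd ((f ^^ i) (\<theta>', y))) \<in> W"
    using attracting[of W] by metis
  show ?thesis
  proof (intro exI[of _ I] allI impI)
    fix i \<theta>' assume i: "I \<le> i" "(\<omega> ^^ i) \<theta>' = \<theta>"
    have "\<exists>x. x \<in> fibre \<theta>' \<and> snd ((f ^^ i) (\<theta>', x)) = y" if "y \<in> S" for y
      using fibre_preimage[of y i \<theta>'] that assms(2) i(2) by blast
    then obtain h where h: "\<And>y. y \<in> S \<Longrightarrow> h y \<in> fibre \<theta>'" "\<And>y. y \<in> S \<Longrightarrow> snd ((f ^^ i) (\<theta>', h y)) = y"
      by metis
    have "inj_on h S" using h(2) by (metis inj_onI)
    then have "card (h ` S) = card S" by (rule card_image)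
    moreover have "separated \<theta>' (h ` S)"
      unfolding separated_def
    proof (intro ballI impI notI)
      fix x y assume "x \<in> h ` S" "y \<in> h ` S" "x \<noteq> y" and xyV: "(\<theta>', x, y) \<in> V"
      then obtain a b where ab: "a \<in> S" "b \<in> S" "x = h a" "y = h b" "a \<noteq> b" by auto
      then have "(\<theta>, a, b) \<in> W"
        using I[OF i(1) _ _ xyV] h i(2) by (auto simp: fibre_def)
      then show False using ab by (auto simp: W_def)
    qed
    moreover have "h ` S \<subseteq> fibre \<theta>'" using h(1) by auto
    ultimately show "\<exists>S'\<subseteq>fibre \<theta>'. finite S' \<and> card S' = card S \<and> separated \<theta>' S'"
      using assms(1) by blast
  qed
qed

text \<open>\<open>K\<close> is covered by finitely many boxes \<open>N p \<times> U p\<close> with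
  \<open>N p \<times> U p \<times> U p \<subseteq> V\<close>. A separated set has at most one point
  in each, and every finite part of a fibre is the bijective image of a separated set in the
  past.\<close>

lemma card_fibre_bounded:
  obtains m where "\<And>\<theta>. finite (fibre \<theta>) \<and> card (fibre \<theta>) \<le> m"
proof -
  have "\<exists>N U. open N \<and> open U \<and> fst p \<in> N \<and> snd p \<in> U \<and> N \<times> U \<times> U \<subseteq> V" if "p \<in> K" for p
  proof -
    have pV: "(fst p, snd p, snd p) \<in> V" using V_diag that by simp
    obtain N R where NR: "open N" "open R" "(fst p, snd p, snd p) \<in> N \<times> R" "N \<times> R \<subseteq> V"
      by (rule open_prod_elim[OF V_open pV])
    then have pR: "(snd p, snd p) \<in> R" by simp
    obtain U U' where "open U" "open U'" "(snd p, snd p) \<in> U \<times> U'" "U \<times> U' \<subseteq> R"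
      by (rule open_prod_elim[OF NR(2) pR])
    with NR show ?thesis
      by (intro exI[of _ N] exI[of _ "U \<inter> U'"]) auto
  qed
  then obtain N U where NU: "\<And>p. p \<in> K \<Longrightarrow> open (N p)" "\<And>p. p \<in> K \<Longrightarrow> open (U p)"
      "\<And>p. p \<in> K \<Longrightarrow> fst p \<in> N p" "\<And>p. p \<in> K \<Longrightarrow> snd p \<in> U p"
      "\<And>p. p \<in> K \<Longrightarrow> N p \<times> U p \<times> U p \<subseteq> V"
    by metis
  have "\<And>p. p \<in> K \<Longrightarrow> open (N p \<times> U p)" using NU(1,2) by (simp add: open_Times)
  moreover have "K \<subseteq> (\<Union>p\<in>K. N p \<times> U p)" using NU(3,4) by fastforce
  ultimately obtain P where P: "P \<subseteq> K" "finite P" "K \<subseteq> (\<Union>p\<in>P. N p \<times> U p)"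
    by (rule compactE_image[OF K(2)])
  have sep: "card S \<le> card P" if S: "S \<subseteq> fibre \<theta>" "separated \<theta> S" for S \<theta>
  proof -
    have "\<exists>p\<in>P. (\<theta>, x) \<in> N p \<times> U p" if "x \<in> S" for x
      using that S(1) P(3) by (auto simp: fibre_def)
    then obtain c where c: "\<And>x. x \<in> S \<Longrightarrow> c x \<in> P" "\<And>x. x \<in> S \<Longrightarrow> (\<theta>, x) \<in> N (c x) \<times> U (c x)"
      by metis
    have "inj_on c S"
    proof (rule inj_onI, rule ccontr)
      fix x y assume xy: "x \<in> S" "y \<in> S" "c x = c y" "x \<noteq> y"
      then have "(\<theta>, x, y) \<in> N (c x) \<times> U (c x) \<times> U (c x)"
        using c(2)[OF xy(1)] c(2)[OF xy(2)] by auto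
      then have "(\<theta>, x, y) \<in> V" using NU(5) c(1)[OF xy(1)] P(1) by blast
      then show False using S(2) xy by (auto simp: separated_def)
    qed
    then show ?thesis using c(1) P(2) by (intro card_inj_on_le[of c]) auto
  qed
  have le: "card S \<le> card P" if S: "finite S" "S \<subseteq> fibre \<theta>" for S \<theta>
  proof -
    obtain I where "\<forall>i\<ge>I. \<forall>\<theta>'. (\<omega> ^^ i) \<theta>' = \<theta> \<longrightarrow>
        (\<exists>S'\<subseteq>fibre \<theta>'. finite S' \<and> card S' = card S \<and> separated \<theta>' S')"
      using separated_preimage[OF S] by (rule exE)
    from this[rule_format, OF order_refl funpow_inverse(1)] sep show ?thesis by metis
  qed
  have fin: "finite (fibre \<theta>)" for \<theta>
  proof (rule ccontr)
    assume "infinite (fibre \<theta>)"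
    then obtain S where "finite S" "card S = Suc (card P)" "S \<subseteq> fibre \<theta>"
      using infinite_arbitrarily_large by blast
    then show False using le by force
  qed
  show ?thesis using that fin le by blast
qed

text \<open>The limit set of the backward orbit is closed, nonempty by compactness and carried onto
  itself by \<omega>; minimality makes it the whole base. The density persists for arbitrarily late
  times.\<close>

lemma backward_orbit_dense:
  assumes "open N" "\<theta>' \<in> N"
  obtains i \<theta>'' where "I \<le> i" "\<theta>'' \<in> N" "(\<omega> ^^ i) \<theta>'' = \<theta>"
proof -
  define Z where "Z I = {\<theta>''. \<exists>i\<ge>I. (\<omega> ^^ i) \<theta>'' = \<theta>}" for I
  define L where "L = (\<Inter>I. closure (Z I))"
  have Z_mono: "Z J \<subseteq> Z I" if "I \<le> J" for I J
    using that by (auto simp: Z_def intro: order_trans)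
  \<comment> \<open>Applying \<omega> lowers the index by one, which the intersection over all
    \<open>I\<close> absorbs.\<close>
  have \<omega>Z: "\<omega> ` Z (Suc I) \<subseteq> Z I" for I
  proof
    fix y assume "y \<in> \<omega> ` Z (Suc I)"
    then obtain x i where x: "y = \<omega> x" "Suc I \<le> i" "(\<omega> ^^ i) x = \<theta>" by (auto simp: Z_def)
    then obtain j where "i = Suc j" "I \<le> j" by (cases i) auto
    with x show "y \<in> Z I" by (auto simp: Z_def funpow_swap1)
  qed
  have \<omega>'Z: "\<omega>' ` Z I \<subseteq> Z I" for I
  proof
    fix y assume "y \<in> \<omega>' ` Z I"
    then obtain x i where x: "y = \<omega>' x" "I \<le> i" "(\<omega> ^^ i) x = \<theta>" by (auto simp: Z_def)
    then have "(\<omega> ^^ Suc i) y = \<theta>" by (simp add: funpow_swap1 \<omega>_inverse)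
    then show "y \<in> Z I" using x(2) unfolding Z_def by (intro CollectI exI[of _ "Suc i"]) auto
  qed
  have sub: "h ` closure S \<subseteq> closure T" if "continuous_on UNIV h" "h ` S \<subseteq> T" for h :: "'t \<Rightarrow> 't" and S T
    using image_closure_subset[of S h "closure T"] continuous_on_subset[OF that(1)] that(2) closure_subset
    by blast
  have "\<omega> ` L \<subseteq> L"
    unfolding L_def using sub[OF continuous_\<omega>(1) \<omega>Z] by blast
  moreover have "L \<subseteq> \<omega> ` L"
  proof
    fix x assume "x \<in> L"
    then have "\<omega>' x \<in> L" unfolding L_def using sub[OF continuous_\<omega>(2) \<omega>'Z] by blast
    then show "x \<in> \<omega> ` L" using \<omega>_inverse(2)[of x] by (metis imageI)
  qed
  moreover have "closed L" unfolding L_def by (intro closed_INT) auto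
  moreover have "L \<noteq> {}"
  proof -
    obtain x where x: "\<And>S. closed S \<Longrightarrow> eventually (\<lambda>n. (\<omega>' ^^ n) \<theta> \<in> S) sequentially \<Longrightarrow> x \<in> S"
      using compact_sequence_cluster[OF compact_base, of "\<lambda>n. (\<omega>' ^^ n) \<theta>"] by (metis UNIV_I)
    have "x \<in> closure (Z I)" for I
    proof (rule x)
      show "eventually (\<lambda>n. (\<omega>' ^^ n) \<theta> \<in> closure (Z I)) sequentially"
        using eventually_ge_at_top[of I]
      proof eventually_elim
        case (elim n)
        then have "(\<omega>' ^^ n) \<theta> \<in> Z I" using funpow_inverse(1) by (auto simp: Z_def)
        then show ?case using closure_subset by blast
      qed
    qed simp
    then show ?thesis by (auto simp: L_def)
  qed
  ultimately have "L = UNIV" using minimal[of L] by blast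
  then have "\<theta>' \<in> closure (Z I)" by (auto simp: L_def)
  then have "N \<inter> Z I \<noteq> {}" using assms by (auto simp: closure_iff_nhds_not_empty)
  then show ?thesis using that by (auto simp: Z_def)
qed

text \<open>A finite fibre has disjoint tasks met at once by finitely many open conditions: a pair
  of the fibre in \<open>V\<close> keeps a whole box in \<open>V\<close>, so separation of a nearby
  fibre is passed on to the given one, and upper semicontinuity places nearby fibres in the
  boxes.\<close>

lemma fibre_boxes:
  assumes U: "\<And>z. z \<in> fibre \<theta> \<Longrightarrow> open (U z) \<and> z \<in> U z"
  shows "\<exists>N G. open N \<and> \<theta> \<in> N \<and> (\<forall>z\<in>fibre \<theta>. G z \<subseteq> U z) \<and>
    (\<forall>z\<in>fibre \<theta>. \<forall>w\<in>fibre \<theta>. (\<theta>, z, w) \<in> V \<longrightarrow> N \<times> G z \<times> G w \<subseteq> V) \<and>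
    (\<forall>\<theta>'\<in>N. fibre \<theta>' \<subseteq> (\<Union>z\<in>fibre \<theta>. G z))"
proof -
  have fin: "finite (fibre \<theta>)" using card_fibre_bounded by metis
  have "\<exists>N P Q. open N \<and> open P \<and> open Q \<and> \<theta> \<in> N \<and> z \<in> P \<and> w \<in> Q \<and>
      ((\<theta>, z, w) \<in> V \<longrightarrow> N \<times> P \<times> Q \<subseteq> V)" for z w
  proof (cases "(\<theta>, z, w) \<in> V")
    case True
    obtain N R where NR: "open N" "open R" "(\<theta>, z, w) \<in> N \<times> R" "N \<times> R \<subseteq> V"
      by (rule open_prod_elim[OF V_open True])
    then have zwR: "(z, w) \<in> R" by simp
    obtain P Q where "open P" "open Q" "(z, w) \<in> P \<times> Q" "P \<times> Q \<subseteq> R"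
      by (rule open_prod_elim[OF NR(2) zwR])
    with NR show ?thesis
      by (intro exI[of _ N] exI[of _ P] exI[of _ Q]) auto
  qed (intro exI[of _ UNIV], auto)
  then obtain N P Q where NPQ: "\<And>z w. open (N z w)" "\<And>z w. open (P z w)" "\<And>z w. open (Q z w)"
      "\<And>z w. \<theta> \<in> N z w" "\<And>z w. z \<in> P z w" "\<And>z w. w \<in> Q z w"
      "\<And>z w. (\<theta>, z, w) \<in> V \<Longrightarrow> N z w \<times> P z w \<times> Q z w \<subseteq> V"
    by metis
  define M where "M = (\<Inter>z\<in>fibre \<theta>. \<Inter>w\<in>fibre \<theta>. N z w)"
  \<comment> \<open>The point \<open>z\<close> occurs as first entry in the pairs
    \<open>(z, w)\<close> and as second entry in the pairs \<open>(w, z)\<close>.\<close>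
  define G where "G z = U z \<inter> (\<Inter>w\<in>fibre \<theta>. P z w) \<inter> (\<Inter>w\<in>fibre \<theta>. Q w z)" for z
  have M: "open M" "\<theta> \<in> M"
    unfolding M_def using fin NPQ by (auto intro!: open_INT)
  have G: "open (G z)" "z \<in> G z" if "z \<in> fibre \<theta>" for z
    unfolding G_def using fin NPQ U[OF that] by (auto intro!: open_INT open_Int)
  have UG: "open (\<Union>z\<in>fibre \<theta>. G z)" "fibre \<theta> \<subseteq> (\<Union>z\<in>fibre \<theta>. G z)"
    using G by auto
  obtain N' where N': "open N'" "\<theta> \<in> N'" "\<forall>\<theta>'\<in>N'. fibre \<theta>' \<subseteq> (\<Union>z\<in>fibre \<theta>. G z)"
    using fibre_upper_semicontinuous[OF UG] by blast
  have "(M \<inter> N') \<times> G z \<times> G w \<subseteq> V" if zw: "z \<in> fibre \<theta>" "w \<in> fibre \<theta>" "(\<theta>, z, w) \<in> V" for z w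
  proof -
    have "(M \<inter> N') \<times> G z \<times> G w \<subseteq> N z w \<times> P z w \<times> Q z w"
      using zw(1,2) by (auto simp: M_def G_def)
    then show ?thesis using NPQ(7)[OF zw(3)] by blast
  qed
  moreover have "\<forall>z\<in>fibre \<theta>. G z \<subseteq> U z" by (auto simp: G_def)
  ultimately show ?thesis
    using M N' by (intro exI[of _ "M \<inter> N'"] exI[of _ G]) auto
qed

text \<open>Two points in the same box would form a pair in \<open>V\<close>, because the centre of
  the box paired with itself lies in \<open>V\<close>.\<close>

lemma separated_fibre_injection:
  assumes sep: "separated \<theta>' (fibre \<theta>')" and N: "\<theta>' \<in> N"
    and V: "\<forall>z\<in>fibre \<theta>. \<forall>w\<in>fibre \<theta>. (\<theta>, z, w) \<in> V \<longrightarrow> N \<times> G z \<times> G w \<subseteq> V"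
    and cover: "fibre \<theta>' \<subseteq> (\<Union>z\<in>fibre \<theta>. G z)"
  shows "\<exists>c. inj_on c (fibre \<theta>') \<and> c ` fibre \<theta>' \<subseteq> fibre \<theta> \<and> (\<forall>x\<in>fibre \<theta>'. x \<in> G (c x))"
proof -
  have "\<exists>z. z \<in> fibre \<theta> \<and> x \<in> G z" if "x \<in> fibre \<theta>'" for x using that cover by auto
  then obtain c where c: "\<And>x. x \<in> fibre \<theta>' \<Longrightarrow> c x \<in> fibre \<theta>" "\<And>x. x \<in> fibre \<theta>' \<Longrightarrow> x \<in> G (c x)"
    by metis
  have "inj_on c (fibre \<theta>')"
  proof (rule inj_onI, rule ccontr)
    fix x y assume xy: "x \<in> fibre \<theta>'" "y \<in> fibre \<theta>'" "c x = c y" "x \<noteq> y"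
    have "(\<theta>, c x, c x) \<in> V" using c(1)[OF xy(1)] V_diag by (simp add: fibre_def)
    then have "N \<times> G (c x) \<times> G (c x) \<subseteq> V"
      using V c(1)[OF xy(1)] by blast
    then have "(\<theta>', x, y) \<in> V"
      using N c(2)[OF xy(1)] c(2)[OF xy(2)] xy(3) by auto
    then show False using sep xy by (auto simp: separated_def)
  qed
  then show ?thesis using c by blast
qed

text \<open>Far in the past of a fibre of maximal cardinality \<open>k\<close> there are
  \<open>k\<close> separated points, which exhaust their fibre by maximality. Such fibres occur near
  every base point; they inject into the fibre there, so this has \<open>k\<close> points as well,
  and separation is inherited through the boxes.\<close>

theorem fibres_constant_card:
  obtains k where "1 \<le> k" "\<And>\<theta>. finite (fibre \<theta>)" "\<And>\<theta>. card (fibre \<theta>) = k"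
    "\<And>\<theta>. separated \<theta> (fibre \<theta>)"
proof -
  obtain m where m: "\<And>\<theta>. finite (fibre \<theta>) \<and> card (fibre \<theta>) \<le> m"
    using card_fibre_bounded by metis
  define k where "k = Max (range (\<lambda>\<theta>. card (fibre \<theta>)))"
  have fin: "finite (range (\<lambda>\<theta>. card (fibre \<theta>)))"
  proof (rule finite_subset)
    show "range (\<lambda>\<theta>. card (fibre \<theta>)) \<subseteq> {..m}" using m by (simp add: image_subset_iff)
  qed simp
  have le: "card (fibre \<theta>) \<le> k" for \<theta>
    unfolding k_def by (rule Max_ge[OF fin rangeI])
  have "k \<in> range (\<lambda>\<theta>. card (fibre \<theta>))"
    unfolding k_def by (rule Max_in[OF fin]) simp
  then obtain \<theta>0 where \<theta>0: "card (fibre \<theta>0) = k" by auto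
  obtain \<theta> x where "(\<theta>, x) \<in> K" using K(1) by auto
  then have "fibre \<theta> \<noteq> {}" by (auto simp: fibre_def)
  then have "0 < card (fibre \<theta>)" using m by (simp add: card_gt_0_iff)
  then have "1 \<le> k" using le[of \<theta>] by simp
  obtain I where I: "\<forall>i\<ge>I. \<forall>\<theta>'. (\<omega> ^^ i) \<theta>' = \<theta>0 \<longrightarrow>
      (\<exists>S'\<subseteq>fibre \<theta>'. finite S' \<and> card S' = card (fibre \<theta>0) \<and> separated \<theta>' S')"
    using separated_preimage[OF conjunct1[OF m] order_refl] by (rule exE)
  have main: "card (fibre \<theta>) = k \<and> separated \<theta> (fibre \<theta>)" for \<theta>
  proof -
    obtain N G where NO: "open N" "\<theta> \<in> N"
      "\<forall>z\<in>fibre \<theta>. \<forall>w\<in>fibre \<theta>. (\<theta>, z, w) \<in> V \<longrightarrow> N \<times> G z \<times> G w \<subseteq> V"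
      "\<forall>\<theta>'\<in>N. fibre \<theta>' \<subseteq> (\<Union>z\<in>fibre \<theta>. G z)"
      using fibre_boxes[of \<theta> "\<lambda>_. UNIV"] by auto
    obtain i \<theta>' where i: "I \<le> i" "\<theta>' \<in> N" "(\<omega> ^^ i) \<theta>' = \<theta>0"
      by (rule backward_orbit_dense[OF NO(1,2)])
    obtain S where S: "S \<subseteq> fibre \<theta>'" "card S = k" "separated \<theta>' S"
      using I[rule_format, OF i(1,3)] \<theta>0 by auto
    have "S = fibre \<theta>'" using S le[of \<theta>'] m[of \<theta>'] by (metis card_seteq)
    with S have S: "card (fibre \<theta>') = k" "separated \<theta>' (fibre \<theta>')" by auto
    obtain c where c: "inj_on c (fibre \<theta>')" "c ` fibre \<theta>' \<subseteq> fibre \<theta>" "\<And>x. x \<in> fibre \<theta>' \<Longrightarrow> x \<in> G (c x)"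
      using separated_fibre_injection[OF S(2) i(2) NO(3) bspec[OF NO(4) i(2)]] by blast
    have "k \<le> card (fibre \<theta>)" using card_inj_on_le[OF c(1,2)] m S(1) by simp
    with le[of \<theta>] have card: "card (fibre \<theta>) = k" by simp
    have surj: "c ` fibre \<theta>' = fibre \<theta>"
      using c(1,2) m card S(1) by (metis card_image card_subset_eq)
    have "separated \<theta> (fibre \<theta>)"
      unfolding separated_def
    proof (intro ballI impI notI)
      fix z w assume zw: "z \<in> fibre \<theta>" "w \<in> fibre \<theta>" "z \<noteq> w" "(\<theta>, z, w) \<in> V"
      obtain x y where xy: "x \<in> fibre \<theta>'" "y \<in> fibre \<theta>'" "c x = z" "c y = w"
        using zw(1,2) surj by (metis imageE)
      then have "(\<theta>', x, y) \<in> V" using NO(3) zw i(2) c(3)[OF xy(1)] c(3)[OF xy(2)] by blast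
      then show False using S(2) xy zw(3) by (auto simp: separated_def)
    qed
    with card show ?thesis by blast
  qed
  show ?thesis using that[OF \<open>1 \<le> k\<close>] m main by blast
qed

text \<open>Since cardinalities agree, the injection into the boxes is onto: every box meets the
  nearby fibre. Thus the lower half of Hausdorff continuity follows from the upper half, with the
  same neighbourhoods \<open>U z\<close>.\<close>

theorem fibres_continuous:
  assumes "\<And>z. z \<in> fibre \<theta> \<Longrightarrow> open (U z) \<and> z \<in> U z"
  shows "eventually (\<lambda>\<theta>'. (\<forall>x\<in>fibre \<theta>'. \<exists>z\<in>fibre \<theta>. x \<in> U z) \<and> (\<forall>z\<in>fibre \<theta>. \<exists>x\<in>fibre \<theta>'. x \<in> U z)) (nhds \<theta>)"
proof -
  obtain k where k: "\<And>\<theta>. finite (fibre \<theta>)" "\<And>\<theta>. card (fibre \<theta>) = k" "\<And>\<theta>. separated \<theta> (fibre \<theta>)"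
    using fibres_constant_card by metis
  obtain N G where NO: "open N" "\<theta> \<in> N" "\<forall>z\<in>fibre \<theta>. G z \<subseteq> U z"
      "\<forall>z\<in>fibre \<theta>. \<forall>w\<in>fibre \<theta>. (\<theta>, z, w) \<in> V \<longrightarrow> N \<times> G z \<times> G w \<subseteq> V"
      "\<forall>\<theta>'\<in>N. fibre \<theta>' \<subseteq> (\<Union>z\<in>fibre \<theta>. G z)"
    using fibre_boxes[of \<theta> U, OF assms] by auto
  show ?thesis
    using eventually_nhds_in_open[OF NO(1,2)]
  proof eventually_elim
    case (elim \<theta>')
    obtain c where c: "inj_on c (fibre \<theta>')" "c ` fibre \<theta>' \<subseteq> fibre \<theta>" "\<And>x. x \<in> fibre \<theta>' \<Longrightarrow> x \<in> G (c x)"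
      using separated_fibre_injection[OF k(3) elim NO(4) bspec[OF NO(5) elim]] by blast
    have surj: "c ` fibre \<theta>' = fibre \<theta>"
      using c(1,2) k(1,2) by (metis card_image card_subset_eq)
    show ?case
    proof (intro conjI ballI)
      fix x assume "x \<in> fibre \<theta>'"
      then show "\<exists>z\<in>fibre \<theta>. x \<in> U z" using c(2,3) NO(3) by blast
    next
      fix z assume "z \<in> fibre \<theta>"
      moreover from this obtain x where "x \<in> fibre \<theta>'" "c x = z" using surj by (metis imageE)
      ultimately show "\<exists>x\<in>fibre \<theta>'. x \<in> U z" using c(3)[of x] NO(3) by auto
    qed
  qed
qed

end

section \<open>Calculus in charts\<close>

lemma compact_unit_sphere: "compact (sphere (0 :: 'e::{real_normed_vector, heine_borel}) 1)"
  unfolding compact_eq_bounded_closed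
proof
  show "bounded (sphere (0::'e) 1)" unfolding bounded_iff by (intro exI[of _ 1]) simp
  show "closed (sphere (0::'e) 1)" unfolding sphere_def by (intro closed_Collect_eq continuous_intros)
qed

locale riemannian =
  fixes A :: "('x::{t2_space, second_countable_topology}, 'e::{real_normed_vector, heine_borel}) chart set"
    and g :: "('x, 'e) chart \<Rightarrow> 'x \<Rightarrow> 'e \<Rightarrow>\<^sub>L 'e \<Rightarrow>\<^sub>L real"
  assumes riemannian: "riemannian_manifold A g"
begin

definition chart_deriv :: "('x, 'e) chart \<Rightarrow> ('x, 'e) chart \<Rightarrow> ('x \<Rightarrow> 'x) \<Rightarrow> 'x \<Rightarrow> 'e \<Rightarrow> 'e" where
  "chart_deriv c c' h x = frechet_derivative (local_rep c c' h) (at (snd c x))"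

definition chart_differentiable :: "('x, 'e) chart \<Rightarrow> ('x, 'e) chart \<Rightarrow> ('x \<Rightarrow> 'x) \<Rightarrow> 'x \<Rightarrow> bool" where
  "chart_differentiable c c' h x \<longleftrightarrow> local_rep c c' h differentiable (at (snd c x))"

definition chart_norm :: "('x, 'e) chart \<Rightarrow> 'x \<Rightarrow> 'e \<Rightarrow> real" where
  "chart_norm c x v = sqrt (g c x v v)"

lemma atlas: "smooth_atlas A"
  using riemannian by (simp add: riemannian_manifold_def)

lemma chart_props:
  assumes "c \<in> A"
  shows open_chart: "open (fst c)" and open_chart_image: "open (snd c ` fst c)"
    and chart_inverse: "x \<in> fst c \<Longrightarrow> inv_into (fst c) (snd c) (snd c x) = x"
    and chart_inverse_right: "y \<in> snd c ` fst c \<Longrightarrow> snd c (inv_into (fst c) (snd c) y) = y"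
    and chart_inverse_in: "y \<in> snd c ` fst c \<Longrightarrow> inv_into (fst c) (snd c) y \<in> fst c"
    and continuous_chart: "continuous_on (fst c) (snd c)"
    and continuous_chart_inverse: "continuous_on (snd c ` fst c) (inv_into (fst c) (snd c))"
proof -
  have "is_chart c" using atlas assms by (simp add: smooth_atlas_def)
  then show "open (fst c)" "open (snd c ` fst c)" "continuous_on (fst c) (snd c)"
    "continuous_on (snd c ` fst c) (inv_into (fst c) (snd c))"
    "x \<in> fst c \<Longrightarrow> inv_into (fst c) (snd c) (snd c x) = x"
    by (auto simp: is_chart_def homeomorphism_def)
qed (auto simp: f_inv_into_f inv_into_into)

lemma chart_exists: obtains c where "c \<in> A" "x \<in> fst c"
  using atlas unfolding smooth_atlas_def by blast

lemma chart_at: "chart_at A x \<in> A" "x \<in> fst (chart_at A x)"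
proof -
  have "\<exists>c. c \<in> A \<and> x \<in> fst c" using chart_exists by metis
  then have "chart_at A x \<in> A \<and> x \<in> fst (chart_at A x)"
    unfolding chart_at_def by (rule someI_ex)
  then show "chart_at A x \<in> A" "x \<in> fst (chart_at A x)" by auto
qed

lemma has_derivative_local_rep:
  "chart_differentiable c c' h x \<Longrightarrow> (local_rep c c' h has_derivative chart_deriv c c' h x) (at (snd c x))"
  unfolding chart_differentiable_def chart_deriv_def by (simp add: frechet_derivative_works)

lemma bounded_linear_chart_deriv: "chart_differentiable c c' h x \<Longrightarrow> bounded_linear (chart_deriv c c' h x)"
  using has_derivative_local_rep has_derivative_bounded_linear by blast

lemma chart_deriv_compose:
  assumes c: "c \<in> A" "c' \<in> A" and x: "x \<in> fst c" "h1 x \<in> fst c'"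
    and cont: "continuous_on UNIV h1"
    and d1: "chart_differentiable c c' h1 x" and d2: "chart_differentiable c' c'' h2 (h1 x)"
  shows "chart_differentiable c c'' (\<lambda>x. h2 (h1 x)) x"
    and "chart_deriv c c'' (\<lambda>x. h2 (h1 x)) x = (\<lambda>v. chart_deriv c' c'' h2 (h1 x) (chart_deriv c c' h1 x v))"
proof -
  \<comment> \<open>Only where \<open>h1\<close> stays in the domain of \<open>c'\<close> do the
    local representatives compose to that of the composition; this set is open, so the derivative is
    unaffected.\<close>
  define S where "S = snd c ` fst c \<inter> (\<lambda>y. h1 (inv_into (fst c) (snd c) y)) -` fst c'"
  have "open S"
    unfolding S_def
    by (intro continuous_open_preimage open_chart_image[OF c(1)] open_chart[OF c(2)]
        continuous_on_compose2[OF cont continuous_chart_inverse[OF c(1)]]) auto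
  have "snd c x \<in> S" using x chart_inverse[OF c(1)] by (auto simp: S_def)
  have e: "local_rep c c' h1 (snd c x) = snd c' (h1 x)"
    using chart_inverse[OF c(1) x(1)] by (simp add: local_rep_def)
  have "((\<lambda>y. local_rep c' c'' h2 (local_rep c c' h1 y)) has_derivative
      (\<lambda>v. chart_deriv c' c'' h2 (h1 x) (chart_deriv c c' h1 x v))) (at (snd c x))"
    by (rule has_derivative_compose[OF has_derivative_local_rep[OF d1]])
      (simp only: e has_derivative_local_rep[OF d2])
  then have d: "(local_rep c c'' (\<lambda>x. h2 (h1 x)) has_derivative
      (\<lambda>v. chart_deriv c' c'' h2 (h1 x) (chart_deriv c c' h1 x v))) (at (snd c x))"
    by (rule has_derivative_transform_within_open[OF _ \<open>open S\<close> \<open>snd c x \<in> S\<close>])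
      (auto simp: local_rep_def S_def chart_inverse[OF c(2)])
  then show "chart_differentiable c c'' (\<lambda>x. h2 (h1 x)) x"
    unfolding chart_differentiable_def differentiable_def by blast
  show "chart_deriv c c'' (\<lambda>x. h2 (h1 x)) x = (\<lambda>v. chart_deriv c' c'' h2 (h1 x) (chart_deriv c c' h1 x v))"
    unfolding chart_deriv_def[of c c''] using frechet_derivative_at[OF d] by simp
qed

lemma transition:
  assumes "c \<in> A" "c' \<in> A" "x \<in> fst c" "x \<in> fst c'"
  shows transition_differentiable: "chart_differentiable c c' (\<lambda>x. x) x"
    and chart_norm_transition: "chart_norm c' x (chart_deriv c c' (\<lambda>x. x) x v) = chart_norm c x v"
proof -
  have "Ck_on (Suc 0) (local_rep c c' (\<lambda>x. x)) (snd c ` (fst c \<inter> fst c'))"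
    using atlas assms unfolding smooth_atlas_def smooth_on_def by blast
  then show "chart_differentiable c c' (\<lambda>x. x) x"
    using assms unfolding chart_differentiable_def Ck_on.simps by blast
  have "g c x v v = g c' x (chart_deriv c c' (\<lambda>x. x) x v) (chart_deriv c c' (\<lambda>x. x) x v)"
    using riemannian[unfolded riemannian_manifold_def, THEN conjunct2, THEN conjunct2, rule_format, of c c' x v v]
      assms by (simp add: chart_deriv_def Let_def)
  then show "chart_norm c' x (chart_deriv c c' (\<lambda>x. x) x v) = chart_norm c x v"
    by (simp add: chart_norm_def)
qed

lemma continuous_transition_deriv:
  assumes "c \<in> A" "c' \<in> A"
  shows "continuous_on (snd c ` (fst c \<inter> fst c')) (\<lambda>y. frechet_derivative (local_rep c c' (\<lambda>x. x)) (at y) v)"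
proof -
  have "Ck_on (Suc 0) (local_rep c c' (\<lambda>x. x)) (snd c ` (fst c \<inter> fst c'))"
    using atlas assms unfolding smooth_atlas_def smooth_on_def by blast
  then show ?thesis by simp
qed

lemma transition_inverse:
  assumes "c \<in> A" "c' \<in> A" "x \<in> fst c" "x \<in> fst c'"
  shows "chart_deriv c' c (\<lambda>x. x) x (chart_deriv c c' (\<lambda>x. x) x v) = v"
proof -
  have "chart_deriv c c (\<lambda>x. x) x = (\<lambda>v. chart_deriv c' c (\<lambda>x. x) x (chart_deriv c c' (\<lambda>x. x) x v))"
    using chart_deriv_compose(2)[of c c' x "\<lambda>x. x" c "\<lambda>x. x"] assms transition_differentiable by auto
  moreover have "(local_rep c c (\<lambda>x. x) has_derivative (\<lambda>v. v)) (at (snd c x))"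
    by (rule has_derivative_transform_within_open[OF has_derivative_ident open_chart_image[OF assms(1)]])
      (use assms in \<open>auto simp: local_rep_def chart_inverse\<close>)
  then have "chart_deriv c c (\<lambda>x. x) x = (\<lambda>v. v)"
    unfolding chart_deriv_def using frechet_derivative_at by metis
  ultimately show ?thesis by (metis (no_types))
qed

lemma chart_norm_pos:
  assumes "c \<in> A" "x \<in> fst c"
  shows "0 \<le> chart_norm c x v" "v \<noteq> 0 \<Longrightarrow> 0 < chart_norm c x v" "chart_norm c x 0 = 0"
    "chart_norm c x (r *\<^sub>R v) = \<bar>r\<bar> * chart_norm c x v"
proof -
  have pos: "v \<noteq> 0 \<Longrightarrow> 0 < g c x v v"
    using riemannian assms unfolding riemannian_manifold_def by blast
  then show "v \<noteq> 0 \<Longrightarrow> 0 < chart_norm c x v" by (simp add: chart_norm_def)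
  show "chart_norm c x 0 = 0" by (simp add: chart_norm_def)
  show "0 \<le> chart_norm c x v" using pos by (cases "v = 0") (auto simp: chart_norm_def)
  show "chart_norm c x (r *\<^sub>R v) = \<bar>r\<bar> * chart_norm c x v"
    by (simp add: chart_norm_def blinfun.scaleR_right blinfun.scaleR_left real_sqrt_mult)
qed

lemma continuous_metric:
  assumes "c \<in> A"
  shows "continuous_on (fst c) (g c)"
proof -
  have "Ck_on 0 (\<lambda>y. g c (inv_into (fst c) (snd c) y)) (snd c ` fst c)"
    using riemannian assms unfolding riemannian_manifold_def smooth_on_def by blast
  then have "continuous_on (fst c) (\<lambda>x. g c (inv_into (fst c) (snd c) (snd c x)))"
    by (intro continuous_on_compose2[OF _ continuous_chart[OF assms]]) auto
  then show ?thesis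
    by (rule continuous_on_eq) (simp add: chart_inverse[OF assms])
qed

lemma continuous_on_chart_norm:
  assumes "c \<in> A" "continuous_on S u" "continuous_on S w" "u ` S \<subseteq> fst c"
  shows "continuous_on S (\<lambda>s. chart_norm c (u s) (w s))"
proof -
  have "continuous_on S (\<lambda>s. g c (u s))"
    using continuous_on_compose2[OF continuous_metric[OF assms(1)] assms(2,4)] .
  then show ?thesis
    unfolding chart_norm_def
    by (intro continuous_intros bounded_bilinear.continuous_on[OF bounded_bilinear_blinfun_apply] assms)
qed

text \<open>Both norms are homogeneous, so it suffices to compare them on the unit sphere of the
  model space, where continuity in base point and vector gives uniform bounds.\<close>

lemma chart_norm_equiv:
  assumes "c \<in> A" "compact Q" "Q \<subseteq> fst c"
  shows "\<exists>M\<ge>1. \<forall>x\<in>Q. \<forall>v. chart_norm c x v \<le> M * norm v \<and> norm v \<le> M * chart_norm c x v"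
proof (cases "Q \<times> sphere (0::'e) 1 = {}")
  \<comment> \<open>\<open>Q\<close> is empty or the model space is trivial; in both cases no
    nonzero vector has to be treated.\<close>
  case True
  have "chart_norm c x v \<le> 1 * norm v \<and> norm v \<le> 1 * chart_norm c x v" if "x \<in> Q" for x and v :: 'e
  proof (cases "v = 0")
    case False
    then have "(x, (1 / norm v) *\<^sub>R v) \<in> Q \<times> sphere 0 1" using that by simp
    then show ?thesis using True by blast
  qed (use chart_norm_pos(3)[OF assms(1)] assms(3) that in auto)
  then show ?thesis by (intro exI[of _ 1]) blast
next
  case False
  have "compact (sphere (0::'e) 1)"
    by (rule compact_unit_sphere)
  then have comp: "compact (Q \<times> sphere (0::'e) 1)" using assms(2) by (rule compact_Times[rotated])
  have cont: "continuous_on (Q \<times> sphere (0::'e) 1) (\<lambda>p. chart_norm c (fst p) (snd p))"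
    using assms by (intro continuous_on_chart_norm continuous_intros) auto
  obtain p where p: "p \<in> Q \<times> sphere 0 1" "\<And>q. q \<in> Q \<times> sphere 0 1 \<Longrightarrow> chart_norm c (fst p) (snd p) \<le> chart_norm c (fst q) (snd q)"
    using continuous_attains_inf[OF comp False cont] by blast
  obtain r where r: "r \<in> Q \<times> sphere 0 1" "\<And>q. q \<in> Q \<times> sphere 0 1 \<Longrightarrow> chart_norm c (fst q) (snd q) \<le> chart_norm c (fst r) (snd r)"
    using continuous_attains_sup[OF comp False cont] by blast
  define m where "m = chart_norm c (fst p) (snd p)"
  define M where "M = max 1 (max (1 / m) (chart_norm c (fst r) (snd r)))"
  have "0 < m" unfolding m_def using p(1) assms by (intro chart_norm_pos(2)) auto
  have "chart_norm c x v \<le> M * norm v \<and> norm v \<le> M * chart_norm c x v" if x: "x \<in> Q" for x and v :: 'e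
  proof (cases "v = 0")
    case False
    define w where "w = (1 / norm v) *\<^sub>R v"
    have v: "v = norm v *\<^sub>R w" using False by (simp add: w_def)
    have w: "(x, w) \<in> Q \<times> sphere 0 1" using x False by (simp add: w_def)
    have Nv: "chart_norm c x v = norm v * chart_norm c x w"
      by (subst v, subst chart_norm_pos(4)) (use assms x in auto)
    have 1: "m \<le> chart_norm c x w" "chart_norm c x w \<le> M"
      using p(2)[OF w] r(2)[OF w] by (auto simp: m_def M_def)
    have "1 = (1 / m) * m" using \<open>0 < m\<close> by simp
    also have "\<dots> \<le> M * chart_norm c x w"
      using 1(1) \<open>0 < m\<close> by (intro mult_mono) (auto simp: M_def)
    finally have "norm v * 1 \<le> norm v * (M * chart_norm c x w)" by (intro mult_left_mono) auto
    moreover have "norm v * chart_norm c x w \<le> norm v * M" using 1(2) by (intro mult_left_mono) auto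
    ultimately show ?thesis unfolding Nv by (simp add: mult.commute mult.left_commute)
  qed (use chart_norm_pos(3)[OF assms(1)] assms(3) that in auto)
  moreover have "1 \<le> M" by (simp add: M_def)
  ultimately show ?thesis by blast
qed

lemma chart_norm_deriv_bounded:
  assumes "c \<in> A" "c' \<in> A" "x \<in> fst c" "h x \<in> fst c'" "chart_differentiable c c' h x"
  shows "\<exists>C\<ge>0. \<forall>v. chart_norm c' (h x) (chart_deriv c c' h x v) \<le> C * chart_norm c x v"
proof -
  obtain M where M: "1 \<le> M" "\<And>v. norm v \<le> M * chart_norm c x v"
    using chart_norm_equiv[of c "{x}"] assms by auto
  obtain M' where M': "1 \<le> M'" "\<And>v. chart_norm c' (h x) v \<le> M' * norm v"
    using chart_norm_equiv[of c' "{h x}"] assms by auto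
  obtain B where B: "0 < B" "\<And>v. norm (chart_deriv c c' h x v) \<le> norm v * B"
    using bounded_linear.pos_bounded[OF bounded_linear_chart_deriv[OF assms(5)]] by blast
  have "chart_norm c' (h x) (chart_deriv c c' h x v) \<le> (M' * (M * B)) * chart_norm c x v" for v
  proof -
    have "chart_norm c' (h x) (chart_deriv c c' h x v) \<le> M' * norm (chart_deriv c c' h x v)"
      by (rule M')
    also have "\<dots> \<le> M' * (norm v * B)" using M'(1) B by (intro mult_left_mono) auto
    also have "\<dots> \<le> M' * ((M * chart_norm c x v) * B)"
      using M'(1) B(1) M(2) by (intro mult_left_mono mult_right_mono) auto
    finally show ?thesis by (simp add: mult_ac)
  qed
  moreover have "0 \<le> M' * (M * B)" using M(1) M'(1) B(1) by simp
  ultimately show ?thesis by blast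
qed

text \<open>Frees \<open>deriv_norm\<close> from the arbitrary choice in \<open>chart_at\<close>:
  the derivative of a transition map is an isometry for the metric, hence carries unit ball onto
  unit ball.\<close>

lemma deriv_norm_chart:
  assumes c: "c \<in> A" "c' \<in> A" "x \<in> fst c" "h x \<in> fst c'"
    and cont: "continuous_on UNIV h"
    and diff: "\<And>c c'. c \<in> A \<Longrightarrow> c' \<in> A \<Longrightarrow> x \<in> fst c \<Longrightarrow> h x \<in> fst c' \<Longrightarrow> chart_differentiable c c' h x"
  shows "deriv_norm A g h x = (SUP v\<in>{v. chart_norm c x v \<le> 1}. chart_norm c' (h x) (chart_deriv c c' h x v))"
proof -
  define c0 where "c0 = chart_at A x"
  define c1 where "c1 = chart_at A (h x)"
  have c0: "c0 \<in> A" "x \<in> fst c0" and c1: "c1 \<in> A" "h x \<in> fst c1"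
    using chart_at by (auto simp: c0_def c1_def)
  let ?T = "chart_deriv c0 c (\<lambda>x. x) x"
  have eq: "chart_norm c1 (h x) (chart_deriv c0 c1 h x v) = chart_norm c' (h x) (chart_deriv c c' h x (?T v))" for v
  proof -
    have 1: "chart_deriv c0 c' h x = (\<lambda>v. chart_deriv c1 c' (\<lambda>x. x) (h x) (chart_deriv c0 c1 h x v))"
      using chart_deriv_compose(2)[of c0 c1 x h c' "\<lambda>x. x"] c c0 c1 cont diff transition_differentiable by auto
    have 2: "chart_deriv c0 c' h x = (\<lambda>v. chart_deriv c c' h x (?T v))"
      using chart_deriv_compose(2)[of c0 c x "\<lambda>x. x" c' h] c c0 c1 diff transition_differentiable by auto
    have "chart_norm c1 (h x) (chart_deriv c0 c1 h x v) =
        chart_norm c' (h x) (chart_deriv c1 c' (\<lambda>x. x) (h x) (chart_deriv c0 c1 h x v))"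
      using chart_norm_transition[OF c1(1) c(2) c1(2) c(4)] by simp
    also have "\<dots> = chart_norm c' (h x) (chart_deriv c0 c' h x v)" unfolding 1 by simp
    also have "\<dots> = chart_norm c' (h x) (chart_deriv c c' h x (?T v))" unfolding 2 by simp
    finally show ?thesis .
  qed
  have "?T ` {v. chart_norm c0 x v \<le> 1} = {v. chart_norm c x v \<le> 1}"
  proof (intro equalityI subsetI)
    fix w assume w: "w \<in> {v. chart_norm c x v \<le> 1}"
    have "w = ?T (chart_deriv c c0 (\<lambda>x. x) x w)"
      using transition_inverse[OF c(1) c0(1) c(3) c0(2)] by simp
    moreover have "chart_norm c0 x (chart_deriv c c0 (\<lambda>x. x) x w) \<le> 1"
      using chart_norm_transition[OF c(1) c0(1) c(3) c0(2)] w by simp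
    ultimately show "w \<in> ?T ` {v. chart_norm c0 x v \<le> 1}" by blast
  next
    fix w assume "w \<in> ?T ` {v. chart_norm c0 x v \<le> 1}"
    then show "w \<in> {v. chart_norm c x v \<le> 1}"
      using chart_norm_transition[OF c0(1) c(1) c0(2) c(3)] by auto
  qed
  then have "(SUP v\<in>{v. chart_norm c x v \<le> 1}. chart_norm c' (h x) (chart_deriv c c' h x v)) =
      (SUP v\<in>{v. chart_norm c0 x v \<le> 1}. chart_norm c1 (h x) (chart_deriv c0 c1 h x v))"
    by (metis (no_types, lifting) eq image_cong image_image)
  also have "\<dots> = deriv_norm A g h x"
    unfolding deriv_norm_def Let_def c0_def[symmetric] c1_def[symmetric] chart_deriv_def chart_norm_def ..
  finally show ?thesis by simp
qed

text \<open>The supremum is characterised as the least bound for the derivative in any pair of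
  charts; later arguments use only this.\<close>

lemma deriv_norm_bounds:
  assumes c: "c \<in> A" "c' \<in> A" "x \<in> fst c" "h x \<in> fst c'"
    and cont: "continuous_on UNIV h"
    and diff: "\<And>c c'. c \<in> A \<Longrightarrow> c' \<in> A \<Longrightarrow> x \<in> fst c \<Longrightarrow> h x \<in> fst c' \<Longrightarrow> chart_differentiable c c' h x"
  shows chart_norm_deriv_le: "chart_norm c' (h x) (chart_deriv c c' h x v) \<le> deriv_norm A g h x * chart_norm c x v"
    and deriv_norm_nonneg: "0 \<le> deriv_norm A g h x"
    and deriv_norm_least: "0 \<le> L \<Longrightarrow> (\<And>v. chart_norm c' (h x) (chart_deriv c c' h x v) \<le> L * chart_norm c x v) \<Longrightarrow>
          deriv_norm A g h x \<le> L"
proof -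
  have dn: "deriv_norm A g h x = (SUP v\<in>{v. chart_norm c x v \<le> 1}. chart_norm c' (h x) (chart_deriv c c' h x v))"
    by (rule deriv_norm_chart[OF c cont diff])
  note lin = bounded_linear.linear[OF bounded_linear_chart_deriv[OF diff[OF c]]]
  obtain C where C: "0 \<le> C" "\<And>v. chart_norm c' (h x) (chart_deriv c c' h x v) \<le> C * chart_norm c x v"
    using chart_norm_deriv_bounded[of c c' x h, OF c diff[OF c]] by blast
  have bdd: "bdd_above ((\<lambda>v. chart_norm c' (h x) (chart_deriv c c' h x v)) ` {v. chart_norm c x v \<le> 1})"
  proof (rule bdd_aboveI2)
    fix v assume "v \<in> {v. chart_norm c x v \<le> 1}"
    then have "C * chart_norm c x v \<le> C * 1" using C(1) by (intro mult_left_mono) auto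
    then show "chart_norm c' (h x) (chart_deriv c c' h x v) \<le> C" using C(2)[of v] by simp
  qed
  have up: "chart_norm c' (h x) (chart_deriv c c' h x v) \<le> deriv_norm A g h x" if "chart_norm c x v \<le> 1" for v
    unfolding dn using cSUP_upper[OF _ bdd, of v] that by simp
  have "0 \<le> chart_norm c' (h x) (chart_deriv c c' h x 0)" by (rule chart_norm_pos(1)[OF c(2,4)])
  then show nonneg: "0 \<le> deriv_norm A g h x"
    using up[of 0] chart_norm_pos(3)[OF c(1,3)] by linarith
  show "chart_norm c' (h x) (chart_deriv c c' h x v) \<le> deriv_norm A g h x * chart_norm c x v"
  proof (cases "v = 0")
    case True
    then show ?thesis
      using chart_norm_pos(3)[OF c(1,3)] chart_norm_pos(3)[OF c(2,4)] linear_0[OF lin] by simp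
  next
    case False
    define r where "r = chart_norm c x v"
    have r: "0 < r" unfolding r_def by (rule chart_norm_pos(2)[OF c(1,3) False])
    have "chart_norm c x ((1 / r) *\<^sub>R v) \<le> 1"
      using r by (simp add: chart_norm_pos(4)[OF c(1,3)] r_def[symmetric])
    from up[OF this] have "(1 / r) * chart_norm c' (h x) (chart_deriv c c' h x v) \<le> deriv_norm A g h x"
      using r by (simp add: linear_cmul[OF lin] chart_norm_pos(4)[OF c(2,4)])
    then show ?thesis using r by (simp add: r_def[symmetric] field_simps)
  qed
  show "deriv_norm A g h x \<le> L" if L: "0 \<le> L" "\<And>v. chart_norm c' (h x) (chart_deriv c c' h x v) \<le> L * chart_norm c x v"
    unfolding dn
  proof (rule cSUP_least)
    show "{v. chart_norm c x v \<le> 1} \<noteq> {}"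
      using chart_norm_pos(3)[OF c(1,3)] by (intro ex_in_conv[THEN iffD1] exI[of _ 0]) simp
    fix v assume "v \<in> {v. chart_norm c x v \<le> 1}"
    then have "L * chart_norm c x v \<le> L * 1" using L(1) by (intro mult_left_mono) auto
    then show "chart_norm c' (h x) (chart_deriv c c' h x v) \<le> L" using L(2)[of v] by simp
  qed
qed


section \<open>Fibre derivatives of forced maps: chain rule, submultiplicativity, continuity\<close>

declare One_nat_def [simp del]

definition chart_domain :: "('x, 'e) chart \<Rightarrow> ('x, 'e) chart \<Rightarrow> ('t \<times> 'x \<Rightarrow> 't \<times> 'x) \<Rightarrow> ('t \<times> 'x) set" where
  "chart_domain c c' f = {p. snd p \<in> fst c \<and> snd (f p) \<in> fst c'}"

lemma fibre_map_1: "fibre_map f 1 \<theta> = (\<lambda>x. snd (f (\<theta>, x)))"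
  by (simp add: fibre_map_def fun_eq_iff One_nat_def)

text \<open>Treats an iterate as a forced map in its own right, so that facts about one step cover
  all iterates.\<close>

lemma fibre_map_funpow: "fibre_map f n = fibre_map (f ^^ n) 1"
  by (simp add: fibre_map_def fun_eq_iff One_nat_def)

lemma forced_C1_map_iff:
  "forced_C1_map A \<omega> f \<longleftrightarrow> continuous_on UNIV f \<and> (\<forall>p. fst (f p) = \<omega> (fst p)) \<and>
     (\<forall>c\<in>A. \<forall>c'\<in>A. (\<forall>p\<in>chart_domain c c' f. chart_differentiable c c' (fibre_map f 1 (fst p)) (snd p)) \<and>
        continuous_on (chart_domain c c' f) (\<lambda>p. Blinfun (chart_deriv c c' (fibre_map f 1 (fst p)) (snd p))))"
proof -
  have "{(\<theta>, x). x \<in> fst c \<and> fibre_map f 1 \<theta> x \<in> fst c'} = chart_domain c c' f" for c c'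
    by (auto simp: chart_domain_def fibre_map_1)
  then show ?thesis
    unfolding forced_C1_map_def chart_differentiable_def chart_deriv_def Let_def
    by (simp add: case_prod_unfold)
qed

lemma forced_C1_mapD:
  assumes "forced_C1_map A \<omega> f"
  shows forced_continuous: "continuous_on UNIV f" and forced_fst: "fst (f p) = \<omega> (fst p)"
    and forced_continuous_fibre: "continuous_on UNIV (fibre_map f 1 \<theta>)"
    and forced_differentiable: "c \<in> A \<Longrightarrow> c' \<in> A \<Longrightarrow> p \<in> chart_domain c c' f \<Longrightarrow>
          chart_differentiable c c' (fibre_map f 1 (fst p)) (snd p)"
    and forced_continuous_deriv: "c \<in> A \<Longrightarrow> c' \<in> A \<Longrightarrow>
          continuous_on (chart_domain c c' f) (\<lambda>p. Blinfun (chart_deriv c c' (fibre_map f 1 (fst p)) (snd p)))"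
    and forced_open_domain: "c \<in> A \<Longrightarrow> c' \<in> A \<Longrightarrow> open (chart_domain c c' f)"
proof -
  show cont: "continuous_on UNIV f" using assms by (simp add: forced_C1_map_iff)
  show "fst (f p) = \<omega> (fst p)" using assms unfolding forced_C1_map_iff by blast
  show "continuous_on UNIV (fibre_map f 1 \<theta>)"
    unfolding fibre_map_1 by (intro continuous_intros continuous_on_compose2[OF cont]) auto
  show "c \<in> A \<Longrightarrow> c' \<in> A \<Longrightarrow> p \<in> chart_domain c c' f \<Longrightarrow>
          chart_differentiable c c' (fibre_map f 1 (fst p)) (snd p)"
    "c \<in> A \<Longrightarrow> c' \<in> A \<Longrightarrow>
          continuous_on (chart_domain c c' f) (\<lambda>p. Blinfun (chart_deriv c c' (fibre_map f 1 (fst p)) (snd p)))"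
    using assms unfolding forced_C1_map_iff by blast+
  assume "c \<in> A" "c' \<in> A"
  then have "open (snd -` fst c \<inter> (\<lambda>p. snd (f p)) -` fst c')"
    by (intro open_Int open_vimage open_chart continuous_intros cont)
  moreover have "snd -` fst c \<inter> (\<lambda>p. snd (f p)) -` fst c' = chart_domain c c' f"
    by (auto simp: chart_domain_def)
  ultimately show "open (chart_domain c c' f)" by simp
qed

lemma blinfun_apply_chart_deriv:
  assumes "forced_C1_map A \<omega> f" "c \<in> A" "c' \<in> A" "p \<in> chart_domain c c' f"
  shows "blinfun_apply (Blinfun (chart_deriv c c' (fibre_map f 1 (fst p)) (snd p))) =
    chart_deriv c c' (fibre_map f 1 (fst p)) (snd p)"
  by (intro bounded_linear_Blinfun_apply bounded_linear_chart_deriv forced_differentiable[OF assms])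

lemma forced_chart_deriv_compose:
  assumes f1: "forced_C1_map A \<omega>1 f1" and f2: "forced_C1_map A \<omega>2 f2"
    and c: "c \<in> A" "c' \<in> A" "c'' \<in> A"
    and p: "p \<in> chart_domain c c' f1" "f1 p \<in> chart_domain c' c'' f2"
  shows "chart_differentiable c c'' (fibre_map (f2 \<circ> f1) 1 (fst p)) (snd p)"
    "chart_deriv c c'' (fibre_map (f2 \<circ> f1) 1 (fst p)) (snd p) =
      (\<lambda>v. chart_deriv c' c'' (fibre_map f2 1 (fst (f1 p))) (snd (f1 p)) (chart_deriv c c' (fibre_map f1 1 (fst p)) (snd p) v))"
proof -
  have f1p: "fibre_map f1 1 (fst p) (snd p) = snd (f1 p)"
    by (simp add: fibre_map_1)
  have "f1 (\<theta>, x) = (\<omega>1 \<theta>, snd (f1 (\<theta>, x)))" for \<theta> x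
    using forced_fst[OF f1, of "(\<theta>, x)"] by (metis fst_conv prod.collapse)
  then have eq: "fibre_map (f2 \<circ> f1) 1 (fst p) = (\<lambda>x. fibre_map f2 1 (fst (f1 p)) (fibre_map f1 1 (fst p) x))"
    unfolding fibre_map_1 forced_fst[OF f1] by (auto simp: fun_eq_iff)
  have x: "snd p \<in> fst c" "fibre_map f1 1 (fst p) (snd p) \<in> fst c'"
    using p(1) by (auto simp: chart_domain_def fibre_map_1)
  have d2: "chart_differentiable c' c'' (fibre_map f2 1 (fst (f1 p))) (fibre_map f1 1 (fst p) (snd p))"
    unfolding f1p by (rule forced_differentiable[OF f2 c(2,3) p(2)])
  note comp = chart_deriv_compose[OF c(1,2) x forced_continuous_fibre[OF f1] forced_differentiable[OF f1 c(1,2) p(1)] d2]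
  show "chart_differentiable c c'' (fibre_map (f2 \<circ> f1) 1 (fst p)) (snd p)"
    unfolding eq by (rule comp(1))
  show "chart_deriv c c'' (fibre_map (f2 \<circ> f1) 1 (fst p)) (snd p) =
      (\<lambda>v. chart_deriv c' c'' (fibre_map f2 1 (fst (f1 p))) (snd (f1 p)) (chart_deriv c c' (fibre_map f1 1 (fst p)) (snd p) v))"
    unfolding eq comp(2) f1p ..
qed

text \<open>The intermediate chart varies with the point. The domain is a union of open pieces
  \<open>S c'\<close>, and on each of them the derivative is a composition of continuous
  operator-valued maps.\<close>

lemma forced_C1_map_compose:
  assumes f1: "forced_C1_map A \<omega>1 f1" and f2: "forced_C1_map A \<omega>2 f2"
  shows "forced_C1_map A (\<omega>2 \<circ> \<omega>1) (f2 \<circ> f1)"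
  unfolding forced_C1_map_iff
proof (intro conjI allI ballI)
  show "continuous_on UNIV (f2 \<circ> f1)"
    using forced_continuous[OF f1] forced_continuous[OF f2]
    by (intro continuous_on_compose) (auto intro: continuous_on_subset)
  show "fst ((f2 \<circ> f1) p) = (\<omega>2 \<circ> \<omega>1) (fst p)" for p
    by (simp add: forced_fst[OF f1] forced_fst[OF f2])
next
  fix c c'' assume c: "c \<in> A" "c'' \<in> A"
  define S where "S c' = chart_domain c c' f1 \<inter> f1 -` chart_domain c' c'' f2" for c'
  have openS: "open (S c')" if "c' \<in> A" for c'
    unfolding S_def
    by (intro open_Int open_vimage forced_open_domain[OF f1] forced_open_domain[OF f2]
        forced_continuous[OF f1] c that)
  have dom: "chart_domain c c'' (f2 \<circ> f1) = (\<Union>c'\<in>A. S c')"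
  proof (intro equalityI subsetI)
    fix p assume p: "p \<in> chart_domain c c'' (f2 \<circ> f1)"
    obtain c' where "c' \<in> A" "snd (f1 p) \<in> fst c'" using chart_exists by metis
    then show "p \<in> (\<Union>c'\<in>A. S c')" using p by (auto simp: S_def chart_domain_def)
  qed (auto simp: S_def chart_domain_def)
  show "chart_differentiable c c'' (fibre_map (f2 \<circ> f1) 1 (fst p)) (snd p)"
    if p: "p \<in> chart_domain c c'' (f2 \<circ> f1)" for p
  proof -
    obtain c' where c': "c' \<in> A" "p \<in> S c'" using p unfolding dom by blast
    then show ?thesis
      using forced_chart_deriv_compose(1)[OF f1 f2 c(1) c'(1) c(2)] by (auto simp: S_def)
  qed
  show "continuous_on (chart_domain c c'' (f2 \<circ> f1)) (\<lambda>p. Blinfun (chart_deriv c c'' (fibre_map (f2 \<circ> f1) 1 (fst p)) (snd p)))"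
    unfolding dom
  proof (rule continuous_on_open_UN)
    fix c' assume c': "c' \<in> A"
    show "open (S c')" by (rule openS[OF c'])
    define L1 where "L1 p = Blinfun (chart_deriv c c' (fibre_map f1 1 (fst p)) (snd p))" for p
    define L2 where "L2 p = Blinfun (chart_deriv c' c'' (fibre_map f2 1 (fst p)) (snd p))" for p
    have "continuous_on (S c') L1"
      unfolding L1_def by (rule continuous_on_subset[OF forced_continuous_deriv[OF f1 c(1) c']]) (auto simp: S_def)
    moreover have "continuous_on (S c') (\<lambda>p. L2 (f1 p))"
      unfolding L2_def
      by (rule continuous_on_compose2[OF forced_continuous_deriv[OF f2 c' c(2)]
            continuous_on_subset[OF forced_continuous[OF f1]]]) (auto simp: S_def)
    ultimately have "continuous_on (S c') (\<lambda>p. L2 (f1 p) o\<^sub>L L1 p)"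
      by (intro bounded_bilinear.continuous_on[OF bounded_bilinear_blinfun_compose])
    then show "continuous_on (S c') (\<lambda>p. Blinfun (chart_deriv c c'' (fibre_map (f2 \<circ> f1) 1 (fst p)) (snd p)))"
    proof (rule continuous_on_eq)
      fix p assume "p \<in> S c'"
      then have p: "p \<in> chart_domain c c' f1" "f1 p \<in> chart_domain c' c'' f2" by (auto simp: S_def)
      have "blinfun_apply (L2 (f1 p) o\<^sub>L L1 p) = chart_deriv c c'' (fibre_map (f2 \<circ> f1) 1 (fst p)) (snd p)"
        unfolding forced_chart_deriv_compose(2)[OF f1 f2 c(1) c' c(2) p] L1_def L2_def
        by (auto simp: blinfun_apply_chart_deriv[OF f1 c(1) c' p(1)] blinfun_apply_chart_deriv[OF f2 c' c(2) p(2)])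
      then show "L2 (f1 p) o\<^sub>L L1 p = Blinfun (chart_deriv c c'' (fibre_map (f2 \<circ> f1) 1 (fst p)) (snd p))"
        by (metis blinfun_apply_inverse)
    qed
  qed
qed

lemma forced_C1_map_funpow:
  assumes "forced_C1_map A \<omega> f" "1 \<le> n"
  shows "forced_C1_map A (\<omega> ^^ n) (f ^^ n)"
  using assms(2)
proof (induction n rule: dec_induct)
  case (step n)
  show ?case using forced_C1_map_compose[OF step.IH assms(1)] by (simp only: funpow.simps(2))
qed (simp add: assms(1) One_nat_def)

definition fibre_deriv_norm :: "('t \<times> 'x \<Rightarrow> 't \<times> 'x) \<Rightarrow> 't \<times> 'x \<Rightarrow> real" where
  "fibre_deriv_norm f p = deriv_norm A g (fibre_map f 1 (fst p)) (snd p)"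

lemma fibre_deriv_norm_bounds:
  assumes f: "forced_C1_map A \<omega> f" and c: "c \<in> A" "c' \<in> A" and p: "p \<in> chart_domain c c' f"
  shows fibre_deriv_norm_upper: "chart_norm c' (snd (f p)) (chart_deriv c c' (fibre_map f 1 (fst p)) (snd p) v) \<le>
        fibre_deriv_norm f p * chart_norm c (snd p) v"
    and fibre_deriv_norm_least: "0 \<le> L \<Longrightarrow>
        (\<And>v. chart_norm c' (snd (f p)) (chart_deriv c c' (fibre_map f 1 (fst p)) (snd p) v) \<le> L * chart_norm c (snd p) v) \<Longrightarrow>
        fibre_deriv_norm f p \<le> L"
proof -
  have fp: "fibre_map f 1 (fst p) (snd p) = snd (f p)" by (simp add: fibre_map_1)
  have x: "snd p \<in> fst c" "fibre_map f 1 (fst p) (snd p) \<in> fst c'"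
    using p by (auto simp: chart_domain_def fp)
  have d: "chart_differentiable c c' (fibre_map f 1 (fst p)) (snd p)"
    if "c \<in> A" "c' \<in> A" "snd p \<in> fst c" "fibre_map f 1 (fst p) (snd p) \<in> fst c'" for c c'
    using that by (intro forced_differentiable[OF f]) (auto simp: chart_domain_def fp)
  show "chart_norm c' (snd (f p)) (chart_deriv c c' (fibre_map f 1 (fst p)) (snd p) v) \<le>
        fibre_deriv_norm f p * chart_norm c (snd p) v"
    unfolding fp[symmetric] fibre_deriv_norm_def
    by (rule chart_norm_deriv_le[OF c x forced_continuous_fibre[OF f]]) (rule d)
  show "fibre_deriv_norm f p \<le> L" if "0 \<le> L"
    "\<And>v. chart_norm c' (snd (f p)) (chart_deriv c c' (fibre_map f 1 (fst p)) (snd p) v) \<le> L * chart_norm c (snd p) v"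
    unfolding fibre_deriv_norm_def
    by (rule deriv_norm_least[OF c x forced_continuous_fibre[OF f] _ that(1)])
      (use d that(2) in \<open>simp_all add: fp\<close>)
qed

lemma fibre_deriv_norm_nonneg:
  assumes f: "forced_C1_map A \<omega> f"
  shows "0 \<le> fibre_deriv_norm f p"
proof -
  have fp: "fibre_map f 1 (fst p) (snd p) = snd (f p)" by (simp add: fibre_map_1)
  obtain c c' where c: "c \<in> A" "c' \<in> A" "snd p \<in> fst c" "fibre_map f 1 (fst p) (snd p) \<in> fst c'"
    using chart_exists by metis
  show ?thesis
    unfolding fibre_deriv_norm_def
    by (rule deriv_norm_nonneg[OF c forced_continuous_fibre[OF f]])
      (auto intro!: forced_differentiable[OF f] simp: chart_domain_def fp)
qed

lemma fibre_deriv_norm_compose: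
  assumes f1: "forced_C1_map A \<omega>1 f1" and f2: "forced_C1_map A \<omega>2 f2"
  shows "fibre_deriv_norm (f2 \<circ> f1) p \<le> fibre_deriv_norm f2 (f1 p) * fibre_deriv_norm f1 p"
proof -
  obtain c c' c'' where c: "c \<in> A" "c' \<in> A" "c'' \<in> A"
    and x: "snd p \<in> fst c" "snd (f1 p) \<in> fst c'" "snd (f2 (f1 p)) \<in> fst c''"
    using chart_exists by metis
  have p: "p \<in> chart_domain c c' f1" "f1 p \<in> chart_domain c' c'' f2" "p \<in> chart_domain c c'' (f2 \<circ> f1)"
    using x by (auto simp: chart_domain_def)
  show ?thesis
  proof (rule fibre_deriv_norm_least[OF forced_C1_map_compose[OF f1 f2] c(1,3) p(3)])
    show "0 \<le> fibre_deriv_norm f2 (f1 p) * fibre_deriv_norm f1 p"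
      by (intro mult_nonneg_nonneg fibre_deriv_norm_nonneg[OF f1] fibre_deriv_norm_nonneg[OF f2])
    fix v
    let ?w = "chart_deriv c c' (fibre_map f1 1 (fst p)) (snd p) v"
    have "chart_norm c'' (snd (f2 (f1 p))) (chart_deriv c' c'' (fibre_map f2 1 (fst (f1 p))) (snd (f1 p)) ?w) \<le>
        fibre_deriv_norm f2 (f1 p) * chart_norm c' (snd (f1 p)) ?w"
      by (rule fibre_deriv_norm_upper[OF f2 c(2,3) p(2)])
    also have "\<dots> \<le> fibre_deriv_norm f2 (f1 p) * (fibre_deriv_norm f1 p * chart_norm c (snd p) v)"
      by (intro mult_left_mono fibre_deriv_norm_upper[OF f1 c(1,2) p(1)] fibre_deriv_norm_nonneg[OF f2])
    finally show "chart_norm c'' (snd ((f2 \<circ> f1) p)) (chart_deriv c c'' (fibre_map (f2 \<circ> f1) 1 (fst p)) (snd p) v) \<le>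
        fibre_deriv_norm f2 (f1 p) * fibre_deriv_norm f1 p * chart_norm c (snd p) v"
      unfolding forced_chart_deriv_compose(2)[OF f1 f2 c p(1,2)] by (simp add: mult.assoc)
  qed
qed

text \<open>The unit ball in the supremum varies with the point, so the two semicontinuities are
  proved apart: from below a single vector witnesses the norm, from above the compact model sphere
  and the tube lemma treat all vectors at once.\<close>

lemma continuous_fibre_deriv_norm:
  assumes f: "forced_C1_map A \<omega> f"
  shows "continuous_on UNIV (fibre_deriv_norm f)"
proof -
  have "(fibre_deriv_norm f \<longlongrightarrow> fibre_deriv_norm f p) (at p)" for p
  proof -
    obtain c c' where c: "c \<in> A" "c' \<in> A" and x: "snd p \<in> fst c" "snd (f p) \<in> fst c'"
      using chart_exists by metis
    define W where "W = chart_domain c c' f"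
    have p: "p \<in> W" using x by (auto simp: W_def chart_domain_def)
    have W: "open W" unfolding W_def by (rule forced_open_domain[OF f c])
    define D where "D q = Blinfun (chart_deriv c c' (fibre_map f 1 (fst q)) (snd q))" for q
    have D: "blinfun_apply (D q) = chart_deriv c c' (fibre_map f 1 (fst q)) (snd q)" if "q \<in> W" for q
      unfolding D_def using that blinfun_apply_chart_deriv[OF f c] by (simp add: W_def)
    have Dc: "continuous_on W D"
      unfolding D_def W_def by (rule forced_continuous_deriv[OF f c])
    have c1: "continuous_on (W \<times> UNIV) (\<lambda>z. chart_norm c (snd (fst z)) (snd z))"
      by (intro continuous_on_chart_norm[OF c(1)] continuous_intros) (auto simp: W_def chart_domain_def)
    have c2: "continuous_on (W \<times> UNIV) (\<lambda>z. chart_norm c' (snd (f (fst z))) (D (fst z) (snd z)))"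
    proof (intro continuous_on_chart_norm[OF c(2)])
      show "continuous_on (W \<times> UNIV) (\<lambda>z. snd (f (fst z)))"
        by (intro continuous_intros continuous_on_compose2[OF forced_continuous[OF f]]) auto
      show "continuous_on (W \<times> UNIV) (\<lambda>z. D (fst z) (snd z))"
        by (intro bounded_bilinear.continuous_on[OF bounded_bilinear_blinfun_apply]
            continuous_on_compose2[OF Dc] continuous_intros) auto
    qed (auto simp: W_def chart_domain_def)
    \<comment> \<open>For \<open>L \<ge> 0\<close>, the norm at \<open>q\<close> is at most
      \<open>L\<close> iff \<Phi> \<open>L (q, v)\<close> is nonpositive for all \<open>v\<close>.
      Being positively homogeneous in \<open>v\<close>, it needs testing on the unit sphere
      only.\<close>
    define \<Phi> where "\<Phi> L z = chart_norm c' (snd (f (fst z))) (D (fst z) (snd z)) - L * chart_norm c (snd (fst z)) (snd z)" for L z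
    have \<Phi>c: "continuous_on (W \<times> UNIV) (\<Phi> L)" for L
      unfolding \<Phi>_def by (intro continuous_intros c1 c2)
    have up: "\<Phi> (fibre_deriv_norm f q) (q, v) \<le> 0" if "q \<in> W" for q v
      using fibre_deriv_norm_upper[OF f c, of q v] that D[OF that] by (simp add: \<Phi>_def W_def)
    have least: "fibre_deriv_norm f q \<le> L" if "q \<in> W" "0 \<le> L" "\<And>v. \<Phi> L (q, v) \<le> 0" for q L
      using fibre_deriv_norm_least[OF f c, of q L] that D[OF that(1)] by (simp add: \<Phi>_def W_def)
    have inW: "eventually (\<lambda>q. q \<in> W) (at p)"
      using eventually_at_topological W p by blast
    have xW: "snd q \<in> fst c" "snd (f q) \<in> fst c'" if "q \<in> W" for q
      using that by (auto simp: W_def chart_domain_def)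
    show ?thesis
    proof (rule order_tendstoI)
      fix a assume a: "a < fibre_deriv_norm f p"
      show "eventually (\<lambda>q. a < fibre_deriv_norm f q) (at p)"
      proof (cases "a < 0")
        case True
        then show ?thesis using fibre_deriv_norm_nonneg[OF f] by (auto intro!: always_eventually intro: less_le_trans)
      next
        case False
        then obtain v where v: "0 < \<Phi> a (p, v)"
          using least[OF p, of a] a by (metis linorder_not_less)
        have "open ((W \<times> UNIV) \<inter> \<Phi> a -` {0<..})"
          by (intro continuous_open_preimage[OF \<Phi>c] open_Times W open_UNIV) simp
        then have "open ((\<lambda>q. (q, v)) -` ((W \<times> UNIV) \<inter> \<Phi> a -` {0<..}))"
          by (intro open_vimage continuous_intros)
        then have "eventually (\<lambda>q. q \<in> (\<lambda>q. (q, v)) -` ((W \<times> UNIV) \<inter> \<Phi> a -` {0<..})) (at p)"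
          using p v by (intro eventually_at_topological[THEN iffD2]) blast
        then show ?thesis
        proof eventually_elim
          case (elim q)
          then have q: "q \<in> W" "0 < \<Phi> a (q, v)" by auto
          have "0 < \<Phi> a (q, v) - \<Phi> (fibre_deriv_norm f q) (q, v)" using q up[OF q(1), of v] by linarith
          also have "\<dots> = (fibre_deriv_norm f q - a) * chart_norm c (snd q) v"
            by (simp add: \<Phi>_def algebra_simps)
          finally show ?case
            using chart_norm_pos(1)[OF c(1) xW(1)[OF q(1)], of v] by (simp add: zero_less_mult_iff)
        qed
      qed
    next
      fix a assume a: "fibre_deriv_norm f p < a"
      \<comment> \<open>The midpoint leaves a strict gap on either side: \<Phi> \<open>L\<close> is
        negative on the sphere over \<open>p\<close>, and \<open>L\<close> is still below
        \<open>a\<close>.\<close>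
      define L where "L = (fibre_deriv_norm f p + a) / 2"
      have L: "fibre_deriv_norm f p < L" "L < a" using a by (auto simp: L_def)
      have L0: "0 \<le> L" using L(1) fibre_deriv_norm_nonneg[OF f, of p] by linarith
      have comp: "compact (sphere (0::'e) 1)"
        by (rule compact_unit_sphere)
      have op: "open ((W \<times> UNIV) \<inter> \<Phi> L -` {..<0})"
        by (intro continuous_open_preimage[OF \<Phi>c] open_Times W open_UNIV) simp
      have neg: "\<Phi> L (p, v) < 0" if v: "v \<in> sphere 0 1" for v :: 'e
      proof -
        have "\<Phi> L (p, v) = \<Phi> (fibre_deriv_norm f p) (p, v) - (L - fibre_deriv_norm f p) * chart_norm c (snd p) v"
          by (simp add: \<Phi>_def algebra_simps)
        also have "\<dots> < 0"
        proof -
          have "v \<noteq> 0" using v by auto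
          then have "0 < (L - fibre_deriv_norm f p) * chart_norm c (snd p) v"
            using L(1) chart_norm_pos(2)[OF c(1) x(1)] by simp
          then show ?thesis using up[OF p, of v] by linarith
        qed
        finally show ?thesis .
      qed
      have "{p} \<times> sphere 0 1 \<subseteq> (W \<times> UNIV) \<inter> \<Phi> L -` {..<0}" using p neg by auto
      from Elementary_Topology.tube_lemma[OF comp op this] obtain X0 where X0: "p \<in> X0" "open X0" "X0 \<times> sphere 0 1 \<subseteq> (W \<times> UNIV) \<inter> \<Phi> L -` {..<0}"
        by blast
      have "eventually (\<lambda>q. q \<in> X0) (at p)"
        using X0 by (intro eventually_at_topological[THEN iffD2]) blast
      then show "eventually (\<lambda>q. fibre_deriv_norm f q < a) (at p)"
        using inW
      proof eventually_elim
        case (elim q)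
        have "fibre_deriv_norm f q \<le> L"
        proof (rule least[OF elim(2) L0])
          fix v
          show "\<Phi> L (q, v) \<le> 0"
          proof (cases "v = 0")
            case True
            then show ?thesis
              using chart_norm_pos(3)[OF c(1) xW(1)[OF elim(2)]] chart_norm_pos(3)[OF c(2) xW(2)[OF elim(2)]]
              by (simp add: \<Phi>_def blinfun.zero_right)
          next
            case False
            define w where "w = (1 / norm v) *\<^sub>R v"
            have v: "v = norm v *\<^sub>R w" using False by (simp add: w_def)
            have "(q, w) \<in> X0 \<times> sphere 0 1" using False elim(1) by (simp add: w_def)
            then have "\<Phi> L (q, w) < 0" using X0(3) by blast
            moreover have "\<Phi> L (q, norm v *\<^sub>R w) = norm v * \<Phi> L (q, w)"
              using chart_norm_pos(4)[OF c(1) xW(1)[OF elim(2)]] chart_norm_pos(4)[OF c(2) xW(2)[OF elim(2)]]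
              by (simp add: \<Phi>_def blinfun.scaleR_right algebra_simps)
            ultimately have "\<Phi> L (q, norm v *\<^sub>R w) \<le> 0"
              by (simp add: mult_nonneg_nonpos)
            then show ?thesis using v by simp
          qed
        qed
        then show ?case using L(2) by simp
      qed
    qed
  qed
  then show ?thesis unfolding continuous_on_def by simp
qed


section \<open>Uniform estimates in charts and the Riemannian distance\<close>

lemma chart_ball_open:
  assumes "c \<in> A"
  shows "open {x \<in> fst c. dist (snd c x) y < \<rho>}"
proof -
  have "open (fst c \<inter> snd c -` ball y \<rho>)"
    by (intro continuous_open_preimage continuous_chart open_chart assms) simp
  moreover have "fst c \<inter> snd c -` ball y \<rho> = {x \<in> fst c. dist (snd c x) y < \<rho>}"
    by (auto simp: dist_commute)
  ultimately show ?thesis by simp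
qed

lemma open_chart_image_subset:
  assumes "c \<in> A" "open U"
  shows "open (snd c ` (fst c \<inter> U))"
proof -
  have "open (snd c ` fst c \<inter> inv_into (fst c) (snd c) -` U)"
    by (intro continuous_open_preimage continuous_chart_inverse open_chart_image assms)
  moreover have "snd c ` fst c \<inter> inv_into (fst c) (snd c) -` U = snd c ` (fst c \<inter> U)"
    using chart_inverse[OF assms(1)] by auto
  ultimately show ?thesis by simp
qed

lemma chart_ball_subset:
  assumes "c \<in> A" "open U" "x \<in> fst c" "x \<in> U"
  obtains \<rho> where "0 < \<rho>" "ball (snd c x) \<rho> \<subseteq> snd c ` (fst c \<inter> U)"
    "\<And>y. y \<in> fst c \<Longrightarrow> dist (snd c y) (snd c x) < \<rho> \<Longrightarrow> y \<in> U"
proof -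
  have "snd c x \<in> snd c ` (fst c \<inter> U)" using assms(3,4) by auto
  then obtain \<rho> where \<rho>: "0 < \<rho>" "ball (snd c x) \<rho> \<subseteq> snd c ` (fst c \<inter> U)"
    using open_chart_image_subset[OF assms(1,2)] open_contains_ball by blast
  have "y \<in> U" if y: "y \<in> fst c" "dist (snd c y) (snd c x) < \<rho>" for y
  proof -
    have "snd c y \<in> snd c ` (fst c \<inter> U)" using y \<rho>(2) by (auto simp: dist_commute)
    then obtain z where z: "z \<in> fst c" "z \<in> U" "snd c y = snd c z" by auto
    then show ?thesis using chart_inverse[OF assms(1)] y(1) by metis
  qed
  with \<rho> show ?thesis using that by blast
qed

text \<open>A Lebesgue number lemma for pairs in coordinates. Balls of half the radius cover the
  relevant part of \<open>K\<close>, so a second point at distance below \<eta> remains in the full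
  ball of the first.\<close>

lemma chart_Lebesgue_number:
  fixes K :: "('t::t2_space \<times> 'x) set"
  assumes c: "c \<in> A" and K: "compact K" and Q: "compact Q" "Q \<subseteq> fst c"
    and R: "\<And>\<theta>0 x0. (\<theta>0, x0) \<in> K \<Longrightarrow> x0 \<in> Q \<Longrightarrow> \<exists>N \<rho>. open N \<and> \<theta>0 \<in> N \<and> 0 < \<rho> \<and>
      (\<forall>\<theta>\<in>N. \<forall>x\<in>fst c. \<forall>y\<in>fst c. dist (snd c x) (snd c x0) < \<rho> \<longrightarrow> dist (snd c y) (snd c x0) < \<rho> \<longrightarrow> R \<theta> x y)"
  shows "\<exists>\<eta>>0. \<forall>\<theta> x y. (\<theta>, x) \<in> K \<longrightarrow> x \<in> Q \<longrightarrow> y \<in> fst c \<longrightarrow> dist (snd c x) (snd c y) < \<eta> \<longrightarrow> R \<theta> x y"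
proof -
  define K' where "K' = K \<inter> (UNIV \<times> Q)"
  have K': "compact K'"
    unfolding K'_def using compact_imp_closed[OF Q(1)] by (intro compact_Int_closed K closed_Times) auto
  have "\<forall>p\<in>K'. \<exists>N \<rho>. open N \<and> fst p \<in> N \<and> 0 < \<rho> \<and>
      (\<forall>\<theta>\<in>N. \<forall>x\<in>fst c. \<forall>y\<in>fst c. dist (snd c x) (snd c (snd p)) < \<rho> \<longrightarrow> dist (snd c y) (snd c (snd p)) < \<rho> \<longrightarrow> R \<theta> x y)"
  proof
    fix p assume "p \<in> K'"
    then show "\<exists>N \<rho>. open N \<and> fst p \<in> N \<and> 0 < \<rho> \<and>
      (\<forall>\<theta>\<in>N. \<forall>x\<in>fst c. \<forall>y\<in>fst c. dist (snd c x) (snd c (snd p)) < \<rho> \<longrightarrow> dist (snd c y) (snd c (snd p)) < \<rho> \<longrightarrow> R \<theta> x y)"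
      using R[of "fst p" "snd p"] by (simp add: K'_def mem_Times_iff)
  qed
  then obtain N \<rho> where N: "\<forall>p\<in>K'. open (N p) \<and> fst p \<in> N p \<and> 0 < \<rho> p \<and>
      (\<forall>\<theta>\<in>N p. \<forall>x\<in>fst c. \<forall>y\<in>fst c. dist (snd c x) (snd c (snd p)) < \<rho> p \<longrightarrow> dist (snd c y) (snd c (snd p)) < \<rho> p \<longrightarrow> R \<theta> x y)"
    unfolding bchoice_iff by blast
  define G where "G p = N p \<times> {x \<in> fst c. dist (snd c x) (snd c (snd p)) < \<rho> p / 2}" for p
  have "open (G p)" if "p \<in> K'" for p
    unfolding G_def using N that by (intro open_Times chart_ball_open[OF c]) auto
  moreover have "K' \<subseteq> (\<Union>p\<in>K'. G p)"
  proof
    fix p assume p: "p \<in> K'"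
    then have "p \<in> G p" using N Q(2) by (auto simp: G_def K'_def mem_Times_iff)
    then show "p \<in> (\<Union>p\<in>K'. G p)" using p by blast
  qed
  ultimately obtain F where F: "F \<subseteq> K'" "finite F" "K' \<subseteq> (\<Union>p\<in>F. G p)"
    by (rule compactE_image[OF K'])
  define \<eta> where "\<eta> = Min (insert 1 ((\<lambda>p. \<rho> p / 2) ` F))"
  have "0 < \<eta>" unfolding \<eta>_def using F N by (subst Min_gr_iff) auto
  have \<eta>: "\<eta> \<le> \<rho> p / 2" if "p \<in> F" for p
    unfolding \<eta>_def using F(2) that by (intro Min_le) auto
  have "R \<theta> x y" if xy: "(\<theta>, x) \<in> K" "x \<in> Q" "y \<in> fst c" "dist (snd c x) (snd c y) < \<eta>" for \<theta> x y
  proof -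
    have "(\<theta>, x) \<in> K'" using xy by (simp add: K'_def)
    then obtain p where p: "p \<in> F" "(\<theta>, x) \<in> G p" using F(3) by blast
    then have pK: "p \<in> K'" using F(1) by blast
    have x: "\<theta> \<in> N p" "x \<in> fst c" "dist (snd c x) (snd c (snd p)) < \<rho> p / 2"
      using p(2) by (auto simp: G_def)
    have "dist (snd c y) (snd c (snd p)) \<le> dist (snd c x) (snd c y) + dist (snd c x) (snd c (snd p))"
      by (metis dist_commute dist_triangle)
    also have "\<dots> < \<rho> p" using xy(4) \<eta>[OF p(1)] x(3) by linarith
    finally have "dist (snd c y) (snd c (snd p)) < \<rho> p" .
    moreover have "dist (snd c x) (snd c (snd p)) < \<rho> p"
      using x(3) N pK zero_le_dist[of "snd c x" "snd c (snd p)"] by linarith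
    ultimately show ?thesis using N pK x(1,2) xy(3) by blast
  qed
  with \<open>0 < \<eta>\<close> show ?thesis by blast
qed

text \<open>The derivative, at most 1/4 in norm at \<open>p\<close>, stays below 1/2 nearby by joint
  continuity; the mean value inequality on a coordinate ball, which is convex, gives the
  contraction.\<close>

lemma local_contraction:
  assumes f: "forced_C1_map A \<omega> f" and c: "c \<in> A" "c' \<in> A" and p: "p \<in> chart_domain c c' f"
    and U: "open U" "U \<subseteq> fst c'" "snd (f p) \<in> U"
    and le: "\<And>v. norm (chart_deriv c c' (fibre_map f 1 (fst p)) (snd p) v) \<le> norm v / 4"
  shows "\<exists>N \<rho>. open N \<and> fst p \<in> N \<and> 0 < \<rho> \<and>
     (\<forall>\<theta>\<in>N. \<forall>x\<in>fst c. \<forall>y\<in>fst c. dist (snd c x) (snd c (snd p)) < \<rho> \<longrightarrow> dist (snd c y) (snd c (snd p)) < \<rho> \<longrightarrow>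
       snd (f (\<theta>, x)) \<in> U \<and> snd (f (\<theta>, y)) \<in> U \<and>
       dist (snd c' (snd (f (\<theta>, x)))) (snd c' (snd (f (\<theta>, y)))) \<le> dist (snd c x) (snd c y) / 2)"
proof -
  define D where "D q = Blinfun (chart_deriv c c' (fibre_map f 1 (fst q)) (snd q))" for q
  have Dc: "continuous_on (chart_domain c c' f) D"
    unfolding D_def by (rule forced_continuous_deriv[OF f c])
  have D: "blinfun_apply (D q) = chart_deriv c c' (fibre_map f 1 (fst q)) (snd q)" if "q \<in> chart_domain c c' f" for q
    unfolding D_def by (rule blinfun_apply_chart_deriv[OF f c that])
  \<comment> \<open>\<open>G\<close> collects everything needed nearby: both charts apply, the
    derivative is small, and images lie in the prescribed set \<open>U\<close>.\<close>
  define G where "G = (chart_domain c c' f \<inter> (\<lambda>q. norm (D q)) -` {..<1/2}) \<inter> (\<lambda>q. snd (f q)) -` U"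
  have "open (chart_domain c c' f \<inter> (\<lambda>q. norm (D q)) -` {..<1/2})"
    by (intro continuous_open_preimage continuous_intros Dc forced_open_domain[OF f c])
  moreover have "open ((\<lambda>q. snd (f q)) -` U)"
    by (intro open_vimage U(1) continuous_intros forced_continuous[OF f])
  ultimately have "open G"
    unfolding G_def by (rule open_Int)
  have "norm (D p) \<le> 1/4"
    using le by (intro norm_blinfun_bound) (auto simp: D[OF p])
  then have "p \<in> G" using p U(3) by (auto simp: G_def)
  then obtain N V where NV: "open N" "open V" "p \<in> N \<times> V" "N \<times> V \<subseteq> G"
    by (rule open_prod_elim[OF \<open>open G\<close>])
  have x0: "snd p \<in> fst c" using p by (simp add: chart_domain_def)
  obtain \<rho> where \<rho>: "0 < \<rho>" "ball (snd c (snd p)) \<rho> \<subseteq> snd c ` (fst c \<inter> V)"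
    "\<And>y. y \<in> fst c \<Longrightarrow> dist (snd c y) (snd c (snd p)) < \<rho> \<Longrightarrow> y \<in> V"
    using chart_ball_subset[OF c(1) NV(2) x0] NV(3) by (metis mem_Times_iff)
  have "snd (f (\<theta>, x)) \<in> U \<and> snd (f (\<theta>, y)) \<in> U \<and>
       dist (snd c' (snd (f (\<theta>, x)))) (snd c' (snd (f (\<theta>, y)))) \<le> dist (snd c x) (snd c y) / 2"
    if \<theta>: "\<theta> \<in> N" and x: "x \<in> fst c" "dist (snd c x) (snd c (snd p)) < \<rho>"
      and y: "y \<in> fst c" "dist (snd c y) (snd c (snd p)) < \<rho>" for \<theta> x y
  proof -
    have "(\<theta>, x) \<in> G" "(\<theta>, y) \<in> G" using \<rho>(3) x y \<theta> NV(4) by blast+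
    then have "snd (f (\<theta>, x)) \<in> U" "snd (f (\<theta>, y)) \<in> U" by (auto simp: G_def)
    let ?h = "local_rep c c' (fibre_map f 1 \<theta>)"
    have "norm (?h (snd c x) - ?h (snd c y)) \<le> 1/2 * norm (snd c x - snd c y)"
    proof (rule differentiable_bound[OF convex_ball[of "snd c (snd p)" \<rho>],
          where f' = "\<lambda>z. blinfun_apply (D (\<theta>, inv_into (fst c) (snd c) z))"])
      fix z assume "z \<in> ball (snd c (snd p)) \<rho>"
      then obtain w where w: "w \<in> fst c" "w \<in> V" "z = snd c w" using \<rho>(2) by blast
      then have "(\<theta>, w) \<in> G" using \<theta> NV(4) by blast
      then have wd: "(\<theta>, w) \<in> chart_domain c c' f" and nD: "norm (D (\<theta>, w)) < 1/2"
        by (auto simp: G_def)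
      have "(?h has_derivative chart_deriv c c' (fibre_map f 1 \<theta>) w) (at z)"
        unfolding w(3) using has_derivative_local_rep[OF forced_differentiable[OF f c wd]] by simp
      then show "(?h has_derivative blinfun_apply (D (\<theta>, inv_into (fst c) (snd c) z))) (at z within ball (snd c (snd p)) \<rho>)"
        using D[OF wd] chart_inverse[OF c(1) w(1)] w(3) by (simp add: has_derivative_at_withinI)
      show "onorm (blinfun_apply (D (\<theta>, inv_into (fst c) (snd c) z))) \<le> 1/2"
        using nD chart_inverse[OF c(1) w(1)] w(3) by (simp add: norm_blinfun.rep_eq)
    qed (use x y in \<open>auto simp: dist_commute\<close>)
    moreover have "?h (snd c x) = snd c' (snd (f (\<theta>, x)))" "?h (snd c y) = snd c' (snd (f (\<theta>, y)))"
      using chart_inverse[OF c(1)] x(1) y(1) by (simp_all add: local_rep_def fibre_map_1)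
    ultimately show ?thesis
      using \<open>snd (f (\<theta>, x)) \<in> U\<close> \<open>snd (f (\<theta>, y)) \<in> U\<close> by (simp add: dist_norm)
  qed
  moreover have "fst p \<in> N" using NV(3) by (simp add: mem_Times_iff)
  ultimately show ?thesis using NV(1) \<rho>(1) by blast
qed

text \<open>The coordinate segment is an admissible curve whose speed is at most \<open>M\<close>
  times the model norm of its direction.\<close>

lemma chart_segment:
  assumes c: "c \<in> A" and S: "ball y0 r \<subseteq> snd c ` fst c" and x: "x \<in> fst c" "snd c x \<in> ball y0 r"
    and y: "y \<in> fst c" "snd c y \<in> ball y0 r"
    and M: "\<And>z v. z \<in> fst c \<Longrightarrow> snd c z \<in> ball y0 r \<Longrightarrow> chart_norm c z v \<le> M * norm v" "0 \<le> M"
  shows "riemannian_dist A g x y \<le> ennreal (M * dist (snd c x) (snd c y))"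
proof -
  define v where "v = snd c y - snd c x"
  define l where "l t = snd c x + t *\<^sub>R v" for t :: real
  define \<gamma> where "\<gamma> t = inv_into (fst c) (snd c) (l t)" for t
  have l01: "l 0 = snd c x" "l 1 = snd c y" by (auto simp: l_def v_def)
  have lin: "l t \<in> ball y0 r" if "t \<in> {0..1}" for t
  proof -
    have "l t = (1 - t) *\<^sub>R snd c x + t *\<^sub>R snd c y" by (simp add: l_def v_def algebra_simps)
    then show ?thesis using convexD_alt[OF convex_ball x(2) y(2), of t] that by simp
  qed
  have \<gamma>in: "\<gamma> t \<in> fst c" "snd c (\<gamma> t) = l t" if "t \<in> {0..1}" for t
    using chart_inverse_in[OF c] chart_inverse_right[OF c] lin[OF that] S by (auto simp: \<gamma>_def)
  have lc: "continuous_on T l" for T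
    unfolding l_def by (intro continuous_intros)
  have comp: "snd c' \<circ> \<gamma> = local_rep c c' (\<lambda>x. x) \<circ> l" for c'
    by (simp add: local_rep_def \<gamma>_def fun_eq_iff)
  \<comment> \<open>The definition of \<open>C1_curve_on\<close> tests all charts of the atlas. The
    derivative is two-sided even at the end points, as \<gamma> is defined for all real
    \<open>t\<close> and the segment lies in an open image.\<close>
  have der: "((snd c' \<circ> \<gamma>) has_vector_derivative chart_deriv c c' (\<lambda>x. x) (\<gamma> t) v) (at t)"
    if t: "t \<in> {0..1}" and c': "c' \<in> A" "\<gamma> t \<in> fst c'" for t c'
  proof -
    have "(l has_derivative (\<lambda>s. s *\<^sub>R v)) (at t)"
      unfolding l_def by (auto intro!: derivative_eq_intros)
    moreover have "(local_rep c c' (\<lambda>x. x) has_derivative chart_deriv c c' (\<lambda>x. x) (\<gamma> t)) (at (l t))"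
      using has_derivative_local_rep[OF transition_differentiable[OF c c'(1) \<gamma>in(1)[OF t] c'(2)]] \<gamma>in(2)[OF t] by simp
    ultimately have "(local_rep c c' (\<lambda>x. x) \<circ> l has_derivative (\<lambda>s. chart_deriv c c' (\<lambda>x. x) (\<gamma> t) (s *\<^sub>R v))) (at t)"
      unfolding comp_def by (rule has_derivative_compose)
    moreover have "linear (chart_deriv c c' (\<lambda>x. x) (\<gamma> t))"
      using bounded_linear_chart_deriv[OF transition_differentiable[OF c c'(1) \<gamma>in(1)[OF t] c'(2)]]
      by (rule bounded_linear.linear)
    ultimately show ?thesis
      unfolding has_vector_derivative_def comp by (simp add: linear_cmul)
  qed
  have "C1_curve_on A \<gamma> 0 1"
    unfolding C1_curve_on_def Let_def
  proof (intro conjI ballI)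
    show "continuous_on {0..1} \<gamma>"
      unfolding \<gamma>_def using lin S
      by (intro continuous_on_compose2[OF continuous_chart_inverse[OF c] lc]) auto
  next
    fix c' t assume c': "c' \<in> A" and t: "t \<in> {t \<in> {0..1}. \<gamma> t \<in> fst c'}"
    then have "((snd c' \<circ> \<gamma>) has_derivative (\<lambda>s. s *\<^sub>R chart_deriv c c' (\<lambda>x. x) (\<gamma> t) v)) (at t within {0..1})"
      using der[of t c'] by (auto simp: has_vector_derivative_def intro: has_derivative_at_withinI)
    then show "(snd c' \<circ> \<gamma>) differentiable (at t within {0..1})"
      unfolding differentiable_def by blast
  next
    fix c' assume c': "c' \<in> A"
    define T where "T = {t \<in> {0..1}. \<gamma> t \<in> fst c'}"
    have "continuous_on T (\<lambda>t. frechet_derivative (local_rep c c' (\<lambda>x. x)) (at (l t)) v)"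
    proof (rule continuous_on_compose2[OF continuous_transition_deriv[OF c c'] lc])
      show "l ` T \<subseteq> snd c ` (fst c \<inter> fst c')"
      proof
        fix z assume "z \<in> l ` T"
        then obtain t where "z = l t" "t \<in> {0..1}" "\<gamma> t \<in> fst c'" by (auto simp: T_def)
        then show "z \<in> snd c ` (fst c \<inter> fst c')"
          using \<gamma>in[of t] by (intro image_eqI[of _ _ "\<gamma> t"]) auto
      qed
    qed
    then have "continuous_on T (\<lambda>t. vector_derivative (snd c' \<circ> \<gamma>) (at t within {0..1}))"
    proof (rule continuous_on_eq)
      fix t assume "t \<in> T"
      then have t: "t \<in> {0..1}" "\<gamma> t \<in> fst c'" by (auto simp: T_def)
      have "vector_derivative (snd c' \<circ> \<gamma>) (at t within {0..1}) = chart_deriv c c' (\<lambda>x. x) (\<gamma> t) v"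
        using t(1) has_vector_derivative_at_within[OF der[OF t(1) c' t(2)], of "{0..1}"]
        by (intro vector_derivative_within_cbox[of 0 1, simplified]) auto
      then show "frechet_derivative (local_rep c c' (\<lambda>x. x)) (at (l t)) v =
          vector_derivative (snd c' \<circ> \<gamma>) (at t within {0..1})"
        using \<gamma>in(2)[OF t(1)] by (simp add: chart_deriv_def)
    qed
    then show "continuous_on {t \<in> {0..1}. \<gamma> t \<in> fst c'} (\<lambda>t. vector_derivative (snd c' \<circ> \<gamma>) (at t within {0..1}))"
      by (simp add: T_def)
  qed
  then have "piecewise_C1_curve A \<gamma>"
    unfolding piecewise_C1_curve_def
    by (intro exI[of _ 1] exI[of _ real]) auto
  moreover have "\<gamma> 0 = x" "\<gamma> 1 = y"
    using chart_inverse[OF c] x(1) y(1) by (auto simp: \<gamma>_def l01)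
  ultimately have "riemannian_dist A g x y \<le> ennreal (integral {0..1} (speed A g \<gamma>))"
    unfolding riemannian_dist_def by (intro INF_lower) simp
  also have "integral {0..1} (speed A g \<gamma>) \<le> M * norm v"
  proof (cases "speed A g \<gamma> integrable_on {0..1}")
    case True
    have "integral {0..1} (speed A g \<gamma>) \<le> integral {0..1} (\<lambda>t::real. M * norm v)"
    proof (rule integral_le[OF True])
      fix t :: real assume t: "t \<in> {0..1}"
      define c' where "c' = chart_at A (\<gamma> t)"
      have c': "c' \<in> A" "\<gamma> t \<in> fst c'" using chart_at by (auto simp: c'_def)
      have "speed A g \<gamma> t = chart_norm c' (\<gamma> t) (chart_deriv c c' (\<lambda>x. x) (\<gamma> t) v)"
        unfolding speed_def Let_def c'_def[symmetric] chart_norm_def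
        using vector_derivative_at[OF der[OF t c']] by simp
      also have "\<dots> = chart_norm c (\<gamma> t) v"
        by (rule chart_norm_transition[OF c c'(1) \<gamma>in(1)[OF t] c'(2)])
      also have "\<dots> \<le> M * norm v"
        using \<gamma>in[OF t] lin[OF t] by (intro M(1)) auto
      finally show "speed A g \<gamma> t \<le> M * norm v" .
    qed (rule integrable_const_ivl)
    then show ?thesis by simp
  next
    \<comment> \<open>The integral of a non-integrable function is 0 by convention, which the bound
      allows.\<close>
    case False
    then show ?thesis using M(2) by (simp add: not_integrable_integral)
  qed
  finally show ?thesis
    unfolding v_def by (simp add: dist_norm norm_minus_commute ennreal_leI)
qed

text \<open>The link between manifold topology and distance: a point has neighbourhoods of
  arbitrarily small distance to it. This turns the topological continuity of the fibres into
  Hausdorff continuity.\<close>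

lemma riemannian_dist_small:
  assumes "0 < e"
  shows "\<exists>U. open U \<and> z \<in> U \<and> (\<forall>y\<in>U. riemannian_dist A g y z \<le> ennreal e)"
proof -
  obtain c where c: "c \<in> A" "z \<in> fst c" using chart_exists by metis
  obtain r where r: "0 < r" "cball (snd c z) r \<subseteq> snd c ` fst c"
    using open_chart_image[OF c(1)] c(2) open_contains_cball by blast
  define Q where "Q = inv_into (fst c) (snd c) ` cball (snd c z) r"
  have "compact Q"
    unfolding Q_def
    by (intro compact_continuous_image continuous_on_subset[OF continuous_chart_inverse[OF c(1)] r(2)])
      (simp add: compact_eq_bounded_closed)
  moreover have "Q \<subseteq> fst c" unfolding Q_def using r(2) chart_inverse_in[OF c(1)] by blast
  ultimately obtain M where M: "1 \<le> M" "\<And>x v. x \<in> Q \<Longrightarrow> chart_norm c x v \<le> M * norm v"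
    using chart_norm_equiv[OF c(1)] by metis
  define \<rho> where "\<rho> = min r (e / M)"
  define U where "U = {x \<in> fst c. dist (snd c x) (snd c z) < \<rho>}"
  have "open U" unfolding U_def by (rule chart_ball_open[OF c(1)])
  moreover have "z \<in> U" using c(2) r(1) M(1) assms by (simp add: U_def \<rho>_def)
  moreover have "riemannian_dist A g y z \<le> ennreal e" if "y \<in> U" for y
  proof -
    have y: "y \<in> fst c" "dist (snd c y) (snd c z) < r" "dist (snd c y) (snd c z) < e / M"
      using that by (auto simp: U_def \<rho>_def)
    have "riemannian_dist A g y z \<le> ennreal (M * dist (snd c y) (snd c z))"
    proof (rule chart_segment[OF c(1), of "snd c z" r])
      show "ball (snd c z) r \<subseteq> snd c ` fst c" using r(2) ball_subset_cball by blast
      fix w v assume w: "w \<in> fst c" "snd c w \<in> ball (snd c z) r"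
      then have "w \<in> Q"
        unfolding Q_def using chart_inverse[OF c(1) w(1)] by (intro image_eqI[of _ _ "snd c w"]) auto
      then show "chart_norm c w v \<le> M * norm v" by (rule M(2))
    qed (use y c(2) r(1) M(1) in \<open>auto simp: dist_commute\<close>)
    also have "\<dots> \<le> ennreal e"
      using y(3) M(1) by (intro ennreal_leI) (simp add: field_simps)
    finally show ?thesis .
  qed
  ultimately show ?thesis by blast
qed

end

section \<open>Contracting iterates\<close>

text \<open>Balls of radius \<open>1 / Suc n\<close> around the points of finite nets form a
  base.\<close>

lemma compact_UNIV_countable_base:
  assumes "compact (UNIV :: 't::metric_space set)"
  shows "\<exists>B :: 't set set. countable B \<and> topological_basis B"
proof -
  have "\<exists>k. finite k \<and> (UNIV :: 't set) = (\<Union>x\<in>k. ball x (1 / Suc n))" for n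
  proof -
    have "UNIV \<subseteq> (\<Union>x\<in>UNIV. ball (x::'t) (1 / Suc n))" by auto
    then obtain k where "k \<subseteq> UNIV" "finite k" "UNIV \<subseteq> (\<Union>x\<in>k. ball (x::'t) (1 / Suc n))"
      by (rule compactE_image[OF assms open_ball])
    then show ?thesis by blast
  qed
  then obtain k where k: "\<And>n. finite (k n)" "\<And>n. (UNIV :: 't set) = (\<Union>x\<in>k n. ball x (1 / Suc n))"
    by metis
  define B where "B = (\<Union>n. (\<lambda>x. ball x (1 / Suc n)) ` k n)"
  have "countable B"
    unfolding B_def by (intro countable_UN countableI_type countable_image countable_finite[OF k(1)])
  moreover have "topological_basis B"
  proof (rule topological_basisI)
    show "open U" if "U \<in> B" for U using that by (auto simp: B_def)
    fix U :: "'t set" and x assume "open U" "x \<in> U"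
    then obtain e where e: "0 < e" "ball x e \<subseteq> U" using open_contains_ball by blast
    obtain n where n: "1 / Suc n < e / 2" using nat_approx_posE[of "e / 2"] e(1) by auto
    obtain y where y: "y \<in> k n" "x \<in> ball y (1 / Suc n)" using k(2)[of n] by blast
    have "ball y (1 / Suc n) \<subseteq> ball x e"
    proof
      fix z assume "z \<in> ball y (1 / Suc n)"
      then have "dist y z < 1 / Suc n" "dist y x < 1 / Suc n" using y(2) by auto
      then show "z \<in> ball x e" using n dist_triangle3[of x z y] by simp
    qed
    then show "\<exists>V\<in>B. x \<in> V \<and> V \<subseteq> U"
      using y e(2) by (intro bexI[of _ "ball y (1 / Suc n)"]) (auto simp: B_def)
  qed
  ultimately show ?thesis by blast
qed

lemma finite_uniform_positive:
  fixes P :: "'a \<Rightarrow> real \<Rightarrow> bool"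
  assumes "finite I" "\<And>i. i \<in> I \<Longrightarrow> \<exists>\<eta>>0. P i \<eta>"
    and "\<And>i \<eta> \<eta>'. P i \<eta> \<Longrightarrow> 0 < \<eta>' \<Longrightarrow> \<eta>' \<le> \<eta> \<Longrightarrow> P i \<eta>'"
  shows "\<exists>\<eta>>0. \<forall>i\<in>I. P i \<eta>"
  using assms(1,2)
proof (induction I rule: finite_induct)
  case empty
  then show ?case by (intro exI[of _ 1]) simp
next
  case (insert i I)
  obtain \<eta>1 where 1: "0 < \<eta>1" "\<forall>i\<in>I. P i \<eta>1" using insert by auto
  obtain \<eta>2 where 2: "0 < \<eta>2" "P i \<eta>2" using insert(4)[of i] by blast
  have "P j (min \<eta>1 \<eta>2)" if "j \<in> insert i I" for j
    using that 1 2 assms(3)[of j \<eta>1 "min \<eta>1 \<eta>2"] assms(3)[of j \<eta>2 "min \<eta>1 \<eta>2"] by auto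
  then show ?case using 1(1) 2(1) by (intro exI[of _ "min \<eta>1 \<eta>2"]) simp
qed

text \<open>Two points of one fibre moved simultaneously. The base point is computed from the first
  point alone, which is sound because the base motion ignores the fibre coordinate.\<close>

definition pair_step :: "('t \<times> 'x \<Rightarrow> 't \<times> 'x) \<Rightarrow> 't \<times> 'x \<times> 'x \<Rightarrow> 't \<times> 'x \<times> 'x" where
  "pair_step f = (\<lambda>(\<theta>, x, y). (fst (f (\<theta>, x)), snd (f (\<theta>, x)), snd (f (\<theta>, y))))"

lemma pair_step_funpow:
  assumes "\<And>p. fst (f p) = \<omega> (fst p)"
  shows "(pair_step f ^^ n) (\<theta>, x, y) = ((\<omega> ^^ n) \<theta>, snd ((f ^^ n) (\<theta>, x)), snd ((f ^^ n) (\<theta>, y)))"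
proof (induction n)
  case (Suc n)
  have fst_f: "fst ((f ^^ n) p) = (\<omega> ^^ n) (fst p)" for p
    by (induction n) (auto simp: assms)
  have eq: "((\<omega> ^^ n) \<theta>, snd ((f ^^ n) (\<theta>, z))) = (f ^^ n) (\<theta>, z)" for z
    using fst_f[of "(\<theta>, z)"] by (metis fst_conv prod.collapse)
  show ?case
    using Suc by (simp add: pair_step_def eq assms fst_f)
qed simp

context riemannian
begin

text \<open>Finitely many working charts: points are located in the open \<open>U i\<close>, uniform
  estimates are made on the compact \<open>Q i\<close>, and a single \<open>M\<close> compares the
  norms in all of them.\<close>

lemma chart_cover:
  assumes "compact P"
  shows "\<exists>(I::'x set) c U Q M. finite I \<and> P \<subseteq> (\<Union>i\<in>I. U i) \<and> 1 \<le> M \<and>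
    (\<forall>i\<in>I. c i \<in> A \<and> open (U i) \<and> U i \<subseteq> Q i \<and> compact (Q i) \<and> Q i \<subseteq> fst (c i) \<and>
      (\<forall>x\<in>Q i. \<forall>v. chart_norm (c i) x v \<le> M * norm v \<and> norm v \<le> M * chart_norm (c i) x v))"
proof -
  have "\<exists>c U Q M. z \<in> U \<and> c \<in> A \<and> open U \<and> U \<subseteq> Q \<and> compact Q \<and> Q \<subseteq> fst c \<and> 1 \<le> M \<and>
      (\<forall>x\<in>Q. \<forall>v. chart_norm c x v \<le> M * norm v \<and> norm v \<le> M * chart_norm c x v)" for z
  proof -
    obtain c where c: "c \<in> A" "z \<in> fst c" using chart_exists by metis
    obtain r where r: "0 < r" "cball (snd c z) r \<subseteq> snd c ` fst c"
      using open_chart_image[OF c(1)] c(2) open_contains_cball by blast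
    define Q where "Q = inv_into (fst c) (snd c) ` cball (snd c z) r"
    define U where "U = {x \<in> fst c. dist (snd c x) (snd c z) < r}"
    have Q: "compact Q" "Q \<subseteq> fst c"
    proof -
      show "compact Q"
        unfolding Q_def
        by (intro compact_continuous_image continuous_on_subset[OF continuous_chart_inverse[OF c(1)] r(2)])
          (simp add: compact_eq_bounded_closed)
      show "Q \<subseteq> fst c" unfolding Q_def using r(2) chart_inverse_in[OF c(1)] by blast
    qed
    have "U \<subseteq> Q"
    proof
      fix x assume "x \<in> U"
      then show "x \<in> Q"
        unfolding Q_def U_def using chart_inverse[OF c(1)]
        by (intro image_eqI[of _ _ "snd c x"]) (auto simp: dist_commute)
    qed
    moreover have "open U" unfolding U_def by (rule chart_ball_open[OF c(1)])
    moreover have "z \<in> U" using c r by (simp add: U_def)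
    ultimately show ?thesis using chart_norm_equiv[OF c(1) Q] Q c(1) by blast
  qed
  then obtain c U Q M where *: "\<And>z. z \<in> U z" "\<And>z. c z \<in> A" "\<And>z. open (U z)" "\<And>z. U z \<subseteq> Q z"
      "\<And>z. compact (Q z)" "\<And>z. Q z \<subseteq> fst (c z)" "\<And>z. 1 \<le> M z"
      "\<And>z x v. x \<in> Q z \<Longrightarrow> chart_norm (c z) x v \<le> M z * norm v \<and> norm v \<le> M z * chart_norm (c z) x v"
    by metis
  have "P \<subseteq> (\<Union>z\<in>UNIV. U z)" using *(1) by blast
  then obtain I where I: "I \<subseteq> UNIV" "finite I" "P \<subseteq> (\<Union>i\<in>I. U i)"
    by (rule compactE_image[OF assms *(3)])
  define L where "L = Max (insert 1 (M ` I))"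
  have L: "M i \<le> L" if "i \<in> I" for i unfolding L_def using I(2) that by (intro Max_ge) auto
  have "1 \<le> L" unfolding L_def using I(2) by (intro Max_ge) auto
  moreover have "chart_norm (c i) x v \<le> L * norm v \<and> norm v \<le> L * chart_norm (c i) x v"
    if "i \<in> I" "x \<in> Q i" for i x v
  proof -
    have "0 \<le> chart_norm (c i) x v" using *(2,6) that(2) by (intro chart_norm_pos(1)) auto
    then have "M i * chart_norm (c i) x v \<le> L * chart_norm (c i) x v" "M i * norm v \<le> L * norm v"
      using L[OF that(1)] by (auto intro: mult_right_mono)
    then show ?thesis using *(8)[OF that(2), of v] by linarith
  qed
  ultimately show ?thesis
    using I(2,3) * by (intro exI[of _ I] exI[of _ c] exI[of _ U] exI[of _ Q] exI[of _ L]) auto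
qed

lemma fibre_deriv_norm_power:
  assumes f: "forced_C1_map A \<omega> f" and K: "f ` K \<subseteq> K"
    and q: "\<And>p. p \<in> K \<Longrightarrow> fibre_deriv_norm f p \<le> q" "0 \<le> q" and j: "1 \<le> j" and p: "p \<in> K"
  shows "fibre_deriv_norm (f ^^ j) p \<le> q ^ j"
  using j p
proof (induction j arbitrary: p rule: dec_induct)
  case base
  then show ?case using q by (simp add: One_nat_def)
next
  case (step j)
  have "fibre_deriv_norm (f ^^ Suc j) p \<le> fibre_deriv_norm (f ^^ j) (f p) * fibre_deriv_norm f p"
    unfolding funpow_Suc_right
    by (rule fibre_deriv_norm_compose[OF f forced_C1_map_funpow[OF f step(1)]])
  also have "\<dots> \<le> q ^ j * q"
  proof (rule mult_mono[OF step.IH q(1)[OF step.prems] _ fibre_deriv_norm_nonneg[OF f]])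
    show "f p \<in> K" using step.prems K by blast
  qed (simp add: q(2))
  finally show ?case by (simp add: mult.commute del: funpow.simps)
qed

text \<open>A power \<open>F\<close> of the contracting iterate halves the coordinate distance of
  close pairs over \<open>K\<close>, possibly switching to another of the finitely many charts.
  Iterating \<open>F\<close> shrinks pairs to the diagonal, and the fewer than \<open>m\<close>
  remaining steps are absorbed by shrinking the target neighbourhood.\<close>

lemma contraction_attracting:
  fixes K :: "('t::t2_space \<times> 'x) set"
  assumes f: "forced_C1_map A \<omega> f" and K: "compact K" "K \<noteq> {}" "f ` K \<subseteq> K"
    and n: "1 \<le> n" "\<forall>p\<in>K. fibre_deriv_norm (f ^^ n) p < 1"
  shows "\<exists>V. open V \<and> (\<forall>\<theta> x. (\<theta>, x) \<in> K \<longrightarrow> (\<theta>, x, x) \<in> V) \<and>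
    (\<forall>W. open W \<longrightarrow> (\<forall>\<theta> x. (\<theta>, x) \<in> K \<longrightarrow> (\<theta>, x, x) \<in> W) \<longrightarrow>
      (\<exists>I. \<forall>i\<ge>I. \<forall>\<theta> x y. (\<theta>, x) \<in> K \<longrightarrow> (\<theta>, y) \<in> K \<longrightarrow> (\<theta>, x, y) \<in> V \<longrightarrow>
        (pair_step f ^^ i) (\<theta>, x, y) \<in> W))"
proof -
  have fn: "forced_C1_map A (\<omega> ^^ n) (f ^^ n)" by (rule forced_C1_map_funpow[OF f n(1)])
  have funK: "(f ^^ i) p \<in> K" if "p \<in> K" for i p
    using that K(3) by (induction i) auto
  have ctn: "continuous_on K (fibre_deriv_norm (f ^^ n))"
    by (rule continuous_on_subset[OF continuous_fibre_deriv_norm[OF fn] subset_UNIV])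
  obtain p0 where p0: "p0 \<in> K" "\<And>p. p \<in> K \<Longrightarrow> fibre_deriv_norm (f ^^ n) p \<le> fibre_deriv_norm (f ^^ n) p0"
    using continuous_attains_sup[OF K(1,2) ctn] by blast
  define q where "q = fibre_deriv_norm (f ^^ n) p0"
  have q: "0 \<le> q" "q < 1" using fibre_deriv_norm_nonneg[OF fn] n(2) p0(1) by (auto simp: q_def)
  have "compact (snd ` K)" by (intro compact_continuous_image continuous_intros K(1))
  from chart_cover[OF this] obtain I :: "'x set" and c U Q M where
    I: "finite I" "snd ` K \<subseteq> (\<Union>i\<in>I. U i)" "1 \<le> M" and
    cU: "\<forall>i\<in>I. c i \<in> A \<and> open (U i) \<and> U i \<subseteq> Q i \<and> compact (Q i) \<and> Q i \<subseteq> fst (c i) \<and>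
      (\<forall>x\<in>Q i. \<forall>v. chart_norm (c i) x v \<le> M * norm v \<and> norm v \<le> M * chart_norm (c i) x v)"
    by (elim exE conjE) (rule that)
  have c: "c i \<in> A" "open (U i)" "U i \<subseteq> Q i" "compact (Q i)" "Q i \<subseteq> fst (c i)"
    and cM: "\<And>x v. x \<in> Q i \<Longrightarrow> chart_norm (c i) x v \<le> M * norm v \<and> norm v \<le> M * chart_norm (c i) x v" if "i \<in> I" for i
    using cU that by blast+
  have "(\<lambda>j. q ^ j) \<longlonglongrightarrow> 0" using q by (intro LIMSEQ_power_zero) auto
  \<comment> \<open>Source and target norm each cost a factor \<open>M\<close> in coordinates; what
    is left is the 1/4 required by \<open>local_contraction\<close>.\<close>
  then have "eventually (\<lambda>j. q ^ j < 1 / (4 * M\<^sup>2)) sequentially"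
    using I(3) by (intro order_tendstoD(2)) auto
  then have "eventually (\<lambda>j. q ^ j < 1 / (4 * M\<^sup>2) \<and> 1 \<le> j) sequentially"
    using eventually_ge_at_top by (rule eventually_conj)
  from eventually_happens'[OF sequentially_bot this] obtain j where j: "q ^ j < 1 / (4 * M\<^sup>2)" "1 \<le> j"
    by blast
  define m where "m = n * j"
  have m: "1 \<le> m" using mult_le_mono[OF n(1) j(2)] by (simp add: m_def)
  define F where "F = f ^^ m"
  have Fj: "F = (f ^^ n) ^^ j" by (simp add: F_def m_def funpow_mult mult.commute)
  have F: "forced_C1_map A (\<omega> ^^ m) F" unfolding F_def by (rule forced_C1_map_funpow[OF f m])
  have Fq: "fibre_deriv_norm F p \<le> q ^ j" if "p \<in> K" for p
    unfolding Fj using p0(2) funK q(1) j(2) that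
    by (intro fibre_deriv_norm_power[OF fn]) (auto simp: q_def)
  \<comment> \<open>Closeness asks for some common chart domain \<open>U i\<close>; the chart may
    change with every application of \<open>F\<close>.\<close>
  define close where "close \<eta> = {(\<theta>::'t, x, y). \<exists>i\<in>I. x \<in> U i \<and> y \<in> U i \<and> dist (snd (c i) x) (snd (c i) y) < \<eta>}" for \<eta>
  have close_mono: "close \<eta> \<subseteq> close \<eta>'" if "\<eta> \<le> \<eta>'" for \<eta> \<eta>'
    using that unfolding close_def by fastforce
  have close_open: "open (close \<eta>)" for \<eta>
  proof -
    have "open ((U i \<times> U i) \<inter> (\<lambda>(x, y). dist (snd (c i) x) (snd (c i) y)) -` {..<\<eta>})" if i: "i \<in> I" for i
    proof (rule continuous_open_preimage)
      have ci: "continuous_on (U i) (snd (c i))"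
        using c(3,5)[OF i] by (intro continuous_on_subset[OF continuous_chart[OF c(1)[OF i]]]) auto
      show "continuous_on (U i \<times> U i) (\<lambda>(x, y). dist (snd (c i) x) (snd (c i) y))"
        unfolding case_prod_unfold
        by (intro continuous_intros continuous_on_compose2[OF ci]) auto
    qed (auto intro: open_Times c(2)[OF i])
    then have "open ((UNIV :: 't set) \<times> (\<Union>i\<in>I. (U i \<times> U i) \<inter> (\<lambda>(x, y). dist (snd (c i) x) (snd (c i) y)) -` {..<\<eta>}))"
      by (intro open_Times open_UN ballI) auto
    moreover have "(UNIV :: 't set) \<times> (\<Union>i\<in>I. (U i \<times> U i) \<inter> (\<lambda>(x, y). dist (snd (c i) x) (snd (c i) y)) -` {..<\<eta>}) = close \<eta>"
      by (auto simp: close_def)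
    ultimately show ?thesis by simp
  qed
  have close_diag: "(\<theta>, x, x) \<in> close \<eta>" if "(\<theta>, x) \<in> K" "0 < \<eta>" for \<theta> x \<eta>
    using that I(2) by (force simp: close_def)
  have contract: "\<exists>\<eta>>0. \<forall>i\<in>I. \<forall>\<theta> x y. (\<theta>, x) \<in> K \<longrightarrow> x \<in> Q i \<longrightarrow> y \<in> fst (c i) \<longrightarrow>
      dist (snd (c i) x) (snd (c i) y) < \<eta> \<longrightarrow>
      (\<exists>i'\<in>I. snd (F (\<theta>, x)) \<in> U i' \<and> snd (F (\<theta>, y)) \<in> U i' \<and>
        dist (snd (c i') (snd (F (\<theta>, x)))) (snd (c i') (snd (F (\<theta>, y)))) \<le> dist (snd (c i) x) (snd (c i) y) / 2)"
  proof (rule finite_uniform_positive[OF I(1)])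
    fix i assume i: "i \<in> I"
    show "\<exists>\<eta>>0. \<forall>\<theta> x y. (\<theta>, x) \<in> K \<longrightarrow> x \<in> Q i \<longrightarrow> y \<in> fst (c i) \<longrightarrow>
      dist (snd (c i) x) (snd (c i) y) < \<eta> \<longrightarrow>
      (\<exists>i'\<in>I. snd (F (\<theta>, x)) \<in> U i' \<and> snd (F (\<theta>, y)) \<in> U i' \<and>
        dist (snd (c i') (snd (F (\<theta>, x)))) (snd (c i') (snd (F (\<theta>, y)))) \<le> dist (snd (c i) x) (snd (c i) y) / 2)"
    proof (rule chart_Lebesgue_number[OF c(1)[OF i] K(1) c(4,5)[OF i]])
      fix \<theta>0 x0 assume p: "(\<theta>0, x0) \<in> K" "x0 \<in> Q i"
      have "F (\<theta>0, x0) \<in> K" unfolding F_def by (rule funK[OF p(1)])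
      then obtain i' where i': "i' \<in> I" "snd (F (\<theta>0, x0)) \<in> U i'" using I(2) by blast
      have dom: "(\<theta>0, x0) \<in> chart_domain (c i) (c i') F"
        using p(2) c(5)[OF i] i'(2) c(3,5)[OF i'(1)] by (auto simp: chart_domain_def)
      have "norm (chart_deriv (c i) (c i') (fibre_map F 1 (fst (\<theta>0, x0))) (snd (\<theta>0, x0)) v) \<le> norm v / 4" for v
      proof -
        let ?w = "chart_deriv (c i) (c i') (fibre_map F 1 (fst (\<theta>0, x0))) (snd (\<theta>0, x0)) v"
        have nn: "0 \<le> chart_norm (c i) x0 v" using p(2) c(1,5)[OF i] by (intro chart_norm_pos(1)) auto
        have "norm ?w \<le> M * chart_norm (c i') (snd (F (\<theta>0, x0))) ?w"
          using cM[OF i'(1)] i'(2) c(3)[OF i'(1)] by blast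
        also have "\<dots> \<le> M * (fibre_deriv_norm F (\<theta>0, x0) * chart_norm (c i) (snd (\<theta>0, x0)) v)"
          using I(3) by (intro mult_left_mono fibre_deriv_norm_upper[OF F c(1)[OF i] c(1)[OF i'(1)] dom]) auto
        also have "\<dots> \<le> M * (q ^ j * (M * norm v))"
          using I(3) q(1) cM[OF i p(2)] nn Fq[OF p(1)] by (intro mult_left_mono mult_mono) auto
        also have "\<dots> = q ^ j * (M\<^sup>2 * norm v)" by (simp add: power2_eq_square)
        also have "\<dots> \<le> (1 / (4 * M\<^sup>2)) * (M\<^sup>2 * norm v)"
          using j(1) by (intro mult_right_mono) auto
        also have "\<dots> = norm v / 4" using I(3) by simp
        finally show ?thesis .
      qed
      from local_contraction[OF F c(1)[OF i] c(1)[OF i'(1)] dom c(2)[OF i'(1)] subset_trans[OF c(3,5)[OF i'(1)]] i'(2) this]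
      obtain N \<rho> where N: "open N" "\<theta>0 \<in> N" "0 < \<rho>"
        "\<And>\<theta> x y. \<theta> \<in> N \<Longrightarrow> x \<in> fst (c i) \<Longrightarrow> y \<in> fst (c i) \<Longrightarrow> dist (snd (c i) x) (snd (c i) x0) < \<rho> \<Longrightarrow>
          dist (snd (c i) y) (snd (c i) x0) < \<rho> \<Longrightarrow> snd (F (\<theta>, x)) \<in> U i' \<and> snd (F (\<theta>, y)) \<in> U i' \<and>
          dist (snd (c i') (snd (F (\<theta>, x)))) (snd (c i') (snd (F (\<theta>, y)))) \<le> dist (snd (c i) x) (snd (c i) y) / 2"
        by (metis fst_conv snd_conv)
      then show "\<exists>N \<rho>. open N \<and> \<theta>0 \<in> N \<and> 0 < \<rho> \<and> (\<forall>\<theta>\<in>N. \<forall>x\<in>fst (c i). \<forall>y\<in>fst (c i).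
          dist (snd (c i) x) (snd (c i) x0) < \<rho> \<longrightarrow> dist (snd (c i) y) (snd (c i) x0) < \<rho> \<longrightarrow>
          (\<exists>i'\<in>I. snd (F (\<theta>, x)) \<in> U i' \<and> snd (F (\<theta>, y)) \<in> U i' \<and>
        dist (snd (c i') (snd (F (\<theta>, x)))) (snd (c i') (snd (F (\<theta>, y)))) \<le> dist (snd (c i) x) (snd (c i) y) / 2))"
        using i'(1) by (intro exI[of _ N] exI[of _ \<rho>]) blast
    qed
  qed (meson less_le_trans)
  then obtain \<eta>0 where \<eta>0: "0 < \<eta>0" and contr: "\<And>i \<theta> x y. i \<in> I \<Longrightarrow> (\<theta>, x) \<in> K \<Longrightarrow> x \<in> Q i \<Longrightarrow> y \<in> fst (c i) \<Longrightarrow>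
      dist (snd (c i) x) (snd (c i) y) < \<eta>0 \<Longrightarrow>
      (\<exists>i'\<in>I. snd (F (\<theta>, x)) \<in> U i' \<and> snd (F (\<theta>, y)) \<in> U i' \<and>
        dist (snd (c i') (snd (F (\<theta>, x)))) (snd (c i') (snd (F (\<theta>, y)))) \<le> dist (snd (c i) x) (snd (c i) y) / 2)"
    by (elim exE conjE) (rule that, assumption, blast)
  define t where "t = pair_step f"
  define K2 where "K2 = {(\<theta>, x, y). (\<theta>, x) \<in> K \<and> (\<theta>, y) \<in> K}"
  have tn: "(t ^^ i) (\<theta>, x, y) = ((\<omega> ^^ i) \<theta>, snd ((f ^^ i) (\<theta>, x)), snd ((f ^^ i) (\<theta>, y)))" for i \<theta> x y
    unfolding t_def by (rule pair_step_funpow) (rule forced_fst[OF f])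
  have fi: "(f ^^ i) (\<theta>, x) = ((\<omega> ^^ i) \<theta>, snd ((f ^^ i) (\<theta>, x)))" for i \<theta> x
    using forced_fst[OF f] by (induction i) (auto simp: prod_eq_iff)
  have tK: "(t ^^ i) z \<in> K2" if zK: "z \<in> K2" for i z
  proof -
    obtain \<theta> x y where z: "z = (\<theta>, x, y)" "(\<theta>, x) \<in> K" "(\<theta>, y) \<in> K" using zK by (auto simp: K2_def)
    show ?thesis
      unfolding z(1) tn K2_def using funK[OF z(2), of i] funK[OF z(3), of i] fi[of i] by auto
  qed
  have step: "(t ^^ m) z \<in> close (\<eta> / 2)" if z: "z \<in> K2" "z \<in> close \<eta>" and \<eta>: "\<eta> \<le> \<eta>0" for z \<eta>
  proof -
    obtain \<theta> x y i where zi: "z = (\<theta>, x, y)" "(\<theta>, x) \<in> K" "i \<in> I" "x \<in> U i" "y \<in> U i" "dist (snd (c i) x) (snd (c i) y) < \<eta>"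
      using z by (auto simp: K2_def close_def)
    have "x \<in> Q i" "y \<in> fst (c i)" using zi(4,5) c(3,5)[OF zi(3)] by auto
    then obtain i' where i': "i' \<in> I" "snd (F (\<theta>, x)) \<in> U i'" "snd (F (\<theta>, y)) \<in> U i'"
        "dist (snd (c i') (snd (F (\<theta>, x)))) (snd (c i') (snd (F (\<theta>, y)))) \<le> dist (snd (c i) x) (snd (c i) y) / 2"
      using contr[OF zi(3,2)] zi(6) \<eta> by (meson less_le_trans)
    then show ?thesis
      using zi(6) unfolding zi(1) tn F_def[symmetric] close_def by (auto intro!: bexI[of _ i'])
  qed
  have iter: "(t ^^ (m * k)) z \<in> close (\<eta>0 / 2 ^ k)" if z: "z \<in> K2" "z \<in> close \<eta>0" for z k
  proof (induction k)
    case (Suc k)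
    have "\<eta>0 / 2 ^ k \<le> \<eta>0" using \<eta>0 by (simp add: field_simps)
    from step[OF tK[OF z(1)] Suc this] have "(t ^^ m) ((t ^^ (m * k)) z) \<in> close (\<eta>0 / 2 ^ k / 2)" .
    moreover have "(t ^^ (m * Suc k)) z = (t ^^ m) ((t ^^ (m * k)) z)"
      by (simp add: funpow_add)
    moreover have "\<eta>0 / 2 ^ k / 2 = \<eta>0 / 2 ^ Suc k" by simp
    ultimately show ?case by (simp only:)
  qed (use z in simp)
  have t_cont: "continuous_on UNIV (t ^^ i)" for i
  proof (induction i)
    case (Suc i)
    have "continuous_on UNIV t"
      unfolding t_def pair_step_def case_prod_unfold
      by (intro continuous_intros continuous_on_compose2[OF forced_continuous[OF f]]) auto
    then show ?case using continuous_on_compose2[of UNIV t UNIV "t ^^ i"] Suc by simp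
  qed (simp add: id_def)
  have absorb: "\<exists>J. \<forall>i\<ge>J. \<forall>z\<in>K2. z \<in> close \<eta>0 \<longrightarrow> (t ^^ i) z \<in> W"
    if W: "open W" "\<forall>\<theta> x. (\<theta>, x) \<in> K \<longrightarrow> (\<theta>, x, x) \<in> W" for W
  proof -
    \<comment> \<open>Time is split as \<open>m * (i div m) + i mod m\<close>: once a pair is in
      \<open>W'\<close>, any further number of steps below \<open>m\<close> ends in
      \<open>W\<close>.\<close>
    define W' where "W' = (\<Inter>s\<in>{..<m}. (t ^^ s) -` W)"
    have W': "open W'"
      unfolding W'_def by (intro open_INT ballI open_vimage W(1) t_cont) auto
    have W'd: "(\<theta>, x, x) \<in> W'" if "(\<theta>, x) \<in> K" for \<theta> x
      unfolding W'_def using W(2) funK[OF that] fi[of _ \<theta> x] by (auto simp: tn)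
    have "\<exists>\<eta>>0. \<forall>i\<in>I. \<forall>\<theta> x y. (\<theta>, x) \<in> K \<longrightarrow> x \<in> Q i \<longrightarrow> y \<in> fst (c i) \<longrightarrow>
      dist (snd (c i) x) (snd (c i) y) < \<eta> \<longrightarrow> (\<theta>, x, y) \<in> W'"
    proof (rule finite_uniform_positive[OF I(1)])
      fix i assume i: "i \<in> I"
      show "\<exists>\<eta>>0. \<forall>\<theta> x y. (\<theta>, x) \<in> K \<longrightarrow> x \<in> Q i \<longrightarrow> y \<in> fst (c i) \<longrightarrow>
        dist (snd (c i) x) (snd (c i) y) < \<eta> \<longrightarrow> (\<theta>, x, y) \<in> W'"
      proof (rule chart_Lebesgue_number[OF c(1)[OF i] K(1) c(4,5)[OF i]])
        fix \<theta>0 x0 assume p: "(\<theta>0, x0) \<in> K" "x0 \<in> Q i"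
        obtain N R where NR: "open N" "open R" "(\<theta>0, x0, x0) \<in> N \<times> R" "N \<times> R \<subseteq> W'"
          by (rule open_prod_elim[OF W' W'd[OF p(1)]])
        then have "(x0, x0) \<in> R" by simp
        then obtain B1 B2 where B: "open B1" "open B2" "(x0, x0) \<in> B1 \<times> B2" "B1 \<times> B2 \<subseteq> R"
          by (rule open_prod_elim[OF NR(2)])
        have x0: "x0 \<in> fst (c i)" "x0 \<in> B1 \<inter> B2" using p(2) c(5)[OF i] B(3) by auto
        obtain \<rho> where \<rho>: "0 < \<rho>" "\<And>y. y \<in> fst (c i) \<Longrightarrow> dist (snd (c i) y) (snd (c i) x0) < \<rho> \<Longrightarrow> y \<in> B1 \<inter> B2"
          using chart_ball_subset[OF c(1)[OF i] open_Int[OF B(1,2)] x0] by metis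
        have "(\<theta>, x, y) \<in> W'" if "\<theta> \<in> N" "x \<in> fst (c i)" "y \<in> fst (c i)"
          "dist (snd (c i) x) (snd (c i) x0) < \<rho>" "dist (snd (c i) y) (snd (c i) x0) < \<rho>" for \<theta> x y
          using \<rho>(2)[OF that(2,4)] \<rho>(2)[OF that(3,5)] that(1) B(4) NR(4) by blast
        then show "\<exists>N \<rho>. open N \<and> \<theta>0 \<in> N \<and> 0 < \<rho> \<and> (\<forall>\<theta>\<in>N. \<forall>x\<in>fst (c i). \<forall>y\<in>fst (c i).
          dist (snd (c i) x) (snd (c i) x0) < \<rho> \<longrightarrow> dist (snd (c i) y) (snd (c i) x0) < \<rho> \<longrightarrow> (\<theta>, x, y) \<in> W')"
          using NR(1,3) \<rho>(1) by (intro exI[of _ N] exI[of _ \<rho>]) auto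
      qed
    qed (meson less_le_trans)
    then obtain \<eta> where \<eta>: "0 < \<eta>" "\<And>i \<theta> x y. i \<in> I \<Longrightarrow> (\<theta>, x) \<in> K \<Longrightarrow> x \<in> Q i \<Longrightarrow> y \<in> fst (c i) \<Longrightarrow>
      dist (snd (c i) x) (snd (c i) y) < \<eta> \<Longrightarrow> (\<theta>, x, y) \<in> W'"
      by (elim exE conjE) (rule that, assumption, blast)
    have closeW: "z \<in> W'" if z: "z \<in> K2" "z \<in> close \<eta>" for z
    proof -
      obtain \<theta> x y i where zi: "z = (\<theta>, x, y)" "(\<theta>, x) \<in> K" "i \<in> I" "x \<in> U i" "y \<in> U i" "dist (snd (c i) x) (snd (c i) y) < \<eta>"
        using z by (auto simp: K2_def close_def)
      have "x \<in> Q i" "y \<in> fst (c i)" using zi(4,5) c(3,5)[OF zi(3)] by auto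
      then show ?thesis using \<eta>(2)[OF zi(3,2) _ _ zi(6)] zi(1) by simp
    qed
    have "(\<lambda>k. \<eta>0 * (1/2) ^ k) \<longlonglongrightarrow> \<eta>0 * 0"
      by (intro tendsto_mult tendsto_const LIMSEQ_power_zero) auto
    then have "eventually (\<lambda>k. \<eta>0 * (1/2) ^ k < \<eta>) sequentially"
      using \<eta>(1) by (intro order_tendstoD(2)) auto
    then obtain J where J: "\<And>k. J \<le> k \<Longrightarrow> \<eta>0 / 2 ^ k < \<eta>"
      by (auto simp: eventually_sequentially power_divide)
    have "(t ^^ i) z \<in> W" if i: "m * J \<le> i" and z: "z \<in> K2" "z \<in> close \<eta>0" for i z
    proof -
      have "J \<le> i div m" using i m by (metis div_le_mono nonzero_mult_div_cancel_left not_one_le_zero)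
      then have "(t ^^ (m * (i div m))) z \<in> W'"
        using iter[OF z, of "i div m"] J close_mono by (intro closeW tK z(1)) (meson less_imp_le subsetD)
      moreover have "i mod m < m" using m by simp
      ultimately have "(t ^^ (i mod m)) ((t ^^ (m * (i div m))) z) \<in> W" by (auto simp: W'_def)
      moreover have "(t ^^ i) z = (t ^^ (i mod m)) ((t ^^ (m * (i div m))) z)"
        by (metis comp_apply funpow_add mod_mult_div_eq)
      ultimately show ?thesis by simp
    qed
    then show ?thesis by blast
  qed
  show ?thesis
  proof (intro exI[of _ "close \<eta>0"] conjI allI impI)
    fix W :: "('t \<times> 'x \<times> 'x) set" assume "open W" "\<forall>\<theta> x. (\<theta>, x) \<in> K \<longrightarrow> (\<theta>, x, x) \<in> W"
    then obtain J where "\<forall>i\<ge>J. \<forall>z\<in>K2. z \<in> close \<eta>0 \<longrightarrow> (t ^^ i) z \<in> W"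
      using absorb by blast
    then show "\<exists>I. \<forall>i\<ge>I. \<forall>\<theta> x y. (\<theta>, x) \<in> K \<longrightarrow> (\<theta>, y) \<in> K \<longrightarrow> (\<theta>, x, y) \<in> close \<eta>0 \<longrightarrow>
        (pair_step f ^^ i) (\<theta>, x, y) \<in> W"
      by (intro exI[of _ J]) (auto simp: K2_def t_def)
  qed (use close_open close_diag \<eta>0 in auto)
qed

end

text \<open>Once \<open>n\<close> exceeds \<open>D / c\<close>, the constant is absorbed by doubling
  the rate. As \<open>2 * c < 1\<close>, the logarithm then lies above \<open>- n\<close>, so the
  truncation is inactive and the bound concerns \<open>a n\<close> itself.\<close>

lemma limsup_growth:
  fixes a :: "nat \<Rightarrow> real"
  assumes a: "\<And>n. 0 \<le> a n" and c: "0 < c" "c < 1/2"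
    and inf: "\<exists>\<^sub>\<infinity>n. - c * n - D \<le> ln (max (a n) (exp (- real n)))"
  shows "ereal (- 2 * c) \<le> limsup (\<lambda>n. ereal (1 / real n) * log_ereal (a n))"
proof (rule ccontr)
  assume "\<not> ?thesis"
  then have "limsup (\<lambda>n. ereal (1 / real n) * log_ereal (a n)) < ereal (- 2 * c)" by simp
  from Limsup_lessD[OF this] obtain N
    where N: "\<And>n. N \<le> n \<Longrightarrow> ereal (1 / real n) * log_ereal (a n) < ereal (- 2 * c)"
    by (auto simp: eventually_sequentially)
  obtain k :: nat where k: "D / c < k" using reals_Archimedean2 by blast
  obtain n where n: "max N (max 1 k) \<le> n" "- c * n - D \<le> ln (max (a n) (exp (- real n)))"
    using inf unfolding INFM_nat_le by blast
  have n1: "N \<le> n" "1 \<le> n" "k \<le> n" using n(1) by auto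
  have "D / c < n" using k n1(3) by linarith
  then have "D < c * n" using c(1) by (simp add: field_simps)
  then have 1: "- 2 * c * n \<le> ln (max (a n) (exp (- real n)))" using n(2) by simp
  have "c * n < 1/2 * n" using c n1(2) by (intro mult_strict_right_mono) auto
  then have "- real n < ln (max (a n) (exp (- real n)))" using 1 by linarith
  then have "ln (exp (- real n)) < ln (max (a n) (exp (- real n)))" by simp
  then have "exp (- real n) < max (a n) (exp (- real n))"
    by (metis exp_gt_zero less_max_iff_disj ln_less_cancel_iff)
  then have max: "max (a n) (exp (- real n)) = a n" and pos: "0 < a n"
    using exp_gt_zero[of "- real n"] by (auto simp: max_def split: if_splits intro: less_trans[OF exp_gt_zero])
  have "- 2 * c \<le> 1 / real n * ln (a n)"
    using 1 n1(2) unfolding max by (simp add: field_simps)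
  then have "ereal (- 2 * c) \<le> ereal (1 / real n) * log_ereal (a n)"
    using pos by (simp add: log_ereal_def)
  then show False using N[OF n1(1)] by simp
qed

context riemannian
begin

text \<open>Otherwise the truncated logarithmic norms satisfy the assumption of
  \<open>ergodic_measure_nonneg_growth\<close>, and the resulting ergodic measure has nonnegative
  exponent almost everywhere, against the hypothesis.\<close>

lemma exists_contracting_iterate:
  fixes K :: "('t::metric_space \<times> 'x) set"
  assumes comp: "compact (UNIV :: 't set)" and f: "forced_C1_map A \<omega> f"
    and K: "compact K" "K \<noteq> {}" "f ` K \<subseteq> K"
    and neg: "\<And>\<nu>. ergodic_measure f \<nu> \<Longrightarrow> emeasure \<nu> K = 1 \<Longrightarrow> lyapunov_max_measure A g f \<nu> < 0"
  shows "\<exists>n\<ge>1. \<forall>p\<in>K. fibre_deriv_norm (f ^^ n) p < 1"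
proof (rule ccontr)
  assume no: "\<not> ?thesis"
  define d where "d n p = max (fibre_deriv_norm (f ^^ n) p) (exp (- real n))" for n p
  \<comment> \<open>Continuity of the derivative norm is available for positive iterates only, hence
    the separate value at time 0.\<close>
  define b where "b n p = (if n = 0 then 0 else ln (d n p))" for n p
  have d0: "0 < d n p" for n p by (simp add: d_def less_max_iff_disj)
  have fn: "forced_C1_map A (\<omega> ^^ n) (f ^^ n)" if "1 \<le> n" for n
    by (rule forced_C1_map_funpow[OF f that])
  obtain B1 :: "'t set set" where B1: "countable B1" "topological_basis B1"
    using compact_UNIV_countable_base[OF comp] by blast
  obtain B2 :: "'x set set" where B2: "countable B2" "topological_basis B2"
    using ex_countable_basis by blast
  define B where "B = (\<lambda>(a, b). a \<times> b) ` (B1 \<times> B2)"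
  interpret subadditive_cocycle K B f b
  proof
    show "countable B" unfolding B_def using B1 B2 by simp
    show "topological_basis B" unfolding B_def by (rule topological_basis_prod[OF B1(2) B2(2)])
    show "continuous_on K (b n)" for n
    proof (cases "n = 0")
      case True
      then show ?thesis by (simp add: b_def[abs_def])
    next
      case False
      then have "continuous_on K (d n)"
        unfolding d_def
        by (intro continuous_intros continuous_on_subset[OF continuous_fibre_deriv_norm[OF fn]]) auto
      then have "continuous_on K (\<lambda>p. ln (d n p))"
        using d0 by (intro continuous_intros) (auto simp: less_imp_neq[THEN not_sym])
      then show ?thesis using False by (simp add: b_def[abs_def])
    qed
    fix m n :: nat and p assume mn: "1 \<le> m" "1 \<le> n"
    have "d (m + n) p \<le> d m p * d n ((f ^^ m) p)"
      unfolding d_def[of "m + n"]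
    proof (rule max.boundedI)
      have "fibre_deriv_norm (f ^^ (m + n)) p \<le> fibre_deriv_norm (f ^^ n) ((f ^^ m) p) * fibre_deriv_norm (f ^^ m) p"
        unfolding add.commute[of m n] funpow_add by (rule fibre_deriv_norm_compose[OF fn[OF mn(1)] fn[OF mn(2)]])
      also have "\<dots> \<le> d n ((f ^^ m) p) * d m p"
        using d0[of n "(f ^^ m) p"]
        by (intro mult_mono fibre_deriv_norm_nonneg[OF fn[OF mn(1)]]) (auto simp: d_def)
      finally show "fibre_deriv_norm (f ^^ (m + n)) p \<le> d m p * d n ((f ^^ m) p)" by (simp add: mult.commute)
      have "exp (- real (m + n)) = exp (- real m) * exp (- real n)" by (simp add: exp_add[symmetric])
      also have "\<dots> \<le> d m p * d n ((f ^^ m) p)"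
        using d0[of m p] by (intro mult_mono) (auto simp: d_def)
      finally show "exp (- real (m + n)) \<le> d m p * d n ((f ^^ m) p)" .
    qed
    then have "ln (d (m + n) p) \<le> ln (d m p * d n ((f ^^ m) p))"
      using d0 by (intro ln_mono) auto
    also have "\<dots> = ln (d m p) + ln (d n ((f ^^ m) p))" by (rule ln_mult_pos[OF d0 d0])
    finally show "b (m + n) p \<le> b m p + b n ((f ^^ m) p)" using mn by (simp add: b_def)
  qed (use K f in \<open>auto intro: forced_continuous\<close>)
  have "\<exists>p\<in>K. 0 \<le> b n p" if n: "1 \<le> n" for n
  proof -
    obtain p where p: "p \<in> K" "1 \<le> fibre_deriv_norm (f ^^ n) p" using no n by (auto simp: not_less)
    then have "1 \<le> d n p" by (simp add: d_def le_max_iff_disj)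
    then show ?thesis using p(1) n by (intro bexI[of _ p]) (auto simp: b_def)
  qed
  then obtain \<nu> where \<nu>: "sets \<nu> = sets borel" "emeasure \<nu> UNIV = 1" "emeasure \<nu> K = 1" "distr \<nu> borel f = \<nu>"
    "\<forall>S\<in>sets borel. f -` S = S \<longrightarrow> emeasure \<nu> S = 0 \<or> emeasure \<nu> S = 1"
    "\<forall>c>0. AE p in \<nu>. p \<in> K \<and> (\<exists>D. \<exists>\<^sub>\<infinity>n. - c * n - D \<le> b n p)"
    using ergodic_measure_nonneg_growth by blast
  have "space \<nu> = UNIV" using sets_eq_imp_space_eq[OF \<nu>(1)] by simp
  then have "ergodic_measure f \<nu>"
    using \<nu>(1-5) by (simp add: ergodic_measure_def invariant_measure_def)
  from neg[OF this \<nu>(3)] have lneg: "lyapunov_max_measure A g f \<nu> < 0" .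
  \<comment> \<open>Countably many rates allow the quantifier inside the almost everywhere
    statement; the 3 keeps each rate below 1/2, as \<open>limsup_growth\<close> requires.\<close>
  have "AE p in \<nu>. \<forall>j::nat. \<exists>D. \<exists>\<^sub>\<infinity>n. - (1 / (real j + 3)) * n - D \<le> b n p"
    unfolding AE_all_countable
  proof
    fix j :: nat
    have "0 < 1 / (real j + 3)" by simp
    from \<nu>(6)[rule_format, OF this] show "AE p in \<nu>. \<exists>D. \<exists>\<^sub>\<infinity>n. - (1 / (real j + 3)) * n - D \<le> b n p"
      by eventually_elim blast
  qed
  then have "AE p in \<nu>. e2ennreal (- lyapunov_max A g f p) = 0"
  proof eventually_elim
    case (elim p)
    have lya: "lyapunov_max A g f p = limsup (\<lambda>n. ereal (1 / real n) * log_ereal (fibre_deriv_norm (f ^^ n) p))"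
      by (simp add: lyapunov_max_def case_prod_unfold fibre_deriv_norm_def fibre_map_funpow[of f])
    \<comment> \<open>Nonnegativity is known for positive iterates only; the value at 0 does not
      affect the limsup.\<close>
    define a where "a n = (if n = 0 then 0 else fibre_deriv_norm (f ^^ n) p)" for n
    have a0: "0 \<le> a n" for n
      using fibre_deriv_norm_nonneg[OF fn] by (simp add: a_def)
    have lya: "lyapunov_max A g f p = limsup (\<lambda>n. ereal (1 / real n) * log_ereal (a n))"
      unfolding lya by (intro Limsup_eq eventually_sequentiallyI[of 1]) (auto simp: a_def)
    have lower: "ereal (- 2 * (1 / (real j + 3))) \<le> lyapunov_max A g f p" for j :: nat
    proof -
      obtain D where D: "\<exists>\<^sub>\<infinity>n. - (1 / (real j + 3)) * n - D \<le> b n p" using elim by blast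
      have "\<exists>\<^sub>\<infinity>n. - (1 / (real j + 3)) * n - D \<le> ln (max (a n) (exp (- real n)))"
        unfolding INFM_nat_le
      proof
        fix m
        obtain n where n: "max m 1 \<le> n" "- (1 / (real j + 3)) * n - D \<le> b n p"
          using D unfolding INFM_nat_le by blast
        then have "b n p = ln (max (a n) (exp (- real n)))" by (auto simp: b_def d_def a_def)
        then show "\<exists>n\<ge>m. - (1 / (real j + 3)) * n - D \<le> ln (max (a n) (exp (- real n)))"
          using n by (intro exI[of _ n]) auto
      qed
      then show ?thesis unfolding lya by (intro limsup_growth[OF a0]) (auto simp: field_simps)
    qed
    have "(\<lambda>j. ereal (- 2 * (1 / (real j + 3)))) \<longlonglongrightarrow> ereal 0"
    proof -
      have "(\<lambda>j. 1 / real (j + 3)) \<longlonglongrightarrow> 0"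
        by (rule LIMSEQ_ignore_initial_segment[OF lim_1_over_n])
      then have "(\<lambda>j. - 2 * (1 / real (j + 3))) \<longlonglongrightarrow> - 2 * 0"
        by (intro tendsto_mult tendsto_const)
      then show ?thesis by (intro tendsto_ereal) (simp add: add.commute)
    qed
    then have "ereal 0 \<le> lyapunov_max A g f p"
      by (rule LIMSEQ_le_const2) (intro exI[of _ 0] allI impI lower)
    then show ?case by (simp add: e2ennreal_neg zero_ereal_def[symmetric])
  qed
  \<comment> \<open>The negative part vanishes almost everywhere, so the integrated exponent equals
    the integral of the positive part and cannot be negative.\<close>
  then have "(\<integral>\<^sup>+ p. e2ennreal (- lyapunov_max A g f p) \<partial>\<nu>) = (\<integral>\<^sup>+ p. 0 \<partial>\<nu>)"
    by (rule nn_integral_cong_AE)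
  then have "lyapunov_max_measure A g f \<nu> = enn2ereal (\<integral>\<^sup>+ p. e2ennreal (lyapunov_max A g f p) \<partial>\<nu>)"
    by (simp add: lyapunov_max_measure_def ereal_integral_def zero_ennreal.rep_eq)
  then show False using lneg enn2ereal_nonneg by (metis not_less)
qed

end

theorem theorem5p3:
  fixes \<omega> :: "'t::metric_space \<Rightarrow> 't"
    and A :: "('x::{t2_space, second_countable_topology}, 'e::{real_normed_vector, heine_borel}) chart set"
    and g :: "('x, 'e) chart \<Rightarrow> 'x \<Rightarrow> 'e \<Rightarrow>\<^sub>L 'e \<Rightarrow>\<^sub>L real"
    and f :: "'t \<times> 'x \<Rightarrow> 't \<times> 'x"
    and K :: "('t \<times> 'x) set"
  assumes "compact (UNIV :: 't set)"
    and "minimal_homeomorphism \<omega>"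
    and "riemannian_manifold A g"
    and "forced_C1_map A \<omega> f"
    and "K \<noteq> {}" and "compact K" and "f ` K = K"
    and "\<And>\<nu>. ergodic_measure f \<nu> \<Longrightarrow> emeasure \<nu> K = 1 \<Longrightarrow> lyapunov_max_measure A g f \<nu> < 0"
  shows "\<exists>k \<psi>. k \<ge> 1 \<and> (\<forall>\<theta>. \<psi> \<theta> \<in> config_space k) \<and>
           continuous_config (riemannian_dist A g) k \<psi> \<and>
           K = {(\<theta>, \<psi> \<theta> i) | \<theta> i. i \<in> {1..k}}"
proof -
  interpret riemannian A g by unfold_locales (rule assms(3))
  obtain \<omega>' where \<omega>': "homeomorphism UNIV UNIV \<omega> \<omega>'"
    using assms(2) unfolding minimal_homeomorphism_def by blast
  obtain n where n: "1 \<le> n" "\<forall>p\<in>K. fibre_deriv_norm (f ^^ n) p < 1"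
    using exists_contracting_iterate[OF assms(1,4,6,5) equalityD1[OF assms(7)] assms(8)] by blast
  obtain V where V: "open V" "\<forall>\<theta> x. (\<theta>, x) \<in> K \<longrightarrow> (\<theta>, x, x) \<in> V"
    "\<forall>W. open W \<longrightarrow> (\<forall>\<theta> x. (\<theta>, x) \<in> K \<longrightarrow> (\<theta>, x, x) \<in> W) \<longrightarrow>
      (\<exists>I. \<forall>i\<ge>I. \<forall>\<theta> x y. (\<theta>, x) \<in> K \<longrightarrow> (\<theta>, y) \<in> K \<longrightarrow> (\<theta>, x, y) \<in> V \<longrightarrow>
        (pair_step f ^^ i) (\<theta>, x, y) \<in> W)"
    using contraction_attracting[OF assms(4,6,5) equalityD1[OF assms(7)] n]
    by (elim exE conjE) (rule that)
  interpret fibred_attractor \<omega> \<omega>' f K V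
  proof
    show "S = {} \<or> S = UNIV" if "closed S" "\<omega> ` S = S" for S
      using assms(2) that unfolding minimal_homeomorphism_def by blast
    show "fst (f p) = \<omega> (fst p)" for p by (rule forced_fst[OF assms(4)])
    show "\<exists>I. \<forall>i\<ge>I. \<forall>\<theta> x y. (\<theta>, x) \<in> K \<longrightarrow> (\<theta>, y) \<in> K \<longrightarrow> (\<theta>, x, y) \<in> V \<longrightarrow>
        ((\<omega> ^^ i) \<theta>, snd ((f ^^ i) (\<theta>, x)), snd ((f ^^ i) (\<theta>, y))) \<in> W"
      if "open W" "\<And>\<theta> x. (\<theta>, x) \<in> K \<Longrightarrow> (\<theta>, x, x) \<in> W" for W
      using V(3)[rule_format, OF that(1)] that(2)
      by (simp add: pair_step_funpow[of f \<omega>, OF forced_fst[OF assms(4)]])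
  qed (use assms V \<omega>' in auto)
  obtain k where k: "1 \<le> k" "\<And>\<theta>. finite (fibre \<theta>)" "\<And>\<theta>. card (fibre \<theta>) = k"
    using fibres_constant_card by metis
  have "\<exists>h. bij_betw h {1..k} (fibre \<theta>)" for \<theta>
    using ex_bij_betw_nat_finite_1[OF k(2)[of \<theta>]] k(3) by simp
  then obtain h where h: "\<And>\<theta>. bij_betw (h \<theta>) {1..k} (fibre \<theta>)" by metis
  \<comment> \<open>The fibres are enumerated independently of each other, as continuity concerns
    only the set of entries; the restriction makes the enumeration extensional, as
    \<open>config_space\<close> demands.\<close>
  define \<psi> where "\<psi> \<theta> = restrict (h \<theta>) {1..k}" for \<theta>
  have bij: "bij_betw (\<psi> \<theta>) {1..k} (fibre \<theta>)" for \<theta>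
  proof -
    have "bij_betw (\<psi> \<theta>) {1..k} (fibre \<theta>) = bij_betw (h \<theta>) {1..k} (fibre \<theta>)"
      by (rule bij_betw_cong) (simp add: \<psi>_def)
    then show ?thesis using h by simp
  qed
  then have img: "\<psi> \<theta> ` {1..k} = fibre \<theta>" for \<theta>
    by (simp add: bij_betw_def)
  have "\<psi> \<theta> \<in> config_space k" for \<theta>
    using bij[of \<theta>] by (auto simp: config_space_def \<psi>_def bij_betw_def)
  moreover have "continuous_config (riemannian_dist A g) k \<psi>"
    unfolding continuous_config_def img
  proof
    fix \<theta>
    show "((\<lambda>\<theta>'. hausdorff_dist (riemannian_dist A g) (fibre \<theta>') (fibre \<theta>)) \<longlongrightarrow> 0) (at \<theta>)"
    proof (rule order_tendstoI)
      fix a :: ennreal assume "0 < a"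
      then obtain e where e: "0 < e" "ennreal e < a"
        by (metis dense ennreal_cases ennreal_less_zero_iff not_less_iff_gr_or_eq order_less_imp_not_less top.not_eq_extremum)
      obtain U where U: "\<And>z. open (U z)" "\<And>z. z \<in> U z"
          "\<And>z y. y \<in> U z \<Longrightarrow> riemannian_dist A g y z \<le> ennreal e"
        using riemannian_dist_small[OF e(1)] by metis
      have "eventually (\<lambda>\<theta>'. (\<forall>x\<in>fibre \<theta>'. \<exists>z\<in>fibre \<theta>. x \<in> U z) \<and> (\<forall>z\<in>fibre \<theta>. \<exists>x\<in>fibre \<theta>'. x \<in> U z)) (at \<theta>)"
        by (rule filter_leD[OF at_within_le_nhds fibres_continuous]) (simp add: U)
      then show "eventually (\<lambda>\<theta>'. hausdorff_dist (riemannian_dist A g) (fibre \<theta>') (fibre \<theta>) < a) (at \<theta>)"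
      proof eventually_elim
        case (elim \<theta>')
        have "(SUP x\<in>fibre \<theta>'. INF y\<in>fibre \<theta>. riemannian_dist A g x y) \<le> ennreal e"
        proof (rule SUP_least)
          fix x assume "x \<in> fibre \<theta>'"
          then obtain z where "z \<in> fibre \<theta>" "x \<in> U z" using elim by blast
          then show "(INF y\<in>fibre \<theta>. riemannian_dist A g x y) \<le> ennreal e"
            by (intro INF_lower2[of z] U(3))
        qed
        moreover have "(SUP y\<in>fibre \<theta>. INF x\<in>fibre \<theta>'. riemannian_dist A g x y) \<le> ennreal e"
        proof (rule SUP_least)
          fix z assume "z \<in> fibre \<theta>"
          then obtain x where "x \<in> fibre \<theta>'" "x \<in> U z" using elim by blast
          then show "(INF x\<in>fibre \<theta>'. riemannian_dist A g x z) \<le> ennreal e"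
            by (intro INF_lower2[of x] U(3))
        qed
        ultimately show ?case
          unfolding hausdorff_dist_def using e(2) by (simp add: le_less_trans)
      qed
    qed simp
  qed
  moreover have "K = {(\<theta>, \<psi> \<theta> i) | \<theta> i. i \<in> {1..k}}"
  proof (intro equalityI subsetI)
    fix p assume "p \<in> K"
    then have "snd p \<in> \<psi> (fst p) ` {1..k}" by (simp add: img fibre_def)
    then show "p \<in> {(\<theta>, \<psi> \<theta> i) | \<theta> i. i \<in> {1..k}}" by (cases p) auto
  next
    fix p assume "p \<in> {(\<theta>, \<psi> \<theta> i) | \<theta> i. i \<in> {1..k}}"
    then obtain \<theta> i where p: "p = (\<theta>, \<psi> \<theta> i)" "i \<in> {1..k}" by blast
    have "\<psi> \<theta> i \<in> fibre \<theta>" unfolding img[symmetric] using p(2) by (rule imageI)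
    then show "p \<in> K" by (simp add: p(1) fibre_def)
  qed
  ultimately show ?thesis using k(1) by blast
qed


end
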